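(* Let $M$ be an infinite-horizon discounted-reward MDP with MNL transitions and discount factor $\gamma\in[0,1)$, satisfying (A1)–(A3). Let $\delta\in(0,1)$, $\eta=\frac12\log\mathcal{U}+(L_\theta L_\varphi+1)$, $\lambda\ge84\sqrt2(L_\theta L_\varphi^3+dL_\varphi^2)\eta$, and $N\ge\log(\sqrt T/d)/(1-\gamma)$. Then the (non-stationary) policy $\pi$ of \texttt{UCMNLK} run with discount $\gamma$ guarantees, with probability at least $1-2\delta$, $\mathrm{Regret}(\pi,T)=\tilde{\mathcal O}\big(f(L_\theta,L_\varphi)(d(1-\gamma)^{-2}\sqrt T+\kappa^{-1}d^2(1-\gamma)^{-2})\big)$, where $f$ is a polynomial in $(L_\theta,L_\varphi)$ and $\tilde{\mathcal O}$ hides logarithmic factors of $T,\mathcal U,1/\delta$.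
   Context: MDP: finite $\mathcal{S},\mathcal{A}$, known reward $r:\mathcal{S}\times\mathcal{A}\to[0,1]$; known reachable sets $\mathcal{S}_{s,a}$ and features $\varphi(s,a,s')\in\mathbb{R}^d$; transitions $p(s'\mid s,a,\theta^* )$ with $p(s'\mid s,a,\theta)=\exp(\varphi(s,a,s')^\top\theta)/\sum_{s''\in\mathcal{S}_{s,a}}\exp(\varphi(s,a,s'')^\top\theta)$ on $\mathcal{S}_{s,a}$; $\mathcal U=\max|\mathcal{S}_{s,a}|$. For a history-dependent policy $\pi$, $V^\pi_t(s)=\mathbb{E}[\sum_{i\ge0}\gamma^ir(s_{t+i},a_{t+i})\mid s_t=s]$ (given the history); $V^*(s)=\max_\pi V^\pi_1(s)$; $\mathrm{Regret}(\pi,T)=\sum_{t=1}^TV^*(s_t)-\sum_{t=1}^TV^\pi_t(s_t)$. Assumptions: (A1) $\|\varphi\|_2\le L_\varphi$, $\|\theta^*\|_2\le L_\theta$, $\Theta=\{\|\theta\|_2\le L_\theta\}$; (A2) $\kappa\in(0,1)$ with $\inf_{\theta\in\Theta}p(s'\mid s_t,a_t,\theta)p(s''\mid s_t,a_t,\theta)\ge\kappa$ for all $t\in[T]$, $s',s''\in\mathcal{S}_{s_t,a_t}$; (A3) each $\mathcal{S}_{s,a}$ contains $s'$ with $\varphi(s,a,s')=0$. Estimator, confidence polytopes $\mathcal{P}_t$ (with radii $\beta_t=f_0(L_\theta,L_\varphi)\sqrt d(\log(\mathcal Ut/\delta))^2$, $f_0$ a fixed polynomial for which $\|\widehat\theta_t-\theta^*\|_{\Sigma_t}\le\beta_t$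 for all $t$ w.p. $\ge1-\delta$), \texttt{DEVI} and \texttt{UCMNLK}: exactly as follows. $\ell_t(\theta)=-\sum_{s'\in\mathcal{S}_{s_t,a_t}}\mathbf1\{s_{t+1}=s'\}\log p(s'\mid s_t,a_t,\theta)$; $\widehat\theta_1=0$, $\Sigma_1=\lambda I_d$, $\widehat\Sigma_t=\Sigma_t+\eta\nabla^2\ell_t(\widehat\theta_t)$, $\widehat\theta_{t+1}=\arg\min_{\theta\in\Theta}\{\nabla\ell_t(\widehat\theta_t)^\top(\theta-\widehat\theta_t)+\frac1{2\eta}\|\theta-\widehat\theta_t\|^2_{\widehat\Sigma_t}\}$, $\Sigma_{t+1}=\Sigma_t+\nabla^2\ell_t(\widehat\theta_{t+1})$. $\mathcal P_t$: all $p\in[0,1]^{\mathcal S\times\mathcal A\times\mathcal S}$ with $\sum_{s'\in\mathcal S_{s,a}}p_{s,a,s'}=1$ and $\sum_{s'\in\mathcal S_{s,a}}|p_{s,a,s'}-p(s'\mid s,a,\widehat\theta_t)|\le\beta_t\sum_{s'}p(s'\mid s,a,\widehat\theta_t)\|\varphi(s,a,s')-\sum_{s''}p(s''\mid s,a,\widehat\theta_t)\varphi(s,a,s'')\|_{\Sigma_t^{-1}}+3\beta_t^2\max_{s'}\|\varphi(s,a,s')\|^2_{\Sigma_t^{-1}}$ for all $(s,a)$. \texttt{DEVI}$(\gamma,\mathcal P,N)$: $Q^{(0)}\equiv1/(1-\gamma)$, $V^{(n-1)}(s)=\max_aQ^{(n-1)}(s,a)$, $Q^{(n)}(s,a)=r(s,a)+\gamma\max_{p\in\mathcal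 P}\sum_{s'\in\mathcal S_{s,a}}p_{s,a,s'}V^{(n-1)}(s')$ for $n=1..N$, return $Q^{(N)}$. \texttt{UCMNLK}: for episodes $k$: $t_k=t$, $Q_k=\texttt{DEVI}(\gamma,\mathcal P_{t_k},N)$, $\pi_k(s)\in\arg\max_aQ_k(s,a)$; while $\det\Sigma_t\le2\det\Sigma_{t_k}$, play $a_t=\pi_k(s_t)$, observe $s_{t+1}$, update, $t\leftarrow t+1$. *)

theory Defs
  imports "Jordan_Normal_Form.Gauss_Jordan_Elimination" "Jordan_Normal_Form.Determinant"
          "HOL-Probability.Probability_Mass_Function"
begin

definition poly2 :: "(real \<Rightarrow> real \<Rightarrow> real) \<Rightarrow> bool" where
  "poly2 f \<longleftrightarrow> (\<exists>n::nat. \<exists>c::nat \<Rightarrow> nat \<Rightarrow> real.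
      \<forall>x y. f x y = (\<Sum>i\<le>n. \<Sum>j\<le>n. c i j * x ^ i * y ^ j))"

definition vnorm :: "real Matrix.vec \<Rightarrow> real" where
  "vnorm x = sqrt (scalar_prod x x)"

definition wnorm :: "real mat \<Rightarrow> real Matrix.vec \<Rightarrow> real" where
  "wnorm M x = sqrt (scalar_prod x (M *\<^sub>v x))"

definition minv :: "real mat \<Rightarrow> real mat" where
  "minv M = the (mat_inverse M)"

definition pdiff :: "nat \<Rightarrow> (real Matrix.vec \<Rightarrow> real) \<Rightarrow> real Matrix.vec \<Rightarrow> nat \<Rightarrow> real" where
  "pdiff d f \<theta> i = deriv (\<lambda>x. f (Matrix.vec d (\<lambda>j. if j = i then x else vec_index \<theta> j))) (vec_index \<theta> i)"

definition grad :: "nat \<Rightarrow> (real Matrix.vec \<Rightarrow> real) \<Rightarrow> real Matrix.vec \<Rightarrow> real Matrix.vec" where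
  "grad d f \<theta> = Matrix.vec d (pdiff d f \<theta>)"

definition hess :: "nat \<Rightarrow> (real Matrix.vec \<Rightarrow> real) \<Rightarrow> real Matrix.vec \<Rightarrow> real mat" where
  "hess d f \<theta> = Matrix.mat d d (\<lambda>(i, j). pdiff d (\<lambda>\<theta>'. pdiff d f \<theta>' i) \<theta> j)"

definition Theta :: "nat \<Rightarrow> real \<Rightarrow> real Matrix.vec set" where
  "Theta d L\<theta> = {\<theta> \<in> carrier_vec d. vnorm \<theta> \<le> L\<theta>}"

text \<open>States and actions are natural numbers; Ssa s a is the reachable set,
  phi s a s' the feature vector.\<close>

definition mnl :: "(nat \<Rightarrow> nat \<Rightarrow> nat \<Rightarrow> real Matrix.vec) \<Rightarrow> (nat \<Rightarrow> nat \<Rightarrow> nat set)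
    \<Rightarrow> real Matrix.vec \<Rightarrow> nat \<Rightarrow> nat \<Rightarrow> nat \<Rightarrow> real" where
  "mnl \<phi> Ssa \<theta> s a s' =
     (if s' \<in> Ssa s a then exp (scalar_prod (\<phi> s a s') \<theta>) /
        (\<Sum>s''\<in>Ssa s a. exp (scalar_prod (\<phi> s a s'') \<theta>)) else 0)"

definition trans_pmf :: "(nat \<Rightarrow> nat \<Rightarrow> nat \<Rightarrow> real Matrix.vec) \<Rightarrow> (nat \<Rightarrow> nat \<Rightarrow> nat set)
    \<Rightarrow> real Matrix.vec \<Rightarrow> nat \<Rightarrow> nat \<Rightarrow> nat pmf" where
  "trans_pmf \<phi> Ssa \<theta> s a = embed_pmf (mnl \<phi> Ssa \<theta> s a)"

text \<open>A history at time t is ([(s_1,a_1),...,(s_{t-1},a_{t-1})], s_t).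
  A (possibly randomized) history-dependent policy maps histories to action distributions.\<close>

type_synonym hist = "(nat \<times> nat) list \<times> nat"

definition step_pmf :: "(nat \<Rightarrow> nat \<Rightarrow> nat pmf) \<Rightarrow> (hist \<Rightarrow> nat pmf) \<Rightarrow> hist \<Rightarrow> hist pmf" where
  "step_pmf P \<pi> h = bind_pmf (\<pi> h) (\<lambda>a. map_pmf (\<lambda>s'. (fst h @ [(snd h, a)], s')) (P (snd h) a))"

fun run_pmf :: "(nat \<Rightarrow> nat \<Rightarrow> nat pmf) \<Rightarrow> (hist \<Rightarrow> nat pmf) \<Rightarrow> hist \<Rightarrow> nat \<Rightarrow> hist pmf" where
  "run_pmf P \<pi> h 0 = return_pmf h"
| "run_pmf P \<pi> h (Suc n) = bind_pmf (run_pmf P \<pi> h n) (step_pmf P \<pi>)"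

definition Vpi :: "real \<Rightarrow> (nat \<Rightarrow> nat \<Rightarrow> real) \<Rightarrow> (nat \<Rightarrow> nat \<Rightarrow> nat pmf)
    \<Rightarrow> (hist \<Rightarrow> nat pmf) \<Rightarrow> hist \<Rightarrow> real" where
  "Vpi \<gamma> r P \<pi> h = (\<Sum>i. \<gamma> ^ i * measure_pmf.expectation (run_pmf P \<pi> h i)
       (\<lambda>h'. measure_pmf.expectation (\<pi> h') (\<lambda>a. r (snd h') a)))"

definition policies :: "nat set \<Rightarrow> (hist \<Rightarrow> nat pmf) set" where
  "policies A = {\<pi>. \<forall>h. set_pmf (\<pi> h) \<subseteq> A}"

definition Vstar :: "real \<Rightarrow> (nat \<Rightarrow> nat \<Rightarrow> real) \<Rightarrow> (nat \<Rightarrow> nat \<Rightarrow> nat pmf) \<Rightarrow> nat set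
    \<Rightarrow> nat \<Rightarrow> real" where
  "Vstar \<gamma> r P A s = (SUP \<pi> \<in> policies A. Vpi \<gamma> r P \<pi> ([], s))"

text \<open>Prefix of a history: the history at time i+1 (i = 0,1,...).\<close>
definition hprefix :: "hist \<Rightarrow> nat \<Rightarrow> hist" where
  "hprefix h i = (take i (fst h), if i < length (fst h) then fst (fst h ! i) else snd h)"

text \<open>Regret(pi,T) = sum_{t=1}^T V*(s_t) - V^pi_t(s_t), as a function of the history at time T.\<close>
definition regret :: "real \<Rightarrow> (nat \<Rightarrow> nat \<Rightarrow> real) \<Rightarrow> (nat \<Rightarrow> nat \<Rightarrow> nat pmf) \<Rightarrow> nat set
    \<Rightarrow> (hist \<Rightarrow> nat pmf) \<Rightarrow> nat \<Rightarrow> hist \<Rightarrow> real" where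
  "regret \<gamma> r P A \<pi> T h = (\<Sum>i<T. Vstar \<gamma> r P A (snd (hprefix h i)))
                         - (\<Sum>i<T. Vpi \<gamma> r P \<pi> (hprefix h i))"

definition transitions :: "hist \<Rightarrow> (nat \<times> nat \<times> nat) list" where
  "transitions h = map (\<lambda>i. (fst (fst h ! i), snd (fst h ! i),
        if Suc i < length (fst h) then fst (fst h ! Suc i) else snd h)) [0..<length (fst h)]"

record ucparams =
  pS :: "nat set"
  pA :: "nat set"
  rew :: "nat \<Rightarrow> nat \<Rightarrow> real"
  pSsa :: "nat \<Rightarrow> nat \<Rightarrow> nat set"
  phi :: "nat \<Rightarrow> nat \<Rightarrow> nat \<Rightarrow> real Matrix.vec"
  dim :: nat
  Lth :: real
  disc :: real
  eta :: real
  lam :: real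
  del :: real
  NN :: nat
  beta :: "nat \<Rightarrow> real"

definition UU :: "nat set \<Rightarrow> nat set \<Rightarrow> (nat \<Rightarrow> nat \<Rightarrow> nat set) \<Rightarrow> nat" where
  "UU S A Ssa = Max {card (Ssa s a) | s a. s \<in> S \<and> a \<in> A}"

definition beta0 :: "(real \<Rightarrow> real \<Rightarrow> real) \<Rightarrow> real \<Rightarrow> real \<Rightarrow> nat \<Rightarrow> nat \<Rightarrow> real \<Rightarrow> nat \<Rightarrow> real" where
  "beta0 f0 L\<theta> L\<phi> d U \<delta> t = f0 L\<theta> L\<phi> * sqrt (real d) * (ln (real U * real t / \<delta>)) ^ 2"

definition mean_feat :: "ucparams \<Rightarrow> real Matrix.vec \<Rightarrow> nat \<Rightarrow> nat \<Rightarrow> real Matrix.vec" where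
  "mean_feat M \<theta> s a = Matrix.vec (dim M) (\<lambda>j. \<Sum>s''\<in>pSsa M s a. mnl (phi M) (pSsa M) \<theta> s a s'' * vec_index (phi M s a s'') j)"

definition conf_set :: "ucparams \<Rightarrow> real Matrix.vec \<Rightarrow> real mat \<Rightarrow> real \<Rightarrow> (nat \<Rightarrow> nat \<Rightarrow> nat \<Rightarrow> real) set" where
  "conf_set M \<theta> \<Sigma> b = {p. \<forall>s\<in>pS M. \<forall>a\<in>pA M.
      (\<forall>s'\<in>pS M. 0 \<le> p s a s' \<and> p s a s' \<le> 1) \<and>
      (\<Sum>s'\<in>pSsa M s a. p s a s') = 1 \<and>
      (\<Sum>s'\<in>pSsa M s a. \<bar>p s a s' - mnl (phi M) (pSsa M) \<theta> s a s'\<bar>)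
        \<le> b * (\<Sum>s'\<in>pSsa M s a. mnl (phi M) (pSsa M) \<theta> s a s' *
                  wnorm (minv \<Sigma>) (phi M s a s' - mean_feat M \<theta> s a))
          + 3 * b ^ 2 * Max ((\<lambda>s'. (wnorm (minv \<Sigma>) (phi M s a s')) ^ 2) ` pSsa M s a)}"

fun devi :: "ucparams \<Rightarrow> (nat \<Rightarrow> nat \<Rightarrow> nat \<Rightarrow> real) set \<Rightarrow> nat \<Rightarrow> nat \<Rightarrow> nat \<Rightarrow> real" where
  "devi M P 0 s a = 1 / (1 - disc M)"
| "devi M P (Suc n) s a = rew M s a + disc M *
      (SUP p\<in>P. \<Sum>s'\<in>pSsa M s a. p s a s' * Max ((\<lambda>a'. devi M P n s' a') ` pA M))"

definition Pset :: "ucparams \<Rightarrow> nat \<Rightarrow> real Matrix.vec \<Rightarrow> real mat \<Rightarrow> (nat \<Rightarrow> nat \<Rightarrow> nat \<Rightarrow> real) set" where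
  "Pset M t \<theta> \<Sigma> = conf_set M \<theta> \<Sigma> (beta M t)"

definition loss :: "ucparams \<Rightarrow> nat \<Rightarrow> nat \<Rightarrow> nat \<Rightarrow> real Matrix.vec \<Rightarrow> real" where
  "loss M s a s2 \<theta> = - (\<Sum>s'\<in>pSsa M s a. (if s2 = s' then 1 else 0) * ln (mnl (phi M) (pSsa M) \<theta> s a s'))"

text \<open>Algorithm state before acting at time t: (theta_hat_t, Sigma_t, Sigma_{t_k}, Q_k).\<close>
type_synonym astate = "real Matrix.vec \<times> real mat \<times> real mat \<times> (nat \<Rightarrow> nat \<Rightarrow> real)"

definition alg_init :: "ucparams \<Rightarrow> astate" where
  "alg_init M = (let \<theta> = 0\<^sub>v (dim M); \<Sigma> = lam M \<cdot>\<^sub>m 1\<^sub>m (dim M)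
     in (\<theta>, \<Sigma>, \<Sigma>, devi M (Pset M 1 \<theta> \<Sigma>) (NN M)))"

text \<open>Process the transition (s_t,a_t,s_{t+1}) at time t, then (at time t+1) start a new
  episode if det Sigma_{t+1} > 2 det Sigma_{t_k}.\<close>
definition alg_next :: "ucparams \<Rightarrow> nat \<Rightarrow> nat \<times> nat \<times> nat \<Rightarrow> astate \<Rightarrow> astate" where
  "alg_next M t tr st = (case tr of (s, a, s2) \<Rightarrow> case st of (\<theta>, \<Sigma>, \<Sigma>k, Q) \<Rightarrow>
     let lt = loss M s a s2;
         d = dim M;
         \<Sigma>h = \<Sigma> + eta M \<cdot>\<^sub>m hess d lt \<theta>;
         obj = (\<lambda>x. scalar_prod (grad d lt \<theta>) (x - \<theta>)
                    + 1 / (2 * eta M) * (wnorm \<Sigma>h (x - \<theta>)) ^ 2);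
         \<theta>' = (SOME \<theta>'. \<theta>' \<in> Theta d (Lth M) \<and> (\<forall>x\<in>Theta d (Lth M). obj \<theta>' \<le> obj x));
         \<Sigma>' = \<Sigma> + hess d lt \<theta>'
     in if Determinant.det \<Sigma>' \<le> 2 * Determinant.det \<Sigma>k then (\<theta>', \<Sigma>', \<Sigma>k, Q)
        else (\<theta>', \<Sigma>', \<Sigma>', devi M (Pset M (Suc t) \<theta>' \<Sigma>') (NN M)))"

fun alg_run_from :: "ucparams \<Rightarrow> nat \<Rightarrow> (nat \<times> nat \<times> nat) list \<Rightarrow> astate \<Rightarrow> astate" where
  "alg_run_from M t [] st = st"
| "alg_run_from M t (tr # trs) st = alg_run_from M (Suc t) trs (alg_next M t tr st)"

text \<open>Algorithm state at time length(xs)+1 after processing transitions xs (from time 1).\<close>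
definition alg_state :: "ucparams \<Rightarrow> (nat \<times> nat \<times> nat) list \<Rightarrow> astate" where
  "alg_state M xs = alg_run_from M 1 xs (alg_init M)"

text \<open>The UCMNL-K policy; sel is the (arbitrary) argmax tie-breaking rule.\<close>
definition ucmnlk :: "ucparams \<Rightarrow> ((nat \<Rightarrow> nat \<Rightarrow> real) \<Rightarrow> nat \<Rightarrow> nat) \<Rightarrow> hist \<Rightarrow> nat" where
  "ucmnlk M sel h = (case alg_state M (transitions h) of (\<theta>, \<Sigma>, \<Sigma>k, Q) \<Rightarrow> sel Q (snd h))"

definition ucmnlk_pol :: "ucparams \<Rightarrow> ((nat \<Rightarrow> nat \<Rightarrow> real) \<Rightarrow> nat \<Rightarrow> nat) \<Rightarrow> hist \<Rightarrow> nat pmf" where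
  "ucmnlk_pol M sel h = return_pmf (ucmnlk M sel h)"

end

theory Submission
  imports Defs "HOL-Probability.Hoeffding"
begin

text \<open>
  On the event that the estimates stay in their confidence ellipsoids, a second-order expansion of
  the softmax shows that the true kernel lies in every confidence polytope, so \<open>DEVI\<close> is optimistic:
  its value dominates that of every policy. Unrolling the Bellman equations along the trajectory
  then bounds \<open>1 - \<gamma>\<close> times the regret by the \<open>L1\<close> diameters of the polytopes at the visited pairs, a
  bounded martingale (Azuma), one term \<open>1 / (1 - \<gamma>)\<close> per new episode, and the truncation error
  \<open>T \<gamma>^N\<close>.

  All matrices \<open>\<Sigma>\<^sub>t\<close> arise from \<open>\<lambda> I\<close> by rank-one updates, since the Hessian of the loss is the
  covariance of the features. The matrix determinant lemma and the Sherman-Morrison formula therefore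
  yield the elliptical potential bound, the comparison of \<open>\<Sigma>\<^sub>t\<close> with the \<open>\<Sigma>\<close> at the start of the
  episode, and the bound on the number of episodes, without any spectral theory. The covariance trace
  \<open>x\<^sub>t\<close> controls both terms of the polytope radius: its square root bounds the first-order width, and
  \<open>x\<^sub>t / \<kappa>\<close> bounds \<open>max \<parallel>\<phi>\<parallel>\<^sup>2\<close> because one feature vector is zero. When \<open>d > \<surd>T\<close> the bound is trivial;
  otherwise the Leibniz formula is enough to estimate \<open>ln det \<Sigma>\<^sub>T\<close>.
\<close>

text \<open>The difficulty is a mismatch of reference points. The polytope in use at time t is
  centred at the estimate of the episode start j and measured by the inverse of \<open>Sg j\<close>,
  while the covariance added at time t is taken at the estimate after the step. The bridge has three
  pieces. The form \<open>det A\<close> times \<open>x . A^-1 x\<close>, which belongs to the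
  adjugate, only grows under rank-one updates, so a determinant ratio of at most 2 transfers norms
  at the price of a factor 2. Both estimates are close to the true parameter in their own norms,
  hence in that of \<open>Sg j\<close>. The centred width is Lipschitz in the parameter with a
  factor quadratic in the features, so moving its centre costs another term of the kind that
  \<kappa> controls. The bound on \<lambda> is used as
  \<open>4 * L\<phi>\<^sup>2 \<le> \<lambda>\<close>, which keeps every \<open>x\<^sub>t\<close> in
  [0, 1], where it is at most \<open>2 * ln (1 + x\<^sub>t)\<close>. If \<open>L\<phi> = 0\<close>
  this allows \<lambda> = 0 and a singular matrix, which is treated separately. Of the failure
  probability, one \<delta> pays for the estimates and the other for the martingale.\<close>

section \<open>Polynomials in two variables\<close>

lemma poly_eq_sum_atMost:
  fixes q :: "'a :: comm_semiring_1 poly"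
  assumes "degree q \<le> n" shows "poly q z = (\<Sum>i\<le>n. coeff q i * z ^ i)"
  unfolding poly_altdef using assms by (intro sum.mono_neutral_left) (auto simp: coeff_eq_0)

text \<open>A bivariate polynomial is viewed as a polynomial in \<open>x\<close> with coefficients
  in the polynomials in \<open>y\<close>, so closure of \<open>poly2\<close> under ring operations
  is inherited from the ring \<open>real poly poly\<close>.\<close>

lemma poly2_iff_poly_poly:
  "poly2 f \<longleftrightarrow> (\<exists>p :: real poly poly. \<forall>x y. f x y = poly (poly p [:x:]) y)"
proof
  assume "poly2 f"
  then obtain n c where f: "\<And>x y. f x y = (\<Sum>i\<le>n. \<Sum>j\<le>n. c i j * x ^ i * y ^ j)"
    unfolding poly2_def by blast
  have "f x y = poly (poly (\<Sum>i\<le>n. monom (\<Sum>j\<le>n. monom (c i j) j) i) [:x:]) y" for x y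
    by (simp add: f poly_sum poly_monom sum_distrib_right sum_distrib_left mult_ac poly_power)
  then show "\<exists>p :: real poly poly. \<forall>x y. f x y = poly (poly p [:x:]) y" by blast
next
  assume "\<exists>p :: real poly poly. \<forall>x y. f x y = poly (poly p [:x:]) y"
  then obtain p :: "real poly poly" where f: "\<And>x y. f x y = poly (poly p [:x:]) y" by blast
  \<comment> \<open>\<open>poly2\<close> uses one bound for both exponents, so \<open>n\<close>
    dominates the outer degree and the degrees of all coefficients.\<close>
  define n where "n = Max (insert (degree p) ((\<lambda>i. degree (coeff p i)) ` {..degree p}))"
  have n1: "degree p \<le> n" by (simp add: n_def)
  have n2: "degree (coeff p i) \<le> n" for i
  proof (cases "i \<le> degree p")
    case True then show ?thesis unfolding n_def by (intro Max_ge) auto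
  qed (simp add: coeff_eq_0)
  have "f x y = (\<Sum>i\<le>n. \<Sum>j\<le>n. coeff (coeff p i) j * x ^ i * y ^ j)" for x y
  proof -
    have "f x y = (\<Sum>i\<le>n. poly (coeff p i) y * x ^ i)"
      unfolding f by (subst poly_eq_sum_atMost, rule n1) (simp add: poly_sum poly_power)
    also have "\<dots> = (\<Sum>i\<le>n. \<Sum>j\<le>n. coeff (coeff p i) j * x ^ i * y ^ j)"
      by (rule sum.cong[OF refl], subst poly_eq_sum_atMost, rule n2) (simp add: sum_distrib_left mult_ac)
    finally show ?thesis .
  qed
  then show "poly2 f" unfolding poly2_def
    by (intro exI[of _ n] exI[of _ "\<lambda>i j. coeff (coeff p i) j"]) blast
qed

text \<open>The final \<open>f\<close> has this shape because the regret bound contains both F and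
  F^2 for the value F of \<open>f0\<close>, and \<open>2 * F\<close> is at most
  \<open>1 + F^2\<close>.\<close>

lemma poly2_affine_square:
  assumes "poly2 f" shows "poly2 (\<lambda>x y. a * (1 + (f x y)\<^sup>2))"
proof -
  obtain p :: "real poly poly" where f: "\<And>x y. f x y = poly (poly p [:x:]) y"
    using assms unfolding poly2_iff_poly_poly by blast
  have "a * (1 + (f x y)\<^sup>2) = poly (poly ([:[:a:]:] * (1 + p\<^sup>2)) [:x:]) y" for x y
    by (simp add: f poly_power)
  then show ?thesis unfolding poly2_iff_poly_poly by blast
qed

section \<open>Softmax along a line\<close>

text \<open>A multinomial logit model restricted to a line in parameter space: \<open>c\<close>
  holds the logits at the origin of the line, \<open>x\<close> their slopes. Segments between two
  parameters serve the perturbation bounds, coordinate lines the partial derivatives of the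
  loss.\<close>

locale softmax_line =
  fixes I :: "'a set" and c x :: "'a \<Rightarrow> real"
  assumes fin: "finite I" and ne: "I \<noteq> {}"
begin

definition Z :: "real \<Rightarrow> real" where "Z u = (\<Sum>j\<in>I. exp (c j + u * x j))"
definition p :: "real \<Rightarrow> 'a \<Rightarrow> real" where "p u i = exp (c i + u * x i) / Z u"
definition avg :: "real \<Rightarrow> real" where "avg u = (\<Sum>i\<in>I. p u i * x i)"
definition var :: "real \<Rightarrow> real" where "var u = (\<Sum>i\<in>I. p u i * (x i - avg u)\<^sup>2)"

lemma Z_pos: "Z u > 0" unfolding Z_def using fin ne by (intro sum_pos) auto
lemma p_pos: "p u i > 0" unfolding p_def using Z_pos by simp
lemma sum_p: "(\<Sum>i\<in>I. p u i) = 1"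
  unfolding p_def sum_divide_distrib[symmetric] using Z_pos[of u] by (simp add: Z_def)

lemma deriv_Z: "(Z has_real_derivative Z u * avg u) (at u)"
proof -
  have "(Z has_real_derivative (\<Sum>j\<in>I. exp (c j + u * x j) * x j)) (at u)"
    unfolding Z_def by (auto intro!: derivative_eq_intros sum.cong)
  moreover have "(\<Sum>j\<in>I. exp (c j + u * x j) * x j) = Z u * avg u"
    using Z_pos[of u] by (simp add: avg_def p_def sum_distrib_left)
  ultimately show ?thesis by simp
qed

lemma deriv_p: "((\<lambda>u. p u i) has_real_derivative p u i * (x i - avg u)) (at u)"
proof -
  have "((\<lambda>u. exp (c i + u * x i) / Z u) has_real_derivative p u i * (x i - avg u)) (at u)"
    using Z_pos[of u]
    by (auto intro!: derivative_eq_intros deriv_Z simp: p_def field_simps power2_eq_square)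
  then show ?thesis by (simp add: p_def)
qed

lemma avg_diff: "(\<Sum>i\<in>I. p u i * (x i - avg u)) = 0"
  using sum_p[of u] by (simp add: right_diff_distrib sum_subtractf avg_def flip: sum_distrib_right)

lemma var_alt: "var u = (\<Sum>i\<in>I. p u i * (x i)\<^sup>2) - (avg u)\<^sup>2"
proof -
  have "var u = (\<Sum>i\<in>I. p u i * (x i)\<^sup>2 - 2 * avg u * (p u i * x i) + (avg u)\<^sup>2 * p u i)"
    unfolding var_def by (rule sum.cong) (auto simp: power2_eq_square algebra_simps)
  also have "\<dots> = (\<Sum>i\<in>I. p u i * (x i)\<^sup>2) - 2 * avg u * avg u + (avg u)\<^sup>2 * 1"
    by (simp add: sum.distrib sum_subtractf avg_def sum_p flip: sum_distrib_left)
  finally show ?thesis by (simp add: power2_eq_square)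
qed

lemma deriv_avg: "(avg has_real_derivative var u) (at u)"
proof -
  have "(avg has_real_derivative (\<Sum>i\<in>I. p u i * (x i - avg u) * x i)) (at u)"
    unfolding avg_def [abs_def] by (auto intro!: derivative_eq_intros deriv_p sum.cong simp: avg_def)
  moreover have "(\<Sum>i\<in>I. p u i * (x i - avg u) * x i) = var u"
    by (simp add: var_alt algebra_simps sum_subtractf power2_eq_square avg_def sum_distrib_left)
  ultimately show ?thesis by simp
qed

lemma deriv2_p: "((\<lambda>u. p u i * (x i - avg u)) has_real_derivative p u i * ((x i - avg u)\<^sup>2 - var u)) (at u)"
  by (auto intro!: derivative_eq_intros deriv_p deriv_avg simp: power2_eq_square algebra_simps)

context
  fixes m :: real assumes m: "\<And>i. i \<in> I \<Longrightarrow> \<bar>x i\<bar> \<le> m"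
begin

lemma avg_bound: "\<bar>avg u\<bar> \<le> m"
proof -
  have "\<bar>avg u\<bar> \<le> (\<Sum>i\<in>I. p u i * m)"
    unfolding avg_def by (rule order.trans[OF sum_abs])
      (auto intro!: sum_mono mult_left_mono m simp: abs_mult less_imp_le[OF p_pos] abs_of_pos[OF p_pos])
  then show ?thesis by (simp add: sum_p flip: sum_distrib_right)
qed

lemma m_nonneg: "m \<ge> 0" using ne m by (meson abs_ge_zero all_not_in_conv order.trans)

lemma var_bound: "var u \<le> m\<^sup>2"
proof -
  have "(\<Sum>i\<in>I. p u i * (x i)\<^sup>2) \<le> (\<Sum>i\<in>I. p u i * m\<^sup>2)"
    by (intro sum_mono mult_left_mono) (auto simp: less_imp_le[OF p_pos] m_nonneg intro!: power2_le_iff_abs_le[THEN iffD2] m)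
  also have "\<dots> = m\<^sup>2" by (simp add: sum_p flip: sum_distrib_right)
  finally show ?thesis by (simp add: var_alt)
      (use zero_le_power2[of "avg u"] in linarith)
qed

text \<open>Freezing the signs of the endpoint differences turns the L1 distance into the increment
  of a fixed linear functional of \<open>p u\<close>, which is smooth in \<open>u\<close> and so
  open to Taylor expansion.\<close>

lemma abs_diff_eq_signed:
  "(\<Sum>i\<in>I. \<bar>p 1 i - p 0 i\<bar>) = (\<Sum>i\<in>I. sgn (p 1 i - p 0 i) * p 1 i) - (\<Sum>i\<in>I. sgn (p 1 i - p 0 i) * p 0 i)"
  by (simp add: sum_subtractf[symmetric] right_diff_distrib[symmetric] sgn_if abs_if cong: if_cong)
     (auto intro!: sum.cong)

lemma sum_signed_le:
  fixes \<sigma> y :: "'a \<Rightarrow> real"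
  assumes "\<And>i. \<bar>\<sigma> i\<bar> \<le> 1" shows "\<bar>\<Sum>i\<in>I. \<sigma> i * y i\<bar> \<le> (\<Sum>i\<in>I. \<bar>y i\<bar>)"
  by (rule order.trans[OF sum_abs]) (auto intro!: sum_mono mult_left_le_one_le assms simp: abs_mult)

text \<open>The mean value theorem for the signed functional; its derivative is at most
  \<open>2 * m\<close> because each \<open>x i\<close> and the average lie in
  \<open>[-m, m]\<close>.\<close>

theorem l1_lipschitz: "(\<Sum>i\<in>I. \<bar>p 1 i - p 0 i\<bar>) \<le> 2 * m"
proof -
  define \<sigma> where "\<sigma> i = sgn (p 1 i - p 0 i)" for i
  define g where "g u = (\<Sum>i\<in>I. \<sigma> i * p u i)" for u
  have \<sigma>: "\<bar>\<sigma> i\<bar> \<le> 1" for i by (simp add: \<sigma>_def abs_sgn_eq)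
  have "(g has_real_derivative (\<Sum>i\<in>I. \<sigma> i * (p u i * (x i - avg u)))) (at u)" for u
    unfolding g_def by (auto intro!: derivative_eq_intros deriv_p sum.cong)
  then obtain z where "g 1 - g 0 = (1 - 0) * (\<Sum>i\<in>I. \<sigma> i * (p z i * (x i - avg z)))"
    using MVT2[of 0 1 g "\<lambda>u. \<Sum>i\<in>I. \<sigma> i * (p u i * (x i - avg u))"] by auto
  moreover have "(\<Sum>i\<in>I. \<sigma> i * (p z i * (x i - avg z))) \<le> (\<Sum>i\<in>I. p z i * (2 * m))"
  proof -
    have "\<bar>x i - avg z\<bar> \<le> 2 * m" if "i \<in> I" for i using m[OF that] avg_bound[of z] by linarith
    then have "(\<Sum>i\<in>I. \<bar>p z i * (x i - avg z)\<bar>) \<le> (\<Sum>i\<in>I. p z i * (2 * m))"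
      by (intro sum_mono) (simp add: abs_mult abs_of_pos[OF p_pos] mult_left_mono less_imp_le[OF p_pos])
    with sum_signed_le[where \<sigma> = \<sigma> and y = "\<lambda>i. p z i * (x i - avg z)", OF \<sigma>] show ?thesis by linarith
  qed
  moreover have "(\<Sum>i\<in>I. p z i * (2 * m)) = 2 * m" by (simp add: sum_p flip: sum_distrib_right)
  ultimately show ?thesis unfolding abs_diff_eq_signed g_def \<sigma>_def by simp
qed

text \<open>Second-order Taylor expansion of the signed functional at 0. The remainder is half of at
  most \<open>2 * var\<close>: one \<open>var\<close> comes from the squared deviations, the other
  from the subtracted variance.\<close>

theorem l1_second_order: "(\<Sum>i\<in>I. \<bar>p 1 i - p 0 i\<bar>) \<le> (\<Sum>i\<in>I. p 0 i * \<bar>x i - avg 0\<bar>) + m\<^sup>2"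
proof -
  define \<sigma> where "\<sigma> i = sgn (p 1 i - p 0 i)" for i
  define g0 where "g0 u = (\<Sum>i\<in>I. \<sigma> i * p u i)" for u
  define g1 where "g1 u = (\<Sum>i\<in>I. \<sigma> i * (p u i * (x i - avg u)))" for u
  define g2 where "g2 u = (\<Sum>i\<in>I. \<sigma> i * (p u i * ((x i - avg u)\<^sup>2 - var u)))" for u
  define g where "g n = (if n = 0 then g0 else if n = 1 then g1 else g2)" for n :: nat
  have \<sigma>: "\<bar>\<sigma> i\<bar> \<le> 1" for i by (simp add: \<sigma>_def abs_sgn_eq)
  have d0: "(g0 has_real_derivative g1 u) (at u)" for u
    unfolding g0_def g1_def by (auto intro!: derivative_eq_intros deriv_p sum.cong)
  have d1: "(g1 has_real_derivative g2 u) (at u)" for u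
    unfolding g1_def g2_def by (intro DERIV_sum DERIV_cmult deriv2_p)
  have "\<exists>t>0. t < 1 \<and> g0 1 = (\<Sum>k<2. g k 0 / fact k * 1 ^ k) + g 2 t / fact 2 * 1 ^ 2"
  proof (rule Maclaurin)
    show "\<forall>k t. k < 2 \<and> 0 \<le> t \<and> t \<le> 1 \<longrightarrow> (g k has_real_derivative g (Suc k) t) (at t)"
      using d0 d1 by (auto simp: g_def less_2_cases_iff)
  qed (auto simp: g_def)
  then obtain z where z: "g0 1 - g0 0 = g1 0 + g2 z / 2"
    by (auto simp: g_def numeral_2_eq_2)
  have "g1 0 \<le> (\<Sum>i\<in>I. \<bar>p 0 i * (x i - avg 0)\<bar>)"
    using sum_signed_le[where \<sigma> = \<sigma> and y = "\<lambda>i. p 0 i * (x i - avg 0)", OF \<sigma>] unfolding g1_def by linarith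
  then have 1: "g1 0 \<le> (\<Sum>i\<in>I. p 0 i * \<bar>x i - avg 0\<bar>)"
    by (simp add: abs_mult abs_of_pos[OF p_pos])
  have v0: "var z \<ge> 0" unfolding var_def by (intro sum_nonneg) (auto simp: less_imp_le[OF p_pos])
  have "g2 z \<le> (\<Sum>i\<in>I. \<bar>p z i * ((x i - avg z)\<^sup>2 - var z)\<bar>)"
    using sum_signed_le[where \<sigma> = \<sigma> and y = "\<lambda>i. p z i * ((x i - avg z)\<^sup>2 - var z)", OF \<sigma>] unfolding g2_def by linarith
  also have "\<dots> \<le> (\<Sum>i\<in>I. p z i * (x i - avg z)\<^sup>2 + p z i * var z)"
  proof (rule sum_mono)
    fix i
    have "\<bar>(x i - avg z)\<^sup>2 - var z\<bar> \<le> (x i - avg z)\<^sup>2 + var z"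
      using v0 zero_le_power2[of "x i - avg z"] by linarith
    then show "\<bar>p z i * ((x i - avg z)\<^sup>2 - var z)\<bar> \<le> p z i * (x i - avg z)\<^sup>2 + p z i * var z"
      using p_pos[of z i] by (simp add: abs_mult flip: distrib_left)
  qed
  also have "\<dots> = 2 * var z"
    by (simp add: sum.distrib sum_p var_def flip: sum_distrib_right)
  also have "\<dots> \<le> 2 * m\<^sup>2" using var_bound by simp
  finally have 2: "g2 z / 2 \<le> m\<^sup>2" by simp
  show ?thesis using z 1 2 unfolding abs_diff_eq_signed g0_def \<sigma>_def by linarith
qed

end
end

section \<open>Rank-one updates of positive definite matrices\<close>

definition psd :: "nat \<Rightarrow> real mat \<Rightarrow> bool" where
  "psd d A \<longleftrightarrow> A \<in> carrier_mat d d \<and>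
     (\<forall>x\<in>carrier_vec d. \<forall>y\<in>carrier_vec d. scalar_prod x (A *\<^sub>v y) = scalar_prod y (A *\<^sub>v x)) \<and>
     (\<forall>x\<in>carrier_vec d. 0 \<le> scalar_prod x (A *\<^sub>v x))"

text \<open>For a positive semidefinite matrix a positive determinant is equivalent to definiteness,
  and the determinant is what the episode test and the rank-one formulas track.\<close>

definition pd :: "nat \<Rightarrow> real mat \<Rightarrow> bool" where
  "pd d A \<longleftrightarrow> psd d A \<and> 0 < Determinant.det A"

lemma psdD:
  assumes "psd d A"
  shows "A \<in> carrier_mat d d"
    and "x \<in> carrier_vec d \<Longrightarrow> y \<in> carrier_vec d \<Longrightarrow> scalar_prod x (A *\<^sub>v y) = scalar_prod y (A *\<^sub>v x)"
    and "x \<in> carrier_vec d \<Longrightarrow> 0 \<le> scalar_prod x (A *\<^sub>v x)"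
  using assms unfolding psd_def by blast+

lemma square_le_if_quadratic_nonneg:
  fixes a b c :: real
  assumes "\<And>t. 0 \<le> a + 2 * t * b + t\<^sup>2 * c" and c: "c \<ge> 0"
  shows "b\<^sup>2 \<le> a * c"
proof (cases "c = 0")
  case True
  have "b = 0"
  proof (rule ccontr)
    assume "b \<noteq> 0"
    \<comment> \<open>The witness makes \<open>a + 2 * t * b\<close> equal to
      \<open>-1\<close>.\<close>
    with assms(1)[of "- (a + 1) / (2 * b)"] True show False by (simp add: field_simps)
  qed
  with True show ?thesis by simp
next
  case False
  with c have "c > 0" by simp
  with assms(1)[of "- b / c"] show ?thesis by (simp add: field_simps power2_eq_square)
qed

lemma smult_mat_vec_one:
  "v \<in> carrier_vec d \<Longrightarrow> (a \<cdot>\<^sub>m 1\<^sub>m d) *\<^sub>v v = a \<cdot>\<^sub>v (v :: real Matrix.vec)"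
  by (intro eq_vecI) auto

lemma psd_quadratic_add:
  assumes A: "psd d A" and x: "x \<in> carrier_vec d" and y: "y \<in> carrier_vec d"
  shows "scalar_prod (x + t \<cdot>\<^sub>v y) (A *\<^sub>v (x + t \<cdot>\<^sub>v y)) =
    scalar_prod x (A *\<^sub>v x) + 2 * t * scalar_prod x (A *\<^sub>v y) + t\<^sup>2 * scalar_prod y (A *\<^sub>v y)"
proof -
  note c = psdD(1)[OF A]
  have Ax: "A *\<^sub>v x \<in> carrier_vec d" and Ay: "A *\<^sub>v y \<in> carrier_vec d" using c x y by auto
  have "A *\<^sub>v (x + t \<cdot>\<^sub>v y) = A *\<^sub>v x + t \<cdot>\<^sub>v (A *\<^sub>v y)"
    using c x y by (simp add: mult_add_distrib_mat_vec[OF c] mult_mat_vec[OF c])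
  then show ?thesis
    using x y Ax Ay psdD(2)[OF A y x]
    by (simp add: scalar_prod_add_distrib[of _ d] add_scalar_prod_distrib[of _ d]
        power2_eq_square algebra_simps)
qed

lemma psd_cauchy_schwarz:
  assumes A: "psd d A" and x: "x \<in> carrier_vec d" and y: "y \<in> carrier_vec d"
  shows "(scalar_prod x (A *\<^sub>v y))\<^sup>2 \<le> scalar_prod x (A *\<^sub>v x) * scalar_prod y (A *\<^sub>v y)"
proof (rule square_le_if_quadratic_nonneg)
  show "0 \<le> scalar_prod x (A *\<^sub>v x) + 2 * t * scalar_prod x (A *\<^sub>v y) + t\<^sup>2 * scalar_prod y (A *\<^sub>v y)" for t
    unfolding psd_quadratic_add[OF assms, symmetric] using psdD(3)[OF A] x y by simp
qed (rule psdD(3)[OF A y])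

lemma wnorm_nonneg: "psd d A \<Longrightarrow> x \<in> carrier_vec d \<Longrightarrow> 0 \<le> wnorm A x"
  using psdD(3) by (simp add: wnorm_def)

lemma wnorm_square: "psd d A \<Longrightarrow> x \<in> carrier_vec d \<Longrightarrow> (wnorm A x)\<^sup>2 = scalar_prod x (A *\<^sub>v x)"
  using psdD(3) by (simp add: wnorm_def)

lemma wnorm_cauchy_schwarz:
  assumes "psd d A" "x \<in> carrier_vec d" "y \<in> carrier_vec d"
  shows "\<bar>scalar_prod x (A *\<^sub>v y)\<bar> \<le> wnorm A x * wnorm A y"
  using real_sqrt_le_mono[OF psd_cauchy_schwarz[OF assms]]
  by (simp add: wnorm_def real_sqrt_mult)

lemma wnorm_smult:
  assumes A: "psd d A" and x: "x \<in> carrier_vec d"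
  shows "wnorm A (k \<cdot>\<^sub>v x) = \<bar>k\<bar> * wnorm A x"
proof -
  have "A *\<^sub>v x \<in> carrier_vec d" using psdD(1)[OF A] x by simp
  then have "scalar_prod (k \<cdot>\<^sub>v x) (A *\<^sub>v (k \<cdot>\<^sub>v x)) = k\<^sup>2 * scalar_prod x (A *\<^sub>v x)"
    using x by (simp add: mult_mat_vec[OF psdD(1)[OF A] x] power2_eq_square)
  then show ?thesis by (simp add: wnorm_def real_sqrt_mult)
qed

lemma wnorm_add:
  assumes A: "psd d A" and x: "x \<in> carrier_vec d" and y: "y \<in> carrier_vec d"
  shows "wnorm A (x + y) \<le> wnorm A x + wnorm A y"
proof (rule power2_le_imp_le)
  have "(wnorm A (x + y))\<^sup>2 = (wnorm A x)\<^sup>2 + 2 * scalar_prod x (A *\<^sub>v y) + (wnorm A y)\<^sup>2"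
    using psd_quadratic_add[OF assms, of 1] x y by (simp add: wnorm_square[OF A])
  also have "\<dots> \<le> (wnorm A x + wnorm A y)\<^sup>2"
    using wnorm_cauchy_schwarz[OF assms] by (simp add: power2_sum)
  finally show "(wnorm A (x + y))\<^sup>2 \<le> (wnorm A x + wnorm A y)\<^sup>2" .
qed (use assms in \<open>simp add: wnorm_nonneg\<close>)

lemma wnorm_zero: "psd d A \<Longrightarrow> wnorm A (0\<^sub>v d) = 0"
  using psdD(1)[of d A] by (simp add: wnorm_def)

lemma wnorm_minus_commute:
  assumes A: "psd d A" and x: "x \<in> carrier_vec d" and y: "y \<in> carrier_vec d"
  shows "wnorm A (x - y) = wnorm A (y - x)"
proof -
  have "x - y = (-1) \<cdot>\<^sub>v (y - x)" using x y by (intro eq_vecI) auto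
  then show ?thesis using wnorm_smult[OF A, of "y - x" "-1"] x y by simp
qed

lemma wnorm_triangle:
  assumes A: "psd d A" and x: "x \<in> carrier_vec d" and y: "y \<in> carrier_vec d" and z: "z \<in> carrier_vec d"
  shows "wnorm A (x - z) \<le> wnorm A (x - y) + wnorm A (y - z)"
proof -
  have "x - z = (x - y) + (y - z)" using x y z by (intro eq_vecI) auto
  then show ?thesis using wnorm_add[OF A, of "x - y" "y - z"] x y z by simp
qed

lemma wnorm_sum:
  assumes A: "psd d A" and "finite I" and "\<And>i. i \<in> I \<Longrightarrow> v i \<in> carrier_vec d"
  shows "wnorm A (Matrix.vec d (\<lambda>j. \<Sum>i\<in>I. c i * vec_index (v i) j)) \<le> (\<Sum>i\<in>I. \<bar>c i\<bar> * wnorm A (v i))"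
  using assms(2,3)
proof (induction I rule: finite_induct)
  case empty
  have "Matrix.vec d (\<lambda>j. 0 :: real) = 0\<^sub>v d" by auto
  then show ?case by (simp add: wnorm_zero[OF A])
next
  case (insert a I)
  let ?w = "Matrix.vec d (\<lambda>j. \<Sum>i\<in>I. c i * vec_index (v i) j)"
  have "Matrix.vec d (\<lambda>j. \<Sum>i\<in>insert a I. c i * vec_index (v i) j) = c a \<cdot>\<^sub>v v a + ?w"
    using insert.hyps insert.prems[of a] by (intro eq_vecI) auto
  then show ?case
    using wnorm_add[OF A, of "c a \<cdot>\<^sub>v v a" ?w] insert wnorm_smult[OF A, of "v a" "c a"] by auto
qed

lemma pd_minv:
  assumes "pd d A"
  shows "minv A \<in> carrier_mat d d" "A * minv A = 1\<^sub>m d" "minv A * A = 1\<^sub>m d"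
proof -
  have A: "A \<in> carrier_mat d d" and dA: "Determinant.det A \<noteq> 0"
    using assms psdD(1) by (auto simp: pd_def)
  have "A \<in> Units (ring_mat TYPE(real) d ())" by (rule det_non_zero_imp_unit[OF A dA])
  then have "mat_inverse A \<noteq> None" using mat_inverse(1)[OF A, of "()"] by fast
  then obtain B where "mat_inverse A = Some B" by fast
  with mat_inverse(2)[OF A this]
  show "minv A \<in> carrier_mat d d" "A * minv A = 1\<^sub>m d" "minv A * A = 1\<^sub>m d"
    by (auto simp: minv_def)
qed

lemma pd_psd: "pd d A \<Longrightarrow> psd d A" by (simp add: pd_def)
lemma pd_carrier: "pd d A \<Longrightarrow> A \<in> carrier_mat d d" by (simp add: pd_def psd_def)

lemma pd_solve:
  assumes A: "pd d A" and x: "x \<in> carrier_vec d"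
  shows "minv A *\<^sub>v x \<in> carrier_vec d" "A *\<^sub>v (minv A *\<^sub>v x) = x" "minv A *\<^sub>v (A *\<^sub>v x) = x"
proof -
  note c = pd_carrier[OF A] and I = pd_minv[OF A]
  show "minv A *\<^sub>v x \<in> carrier_vec d" using I(1) x by simp
  show "A *\<^sub>v (minv A *\<^sub>v x) = x"
    unfolding assoc_mult_mat_vec[OF c I(1) x, symmetric] I(2) using x by simp
  show "minv A *\<^sub>v (A *\<^sub>v x) = x"
    unfolding assoc_mult_mat_vec[OF I(1) c x, symmetric] I(3) using x by simp
qed

lemma psd_minv:
  assumes A: "pd d A" shows "psd d (minv A)"
  unfolding psd_def
proof (intro conjI ballI)
  show "minv A \<in> carrier_mat d d" by (rule pd_minv[OF A])
  fix x :: "real Matrix.vec" assume x: "x \<in> carrier_vec d"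
  let ?u = "minv A *\<^sub>v x"
  note u = pd_solve[OF A x]
  have "0 \<le> scalar_prod ?u (A *\<^sub>v ?u)" using psdD(3)[OF pd_psd[OF A] u(1)] .
  then show "0 \<le> scalar_prod x ?u" using u x comm_scalar_prod[OF u(1) x] by simp
  fix y :: "real Matrix.vec" assume y: "y \<in> carrier_vec d"
  note v = pd_solve[OF A y]
  have "scalar_prod ?u (A *\<^sub>v (minv A *\<^sub>v y)) = scalar_prod (minv A *\<^sub>v y) (A *\<^sub>v ?u)"
    by (rule psdD(2)[OF pd_psd[OF A] u(1) v(1)])
  then show "scalar_prod x (minv A *\<^sub>v y) = scalar_prod y ?u"
    using u v comm_scalar_prod[OF u(1) y] comm_scalar_prod[OF v(1) x] by simp
qed

text \<open>With \<open>y\<close> written as \<open>A^-1 (A y)\<close> this is Cauchy-Schwarz for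
  \<open>minv A\<close>, since the \<open>minv A\<close> norm of \<open>A y\<close> is the
  \<open>A\<close> norm of \<open>y\<close>.\<close>

lemma dual_cauchy_schwarz:
  assumes A: "pd d A" and x: "x \<in> carrier_vec d" and y: "y \<in> carrier_vec d"
  shows "\<bar>scalar_prod x y\<bar> \<le> wnorm (minv A) x * wnorm A y"
proof -
  have Ay: "A *\<^sub>v y \<in> carrier_vec d" using pd_carrier[OF A] y by simp
  have "wnorm (minv A) (A *\<^sub>v y) = wnorm A y"
    using pd_solve[OF A y] comm_scalar_prod[OF y Ay] by (simp add: wnorm_def)
  then show ?thesis
    using wnorm_cauchy_schwarz[OF psd_minv[OF A] x Ay] pd_solve(3)[OF A y] by simp
qed

section \<open>Matrix determinant lemma and Sherman-Morrison formula\<close>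

definition outer :: "real Matrix.vec \<Rightarrow> real mat" where
  "outer y = Matrix.mat (dim_vec y) (dim_vec y) (\<lambda>(i, j). vec_index y i * vec_index y j)"

lemma outer_carrier [simp]: "y \<in> carrier_vec d \<Longrightarrow> outer y \<in> carrier_mat d d"
  by (auto simp: outer_def)

lemma outer_mult_vec:
  assumes "y \<in> carrier_vec d" "x \<in> carrier_vec d"
  shows "outer y *\<^sub>v x = scalar_prod y x \<cdot>\<^sub>v y"
  using assms
  by (intro eq_vecI) (auto simp: outer_def scalar_prod_def sum_distrib_left sum_distrib_right mult_ac)

lemma det_add_outer:
  assumes A: "pd d A" and y: "y \<in> carrier_vec d"
  shows "Determinant.det (A + outer y) = Determinant.det A * (1 + scalar_prod y (minv A *\<^sub>v y))"
proof -
  define R where "R = Matrix.mat 1 d (\<lambda>(i, j). vec_index y j)"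
  define C where "C = Matrix.mat d 1 (\<lambda>(i, j). vec_index y i)"
  \<comment> \<open>The determinant of \<open>M\<close> is computed from both Schur complements:
    multiplication by \<open>L1\<close> clears the lower left block and leaves
    \<open>A + outer y\<close>, multiplication by \<open>L2\<close> clears the upper right block and
    leaves the scalar \<open>1 + y . A^-1 y\<close>. Both factors have determinant 1.\<close>
  define M where "M = four_block_mat A (- C) R (1\<^sub>m 1)"
  define L1 where "L1 = four_block_mat (1\<^sub>m d) (0\<^sub>m d 1) (- R) (1\<^sub>m 1)"
  define L2 where "L2 = four_block_mat (1\<^sub>m d) (minv A * C) (0\<^sub>m 1 d) (1\<^sub>m 1)"
  note Ac = pd_carrier[OF A] and I = pd_minv[OF A]
  have R: "R \<in> carrier_mat 1 d" and C: "C \<in> carrier_mat d 1" by (auto simp: R_def C_def)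
  have IC: "minv A * C \<in> carrier_mat d 1" using I C by simp
  have M: "M \<in> carrier_mat (d + 1) (d + 1)" and L1: "L1 \<in> carrier_mat (d + 1) (d + 1)"
    and L2: "L2 \<in> carrier_mat (d + 1) (d + 1)"
    unfolding M_def L1_def L2_def using Ac R C IC by (auto intro!: four_block_carrier_mat)
  have dL1: "Determinant.det L1 = 1" unfolding L1_def
    using R by (subst det_four_block_mat_upper_right_zero[of _ d _ 1]) auto
  have dL2: "Determinant.det L2 = 1" unfolding L2_def
    using IC by (subst det_four_block_mat_lower_left_zero[of _ d _ 1]) auto
  have R0: "R + - R = 0\<^sub>m 1 d" using R by (intro eq_matI) auto
  have CR: "A + C * R = A + outer y"
    using Ac y by (intro eq_matI) (auto simp: C_def R_def outer_def scalar_prod_def)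
  have "M * L1 = four_block_mat (A + outer y) (- C) (0\<^sub>m 1 d) (1\<^sub>m 1)"
    unfolding M_def L1_def
    using Ac R C by (subst mult_four_block_mat[of _ d d _ 1 _ 1 _ _ d _ 1])
      (simp_all add: CR R0[simplified])
  then have 1: "Determinant.det M = Determinant.det (A + outer y)"
    using det_mult[OF M L1] dL1 Ac y C
    by (simp add: det_four_block_mat_lower_left_zero[of _ d _ 1])
  have AIC: "A * (minv A * C) = C"
    using assoc_mult_mat[OF Ac I(1) C] I(2) C by simp
  have "M * L2 = four_block_mat A (0\<^sub>m d 1) R (R * (minv A * C) + 1\<^sub>m 1)"
    unfolding M_def L2_def
    using Ac R C IC by (subst mult_four_block_mat[of _ d d _ 1 _ 1 _ _ d _ 1]) (auto simp: AIC)
  moreover have "R * (minv A * C) + 1\<^sub>m 1 \<in> carrier_mat 1 1" using R IC by auto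
  ultimately have "Determinant.det M = Determinant.det A * Determinant.det (R * (minv A * C) + 1\<^sub>m 1)"
    using det_mult[OF M L2] dL2 Ac R IC
    by (simp add: det_four_block_mat_upper_right_zero[of _ d _ 1])
  also have "Determinant.det (R * (minv A * C) + 1\<^sub>m 1) = 1 + scalar_prod y (minv A *\<^sub>v y)"
  proof -
    have rR: "Matrix.row R 0 = y" using y by (auto simp: R_def)
    have cC: "col C 0 = y" using y by (auto simp: C_def)
    have "col (minv A * C) 0 = minv A *\<^sub>v y" using I C cC by (auto simp: mult_mat_vec_def)
    then show ?thesis using R IC by (subst det_single) (auto simp: rR)
  qed
  finally show ?thesis using 1 by simp
qed

lemma scalar_prod_add_outer:
  assumes A: "A \<in> carrier_mat d d" and y: "y \<in> carrier_vec d" and x: "x \<in> carrier_vec d" and z: "z \<in> carrier_vec d"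
  shows "scalar_prod z ((A + outer y) *\<^sub>v x) = scalar_prod z (A *\<^sub>v x) + scalar_prod y z * scalar_prod y x"
proof -
  have "scalar_prod z ((A + outer y) *\<^sub>v x) = scalar_prod z (A *\<^sub>v x + scalar_prod y x \<cdot>\<^sub>v y)"
    using add_mult_distrib_mat_vec[OF A outer_carrier[OF y] x] outer_mult_vec[OF y x] by simp
  also have "\<dots> = scalar_prod z (A *\<^sub>v x) + scalar_prod y x * scalar_prod z y"
    using A x y z by (simp add: scalar_prod_add_distrib[of _ d])
  also have "scalar_prod z y = scalar_prod y z" by (rule comm_scalar_prod[OF z y])
  finally show ?thesis by simp
qed

lemma pd_add_outer:
  assumes A: "pd d A" and y: "y \<in> carrier_vec d"
  shows "pd d (A + outer y)"
proof -
  have "psd d (A + outer y)"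
    unfolding psd_def
    by (intro conjI ballI) (use psdD[OF pd_psd[OF A]] outer_carrier[OF y] in
      \<open>simp_all add: scalar_prod_add_outer[OF pd_carrier[OF A] y]\<close>)
  moreover have "0 \<le> scalar_prod y (minv A *\<^sub>v y)" using psdD(3)[OF psd_minv[OF A] y] .
  ultimately show ?thesis using A by (simp add: pd_def det_add_outer[OF A y])
qed

lemma minv_add_outer:
  assumes A: "pd d A" and y: "y \<in> carrier_vec d" and x: "x \<in> carrier_vec d"
  shows "scalar_prod x (minv (A + outer y) *\<^sub>v x) =
    scalar_prod x (minv A *\<^sub>v x) - (scalar_prod y (minv A *\<^sub>v x))\<^sup>2 / (1 + scalar_prod y (minv A *\<^sub>v y))"
proof -
  define a w where "a = minv A *\<^sub>v x" and "w = minv A *\<^sub>v y"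
  \<comment> \<open>\<open>q\<close> is chosen so that \<open>y . (a - q w) = q\<close>; the outer
    product then restores exactly the multiple of \<open>y\<close> that the correction
    \<open>- q w\<close> removes.\<close>
  define q where "q = scalar_prod y a / (1 + scalar_prod y w)"
  have a: "a \<in> carrier_vec d" "A *\<^sub>v a = x" and w: "w \<in> carrier_vec d" "A *\<^sub>v w = y"
    using pd_solve[OF A x] pd_solve[OF A y] by (auto simp: a_def w_def)
  have yw: "0 \<le> scalar_prod y w" using psdD(3)[OF psd_minv[OF A] y] by (simp add: w_def)
  let ?B = "A + outer y"
  let ?z = "a + (- q) \<cdot>\<^sub>v w"
  note Ac = pd_carrier[OF A]
  have z: "?z \<in> carrier_vec d" using a w by simp
  have "?B *\<^sub>v ?z = A *\<^sub>v ?z + scalar_prod y ?z \<cdot>\<^sub>v y"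
    using Ac z y by (simp add: add_mult_distrib_mat_vec[OF Ac outer_carrier[OF y] z] outer_mult_vec[OF y z])
  also have "A *\<^sub>v ?z = x + (- q) \<cdot>\<^sub>v y"
    using Ac a w by (simp add: mult_add_distrib_mat_vec[OF Ac] mult_mat_vec[OF Ac])
  also have "scalar_prod y ?z = scalar_prod y a - q * scalar_prod y w"
    using a w y by (simp add: scalar_prod_add_distrib[of _ d])
  also have "\<dots> = q" using yw by (simp add: q_def field_simps)
  also have "x + (- q) \<cdot>\<^sub>v y + q \<cdot>\<^sub>v y = x" using x y by (intro eq_vecI) auto
  finally have Bz: "?B *\<^sub>v ?z = x" .
  have "minv ?B *\<^sub>v x = ?z"
    using pd_solve(3)[OF pd_add_outer[OF A y] z] Bz by simp
  then have "scalar_prod x (minv ?B *\<^sub>v x) = scalar_prod x a - q * scalar_prod x w"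
    using a w x by (simp add: scalar_prod_add_distrib[of _ d])
  also have "scalar_prod x w = scalar_prod y a"
    using psdD(2)[OF psd_minv[OF A] x y] by (simp add: a_def w_def)
  finally show ?thesis by (simp add: q_def a_def w_def power2_eq_square)
qed

lemma minv_quadratic_add_outer_le:
  assumes A: "pd d A" and y: "y \<in> carrier_vec d" and x: "x \<in> carrier_vec d"
  shows "scalar_prod x (minv (A + outer y) *\<^sub>v x) \<le> scalar_prod x (minv A *\<^sub>v x)"
proof -
  have "0 \<le> (scalar_prod y (minv A *\<^sub>v x))\<^sup>2 / (1 + scalar_prod y (minv A *\<^sub>v y))"
    using psdD(3)[OF psd_minv[OF A] y] by (intro divide_nonneg_nonneg) simp_all
  then show ?thesis unfolding minv_add_outer[OF assms] by linarith
qed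

text \<open>Both sides are quadratic forms of adjugates, and the gain reduces to Cauchy-Schwarz in
  the \<open>minv A\<close> form. Through this inequality a bounded determinant ratio lets norms be
  transferred from an old matrix to a newer one.\<close>

lemma det_minv_quadratic_add_outer_ge:
  assumes A: "pd d A" and y: "y \<in> carrier_vec d" and x: "x \<in> carrier_vec d"
  shows "Determinant.det A * scalar_prod x (minv A *\<^sub>v x)
    \<le> Determinant.det (A + outer y) * scalar_prod x (minv (A + outer y) *\<^sub>v x)"
proof -
  let ?a = "scalar_prod x (minv A *\<^sub>v x)" and ?c = "scalar_prod y (minv A *\<^sub>v y)"
  let ?b = "scalar_prod y (minv A *\<^sub>v x)"
  have c: "0 \<le> ?c" using psdD(3)[OF psd_minv[OF A] y] .
  have "?b\<^sup>2 \<le> ?c * ?a" using psd_cauchy_schwarz[OF psd_minv[OF A] y x] .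
  then have "?a \<le> (1 + ?c) * (?a - ?b\<^sup>2 / (1 + ?c))"
    using c by (simp add: right_diff_distrib) (simp add: algebra_simps)
  then show ?thesis
    using A by (simp add: det_add_outer[OF A y] minv_add_outer[OF A y x] pd_def mult.assoc)
qed

text \<open>One transition adds a whole covariance to the design matrix, that is one rank-one term
  for each reachable state; \<open>I\<close> ranges over these states.\<close>

definition gram :: "nat \<Rightarrow> 'i set \<Rightarrow> ('i \<Rightarrow> real Matrix.vec) \<Rightarrow> real mat" where
  "gram d I y = Matrix.mat d d (\<lambda>(i, j). \<Sum>s\<in>I. vec_index (y s) i * vec_index (y s) j)"

lemma gram_carrier [simp]: "gram d I y \<in> carrier_mat d d" by (simp add: gram_def)

lemma gram_empty: "A \<in> carrier_mat d d \<Longrightarrow> A + gram d {} y = A"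
  by (intro eq_matI) (simp_all add: gram_def)

lemma gram_insert:
  assumes "A \<in> carrier_mat d d" "finite I" "a \<notin> I" "y a \<in> carrier_vec d"
  shows "A + gram d (insert a I) y = (A + gram d I y) + outer (y a)"
proof (rule eq_matI)
  fix i j assume "i < dim_row (A + gram d I y + outer (y a))" "j < dim_col (A + gram d I y + outer (y a))"
  then have ij: "i < d" "j < d" using outer_carrier[OF assms(4)] by simp_all
  have "outer (y a) $$ (i, j) = vec_index (y a) i * vec_index (y a) j"
    using ij assms(4) by (simp add: outer_def)
  then show "(A + gram d (insert a I) y) $$ (i, j) = (A + gram d I y + outer (y a)) $$ (i, j)"
    using ij assms(1-3) outer_carrier[OF assms(4)] by (simp add: gram_def)
qed (use assms(1) outer_carrier[OF assms(4)] in \<open>simp_all add: gram_def\<close>)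

text \<open>All claims share one induction, since each rank-one step needs definiteness of the
  matrix reached so far. In the last claim every vector is measured in the initial \<open>A\<close>:
  adding \<open>y a\<close> to \<open>B\<close> gains \<open>det B\<close> times its
  \<open>minv B\<close> form, which the adjugate comparison bounds below by the same product for
  \<open>A\<close>.\<close>

lemma gram_update:
  assumes A: "pd d A" and "finite I" and "\<And>s. s \<in> I \<Longrightarrow> y s \<in> carrier_vec d"
  defines "B \<equiv> A + gram d I y"
  shows pd_gram_update: "pd d B"
    and quadratic_gram_update: "x \<in> carrier_vec d \<Longrightarrow>
      scalar_prod x (B *\<^sub>v x) = scalar_prod x (A *\<^sub>v x) + (\<Sum>s\<in>I. (scalar_prod (y s) x)\<^sup>2)"
    and minv_gram_update_le: "x \<in> carrier_vec d \<Longrightarrow>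
      scalar_prod x (minv B *\<^sub>v x) \<le> scalar_prod x (minv A *\<^sub>v x)"
    and det_minv_gram_update_ge: "x \<in> carrier_vec d \<Longrightarrow>
      Determinant.det A * scalar_prod x (minv A *\<^sub>v x) \<le> Determinant.det B * scalar_prod x (minv B *\<^sub>v x)"
    and det_gram_update_ge:
      "Determinant.det A * (1 + (\<Sum>s\<in>I. scalar_prod (y s) (minv A *\<^sub>v y s))) \<le> Determinant.det B"
proof -
  note Ac = pd_carrier[OF A]
  have "pd d (A + gram d I y) \<and>
    (\<forall>x\<in>carrier_vec d.
      scalar_prod x ((A + gram d I y) *\<^sub>v x) = scalar_prod x (A *\<^sub>v x) + (\<Sum>s\<in>I. (scalar_prod (y s) x)\<^sup>2) \<and>
      scalar_prod x (minv (A + gram d I y) *\<^sub>v x) \<le> scalar_prod x (minv A *\<^sub>v x) \<and>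
      Determinant.det A * scalar_prod x (minv A *\<^sub>v x)
        \<le> Determinant.det (A + gram d I y) * scalar_prod x (minv (A + gram d I y) *\<^sub>v x)) \<and>
    Determinant.det A * (1 + (\<Sum>s\<in>I. scalar_prod (y s) (minv A *\<^sub>v y s))) \<le> Determinant.det (A + gram d I y)"
    using assms(2,3)
  proof (induction I rule: finite_induct)
    case empty
    show ?case unfolding gram_empty[OF Ac] using A by simp
  next
    case (insert a I)
    define B where "B = A + gram d I y"
    have ya: "y a \<in> carrier_vec d" using insert.prems by simp
    have eq: "A + gram d (insert a I) y = B + outer (y a)"
      unfolding B_def by (rule gram_insert[where y = y, OF Ac insert.hyps ya])
    note IH = insert.IH[OF insert.prems[OF insertI2], folded B_def]
    from IH have B: "pd d B" by blast
    have 1: "pd d (B + outer (y a))" by (rule pd_add_outer[OF B ya])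
    have 2: "scalar_prod x ((B + outer (y a)) *\<^sub>v x) = scalar_prod x (A *\<^sub>v x) + (\<Sum>s\<in>insert a I. (scalar_prod (y s) x)\<^sup>2)"
      if "x \<in> carrier_vec d" for x
      unfolding scalar_prod_add_outer[OF pd_carrier[OF B] ya that that] using IH that insert.hyps
      by (simp add: power2_eq_square)
    have 3: "scalar_prod x (minv (B + outer (y a)) *\<^sub>v x) \<le> scalar_prod x (minv A *\<^sub>v x)"
      if "x \<in> carrier_vec d" for x
      using minv_quadratic_add_outer_le[OF B ya that] IH that by (meson order.trans)
    have 4: "Determinant.det A * scalar_prod x (minv A *\<^sub>v x)
        \<le> Determinant.det (B + outer (y a)) * scalar_prod x (minv (B + outer (y a)) *\<^sub>v x)"
      if "x \<in> carrier_vec d" for x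
      using det_minv_quadratic_add_outer_ge[OF B ya that] IH that by (meson order.trans)
    have "Determinant.det A * (1 + (\<Sum>s\<in>insert a I. scalar_prod (y s) (minv A *\<^sub>v y s)))
      = Determinant.det A * (1 + (\<Sum>s\<in>I. scalar_prod (y s) (minv A *\<^sub>v y s))) +
        Determinant.det A * scalar_prod (y a) (minv A *\<^sub>v y a)"
      using insert.hyps by (simp add: algebra_simps)
    also have "\<dots> \<le> Determinant.det B + Determinant.det B * scalar_prod (y a) (minv B *\<^sub>v y a)"
      using IH ya by (intro add_mono) blast+
    also have "\<dots> = Determinant.det (B + outer (y a))"
      by (simp add: det_add_outer[OF B ya] algebra_simps)
    finally have 5: "Determinant.det A * (1 + (\<Sum>s\<in>insert a I. scalar_prod (y s) (minv A *\<^sub>v y s)))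
      \<le> Determinant.det (B + outer (y a))" .
    show ?case unfolding eq using 1 2 3 4 5 by blast
  qed
  then show "pd d B"
    "x \<in> carrier_vec d \<Longrightarrow>
      scalar_prod x (B *\<^sub>v x) = scalar_prod x (A *\<^sub>v x) + (\<Sum>s\<in>I. (scalar_prod (y s) x)\<^sup>2)"
    "x \<in> carrier_vec d \<Longrightarrow> scalar_prod x (minv B *\<^sub>v x) \<le> scalar_prod x (minv A *\<^sub>v x)"
    "x \<in> carrier_vec d \<Longrightarrow>
      Determinant.det A * scalar_prod x (minv A *\<^sub>v x) \<le> Determinant.det B * scalar_prod x (minv B *\<^sub>v x)"
    "Determinant.det A * (1 + (\<Sum>s\<in>I. scalar_prod (y s) (minv A *\<^sub>v y s))) \<le> Determinant.det B"
    unfolding B_def by blast+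
qed

lemma abs_det_le:
  fixes A :: "real mat"
  assumes A: "A \<in> carrier_mat d d" and b: "\<And>i j. i < d \<Longrightarrow> j < d \<Longrightarrow> \<bar>A $$ (i, j)\<bar> \<le> b"
  shows "\<bar>Determinant.det A\<bar> \<le> (real d * b) ^ d"
proof -
  let ?P = "{p. p permutes {0..<d}}"
  have "\<bar>Determinant.det A\<bar> \<le> (\<Sum>p\<in>?P. \<bar>signof p * (\<Prod>i = 0..<d. A $$ (i, p i))\<bar>)"
    unfolding det_def'[OF A] by (rule sum_abs)
  also have "\<dots> \<le> (\<Sum>p\<in>?P. b ^ d)"
  proof (rule sum_mono)
    fix p assume "p \<in> ?P"
    then have p: "p permutes {0..<d}" by simp
    have "\<bar>signof p * (\<Prod>i = 0..<d. A $$ (i, p i))\<bar> = (\<Prod>i = 0..<d. \<bar>A $$ (i, p i)\<bar>)"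
      by (simp add: abs_mult abs_prod sign_def)
    also have "\<dots> \<le> (\<Prod>i = 0..<d. b)"
      by (rule prod_mono) (use permutes_in_image[OF p] b in auto)
    finally show "\<bar>signof p * (\<Prod>i = 0..<d. A $$ (i, p i))\<bar> \<le> b ^ d" by simp
  qed
  also have "\<dots> = fact d * b ^ d" by (simp add: card_permutations[of _ d])
  also have "\<dots> \<le> real d ^ d * b ^ d"
  proof (cases "d = 0")
    case False
    then have "b \<ge> 0" using b[of 0 0] by simp
    then show ?thesis using fact_le_power[of d, where 'a = real] by (intro mult_right_mono) simp_all
  qed simp
  finally show ?thesis by (simp add: power_mult_distrib)
qed

section \<open>The multinomial logit model\<close>

text \<open>Along the i-th coordinate the logit is affine with slope the i-th feature entry, which
  is the form of a \<open>softmax_line\<close>.\<close>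

lemma scalar_prod_coordinate_line:
  assumes "v \<in> carrier_vec d" "i < d"
  shows "scalar_prod v (Matrix.vec d (\<lambda>j. if j = i then x else vec_index \<theta> j)) =
    (\<Sum>j\<in>{0..<d} - {i}. vec_index v j * vec_index \<theta> j) + (x :: real) * vec_index v i"
proof -
  have "scalar_prod v (Matrix.vec d (\<lambda>j. if j = i then x else vec_index \<theta> j))
    = (\<Sum>j\<in>{0..<d}. vec_index v j * (if j = i then x else vec_index \<theta> j))"
    by (simp add: scalar_prod_def)
  also have "\<dots> = vec_index v i * x + (\<Sum>j\<in>{0..<d} - {i}. vec_index v j * (if j = i then x else vec_index \<theta> j))"
    using assms by (subst sum.remove[of _ i]) auto
  finally show ?thesis by (simp add: mult.commute)
qed

lemma vec_coordinate_line_self: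
  assumes "\<theta> \<in> carrier_vec d"
  shows "Matrix.vec d (\<lambda>j. if j = i then vec_index \<theta> i else vec_index \<theta> j) = \<theta>"
  using assms by (intro eq_vecI) auto

locale mnl_model =
  fixes M :: ucparams and s a :: nat
  assumes fin: "finite (pSsa M s a)" and ne: "pSsa M s a \<noteq> {}"
    and phi: "\<And>k. k \<in> pSsa M s a \<Longrightarrow> phi M s a k \<in> carrier_vec (dim M)"
begin

abbreviation "I \<equiv> pSsa M s a"
abbreviation "\<phi> \<equiv> phi M s a"
abbreviation "d \<equiv> dim M"
abbreviation "p \<theta> k \<equiv> mnl (phi M) (pSsa M) \<theta> s a k"
abbreviation "mean \<theta> \<equiv> mean_feat M \<theta> s a"

lemma mnl_pos: "k \<in> I \<Longrightarrow> 0 < p \<theta> k"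
  using fin ne by (auto simp: mnl_def intro!: divide_pos_pos sum_pos)

lemma mnl_nonneg: "0 \<le> p \<theta> k"
  using mnl_pos[of k \<theta>] by (cases "k \<in> I") (auto simp: mnl_def)

lemma mnl_sum: "(\<Sum>k\<in>I. p \<theta> k) = 1"
proof -
  have "(\<Sum>k\<in>I. exp (scalar_prod (\<phi> k) \<theta>)) > 0" using fin ne by (intro sum_pos) auto
  then show ?thesis by (simp add: mnl_def flip: sum_divide_distrib)
qed

lemma mnl_eq_softmax:
  assumes "\<And>k. k \<in> I \<Longrightarrow> scalar_prod (\<phi> k) \<theta> = c k + u * x k" "k \<in> I"
  shows "p \<theta> k = softmax_line.p I c x u k"
proof -
  interpret sm: softmax_line I c x using fin ne by unfold_locales
  show ?thesis using assms by (simp add: mnl_def sm.p_def sm.Z_def cong: sum.cong)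
qed

lemma mean_carrier [simp]: "mean \<theta> \<in> carrier_vec d" by (simp add: mean_feat_def)

lemma mean_index: "i < d \<Longrightarrow> vec_index (mean \<theta>) i = (\<Sum>k\<in>I. p \<theta> k * vec_index (\<phi> k) i)"
  by (simp add: mean_feat_def)

lemma scalar_prod_mean:
  assumes v: "v \<in> carrier_vec d"
  shows "scalar_prod (mean \<theta>) v = (\<Sum>k\<in>I. p \<theta> k * scalar_prod (\<phi> k) v)"
proof -
  have "scalar_prod (mean \<theta>) v = (\<Sum>i<d. \<Sum>k\<in>I. p \<theta> k * (vec_index (\<phi> k) i * vec_index v i))"
    using v by (simp add: scalar_prod_def mean_index atLeast0LessThan sum_distrib_right mult.assoc)
  also have "\<dots> = (\<Sum>k\<in>I. p \<theta> k * (\<Sum>i<d. vec_index (\<phi> k) i * vec_index v i))"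
    unfolding sum_distrib_left by (rule sum.swap)
  finally show ?thesis using v by (simp add: scalar_prod_def atLeast0LessThan)
qed

lemma loss_pdiff:
  assumes s2: "s2 \<in> I" and \<theta>: "\<theta> \<in> carrier_vec d" and i: "i < d"
  shows "pdiff d (loss M s a s2) \<theta> i = vec_index (mean \<theta>) i - vec_index (\<phi> s2) i"
proof -
  define c where "c k = (\<Sum>j\<in>{0..<d} - {i}. vec_index (\<phi> k) j * vec_index \<theta> j)" for k
  define x where "x k = vec_index (\<phi> k) i" for k
  interpret sm: softmax_line I c x using fin ne by unfold_locales
  define \<theta>' where "\<theta>' u = Matrix.vec d (\<lambda>j. if j = i then u else vec_index \<theta> j)" for u
  have pe: "p (\<theta>' u) k = sm.p u k" if "k \<in> I" for u k
    using that phi i unfolding \<theta>'_def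
    by (intro mnl_eq_softmax) (auto simp: scalar_prod_coordinate_line c_def x_def)
  have "loss M s a s2 (\<theta>' u) = - ln (sm.p u s2)" for u
    using s2 fin by (simp add: loss_def pe if_distrib[of "\<lambda>t. t * _"] cong: if_cong)
  moreover have "((\<lambda>u. - ln (sm.p u s2)) has_real_derivative sm.avg u - x s2) (at u)" for u
    using sm.p_pos[of u s2] by (auto intro!: derivative_eq_intros sm.deriv_p simp: field_simps)
  ultimately have "pdiff d (loss M s a s2) \<theta> i = sm.avg (vec_index \<theta> i) - x s2"
    unfolding pdiff_def \<theta>'_def[symmetric] by (simp add: DERIV_imp_deriv)
  also have "sm.avg (vec_index \<theta> i) = vec_index (mean (\<theta>' (vec_index \<theta> i))) i"
    using i by (simp add: sm.avg_def mean_index x_def pe)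
  also have "\<theta>' (vec_index \<theta> i) = \<theta>" unfolding \<theta>'_def by (rule vec_coordinate_line_self[OF \<theta>])
  finally show ?thesis by (simp add: x_def)
qed

text \<open>The observed successor enters the gradient only through a constant, so the Hessian is
  the feature covariance of the model at \<theta>, whatever \<open>s2\<close> is.\<close>

lemma loss_pdiff2:
  assumes s2: "s2 \<in> I" and \<theta>: "\<theta> \<in> carrier_vec d" and i: "i < d" and j: "j < d"
  shows "pdiff d (\<lambda>\<theta>'. pdiff d (loss M s a s2) \<theta>' i) \<theta> j =
    (\<Sum>k\<in>I. p \<theta> k * (vec_index (\<phi> k) i - vec_index (mean \<theta>) i) * (vec_index (\<phi> k) j - vec_index (mean \<theta>) j))"
proof -
  define c where "c k = (\<Sum>l\<in>{0..<d} - {j}. vec_index (\<phi> k) l * vec_index \<theta> l)" for k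
  define x where "x k = vec_index (\<phi> k) j" for k
  interpret sm: softmax_line I c x using fin ne by unfold_locales
  define \<theta>' where "\<theta>' u = Matrix.vec d (\<lambda>l. if l = j then u else vec_index \<theta> l)" for u
  have [simp]: "\<theta>' u \<in> carrier_vec d" for u by (simp add: \<theta>'_def)
  have pe: "p (\<theta>' u) k = sm.p u k" if "k \<in> I" for u k
    using that phi j unfolding \<theta>'_def
    by (intro mnl_eq_softmax) (auto simp: scalar_prod_coordinate_line c_def x_def)
  have self: "\<theta>' (vec_index \<theta> j) = \<theta>" unfolding \<theta>'_def by (rule vec_coordinate_line_self[OF \<theta>])
  let ?u = "vec_index \<theta> j"
  have avg: "sm.avg ?u = vec_index (mean \<theta>) j"
    using j pe[of _ ?u] by (simp add: sm.avg_def mean_index x_def self)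
  have "pdiff d (loss M s a s2) (\<theta>' u) i = (\<Sum>k\<in>I. sm.p u k * vec_index (\<phi> k) i) - vec_index (\<phi> s2) i" for u
    using i by (simp add: loss_pdiff[OF s2] mean_index pe)
  moreover have "((\<lambda>u. (\<Sum>k\<in>I. sm.p u k * vec_index (\<phi> k) i) - vec_index (\<phi> s2) i) has_real_derivative
      (\<Sum>k\<in>I. sm.p u k * (x k - sm.avg u) * vec_index (\<phi> k) i)) (at u)" for u
    by (auto intro!: derivative_eq_intros sm.deriv_p sum.cong)
  ultimately have "pdiff d (\<lambda>\<theta>'. pdiff d (loss M s a s2) \<theta>' i) \<theta> j =
      (\<Sum>k\<in>I. sm.p ?u k * (x k - sm.avg ?u) * vec_index (\<phi> k) i)"
    unfolding pdiff_def[of d "\<lambda>\<theta>'. pdiff d (loss M s a s2) \<theta>' i"] \<theta>'_def[symmetric] by (simp add: DERIV_imp_deriv)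
  \<comment> \<open>Subtracting a multiple of the vanishing centred sum centres the remaining
    feature factor as well.\<close>
  also have "\<dots> = (\<Sum>k\<in>I. sm.p ?u k * (x k - sm.avg ?u) * vec_index (\<phi> k) i)
      - vec_index (mean \<theta>) i * (\<Sum>k\<in>I. sm.p ?u k * (x k - sm.avg ?u))"
    by (simp add: sm.avg_diff)
  also have "\<dots> = (\<Sum>k\<in>I. sm.p ?u k * (vec_index (\<phi> k) i - vec_index (mean \<theta>) i) * (x k - sm.avg ?u))"
    by (simp add: sum_distrib_left algebra_simps sum_subtractf sum.distrib)
  also have "\<dots> = (\<Sum>k\<in>I. p \<theta> k * (vec_index (\<phi> k) i - vec_index (mean \<theta>) i) * (vec_index (\<phi> k) j - vec_index (mean \<theta>) j))"
    using pe[of _ ?u] by (simp add: self avg x_def)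
  finally show ?thesis .
qed

text \<open>The square root splits each probability weight evenly between the two factors, so the
  covariance becomes a sum of outer products to which \<open>gram_update\<close> applies.\<close>

lemma hess_loss:
  assumes s2: "s2 \<in> I" and \<theta>: "\<theta> \<in> carrier_vec d"
  shows "hess d (loss M s a s2) \<theta> = gram d I (\<lambda>k. sqrt (p \<theta> k) \<cdot>\<^sub>v (\<phi> k - mean \<theta>))"
proof (rule eq_matI)
  fix i j assume "i < dim_row (gram d I (\<lambda>k. sqrt (p \<theta> k) \<cdot>\<^sub>v (\<phi> k - mean \<theta>)))"
    and "j < dim_col (gram d I (\<lambda>k. sqrt (p \<theta> k) \<cdot>\<^sub>v (\<phi> k - mean \<theta>)))"
  then have i: "i < d" and j: "j < d" by (simp_all add: gram_def)
  have "vec_index (sqrt (p \<theta> k) \<cdot>\<^sub>v (\<phi> k - mean \<theta>)) i * vec_index (sqrt (p \<theta> k) \<cdot>\<^sub>v (\<phi> k - mean \<theta>)) j =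
    p \<theta> k * (vec_index (\<phi> k) i - vec_index (mean \<theta>) i) * (vec_index (\<phi> k) j - vec_index (mean \<theta>) j)" for k
  proof -
    have idx: "vec_index (c \<cdot>\<^sub>v (\<phi> k - mean \<theta>)) l = c * (vec_index (\<phi> k) l - vec_index (mean \<theta>) l)"
      if "l < d" for c l
      using that mean_carrier[of \<theta>, THEN carrier_vecD] by (simp del: mean_carrier)
    have "sqrt (p \<theta> k) * sqrt (p \<theta> k) = p \<theta> k" using mnl_nonneg by simp
    moreover have "(r * x) * (r * y) = (r * r) * x * y" for r x y :: real by (simp only: mult_ac)
    ultimately show ?thesis unfolding idx[OF i] idx[OF j] by presburger
  qed
  then show "hess d (loss M s a s2) \<theta> $$ (i, j) = gram d I (\<lambda>k. sqrt (p \<theta> k) \<cdot>\<^sub>v (\<phi> k - mean \<theta>)) $$ (i, j)"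
    using i j by (simp add: hess_def gram_def loss_pdiff2[OF s2 \<theta>])
qed (auto simp: hess_def gram_def)

section \<open>Perturbation bounds for the model in a dual norm\<close>

context
  fixes A :: "real mat" and m :: real
  assumes A: "pd d A" and m: "\<And>k. k \<in> I \<Longrightarrow> wnorm (minv A) (\<phi> k) \<le> m"
begin

lemma scalar_prod_phi_le:
  assumes "k \<in> I" "v \<in> carrier_vec d"
  shows "\<bar>scalar_prod (\<phi> k) v\<bar> \<le> m * wnorm A v"
  by (rule order.trans[OF dual_cauchy_schwarz[OF A phi[OF assms(1)] assms(2)]])
     (use assms in \<open>auto intro!: mult_right_mono m wnorm_nonneg[OF pd_psd[OF A]]\<close>)

text \<open>Both claims are the one-dimensional softmax bounds on the segment from \<theta>0 to
  \<theta>1; dual Cauchy-Schwarz bounds the slopes by \<open>m * b\<close>.\<close>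

lemma mnl_second_order:
  assumes \<theta>0: "\<theta>0 \<in> carrier_vec d" and \<theta>1: "\<theta>1 \<in> carrier_vec d" and b: "wnorm A (\<theta>1 - \<theta>0) \<le> b"
  shows "(\<Sum>k\<in>I. \<bar>p \<theta>1 k - p \<theta>0 k\<bar>) \<le> b * (\<Sum>k\<in>I. p \<theta>0 k * wnorm (minv A) (\<phi> k - mean \<theta>0)) + b\<^sup>2 * m\<^sup>2"
    and mnl_lipschitz: "(\<Sum>k\<in>I. \<bar>p \<theta>1 k - p \<theta>0 k\<bar>) \<le> 2 * (m * b)"
proof -
  define v where "v = \<theta>1 - \<theta>0"
  have v: "v \<in> carrier_vec d" using assms by (simp add: v_def)
  interpret sm: softmax_line I "\<lambda>k. scalar_prod (\<phi> k) \<theta>0" "\<lambda>k. scalar_prod (\<phi> k) v"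
    using fin ne by unfold_locales
  have e0: "p \<theta>0 k = sm.p 0 k" if "k \<in> I" for k
    using that by (intro mnl_eq_softmax) auto
  have e1: "p \<theta>1 k = sm.p 1 k" if "k \<in> I" for k
    using that phi \<theta>0 \<theta>1 by (intro mnl_eq_softmax) (auto simp: v_def scalar_prod_minus_distrib[of _ d])
  have m0: "0 \<le> m" using ne m wnorm_nonneg[OF psd_minv[OF A]] phi by (meson ex_in_conv order.trans)
  have mb: "\<bar>scalar_prod (\<phi> k) v\<bar> \<le> m * b" if "k \<in> I" for k
    using scalar_prod_phi_le[OF that v] mult_left_mono[OF b m0] by (simp add: v_def)
  show "(\<Sum>k\<in>I. \<bar>p \<theta>1 k - p \<theta>0 k\<bar>) \<le> 2 * (m * b)"
    using sm.l1_lipschitz[OF mb] by (simp add: e0 e1)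
  have avg: "sm.avg 0 = scalar_prod (mean \<theta>0) v"
    by (simp add: sm.avg_def scalar_prod_mean[OF v] e0)
  have "(\<Sum>k\<in>I. p \<theta>0 k * \<bar>scalar_prod (\<phi> k) v - sm.avg 0\<bar>)
      \<le> (\<Sum>k\<in>I. p \<theta>0 k * (b * wnorm (minv A) (\<phi> k - mean \<theta>0)))"
  proof (intro sum_mono mult_left_mono mnl_nonneg)
    fix k assume k: "k \<in> I"
    have w: "\<phi> k - mean \<theta>0 \<in> carrier_vec d" using phi[OF k] by simp
    have "\<bar>scalar_prod (\<phi> k) v - sm.avg 0\<bar> = \<bar>scalar_prod (\<phi> k - mean \<theta>0) v\<bar>"
      using minus_scalar_prod_distrib[OF phi[OF k] mean_carrier v] by (simp add: avg)
    also have "\<dots> \<le> wnorm (minv A) (\<phi> k - mean \<theta>0) * wnorm A v"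
      by (rule dual_cauchy_schwarz[OF A w v])
    also have "\<dots> \<le> wnorm (minv A) (\<phi> k - mean \<theta>0) * b"
      using b by (intro mult_left_mono wnorm_nonneg[OF psd_minv[OF A] w]) (simp add: v_def)
    finally show "\<bar>scalar_prod (\<phi> k) v - sm.avg 0\<bar> \<le> b * wnorm (minv A) (\<phi> k - mean \<theta>0)"
      by (simp add: mult.commute)
  qed
  also have "\<dots> = b * (\<Sum>k\<in>I. p \<theta>0 k * wnorm (minv A) (\<phi> k - mean \<theta>0))"
    by (simp add: sum_distrib_left mult_ac)
  finally show "(\<Sum>k\<in>I. \<bar>p \<theta>1 k - p \<theta>0 k\<bar>) \<le> b * (\<Sum>k\<in>I. p \<theta>0 k * wnorm (minv A) (\<phi> k - mean \<theta>0)) + b\<^sup>2 * m\<^sup>2"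
    using sm.l1_second_order[OF mb] by (simp add: e0 e1 power_mult_distrib mult.commute cong: sum.cong)
qed

lemma mean_dist_le:
  "wnorm (minv A) (mean \<theta>1 - mean \<theta>0) \<le> (\<Sum>k\<in>I. \<bar>p \<theta>1 k - p \<theta>0 k\<bar>) * m"
proof -
  have "mean \<theta>1 - mean \<theta>0 = Matrix.vec d (\<lambda>j. \<Sum>k\<in>I. (p \<theta>1 k - p \<theta>0 k) * vec_index (\<phi> k) j)"
    by (intro eq_vecI) (auto simp: mean_feat_def left_diff_distrib sum_subtractf)
  then have "wnorm (minv A) (mean \<theta>1 - mean \<theta>0) \<le> (\<Sum>k\<in>I. \<bar>p \<theta>1 k - p \<theta>0 k\<bar> * wnorm (minv A) (\<phi> k))"
    using wnorm_sum[where v = \<phi> and c = "\<lambda>k. p \<theta>1 k - p \<theta>0 k", OF psd_minv[OF A] fin phi] by simp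
  also have "\<dots> \<le> (\<Sum>k\<in>I. \<bar>p \<theta>1 k - p \<theta>0 k\<bar> * m)"
    by (intro sum_mono mult_left_mono m) auto
  finally show ?thesis by (simp add: sum_distrib_right)
qed

lemma wnorm_mean_le: "wnorm (minv A) (mean \<theta>) \<le> m"
proof -
  have "wnorm (minv A) (mean \<theta>) \<le> (\<Sum>k\<in>I. \<bar>p \<theta> k\<bar> * wnorm (minv A) (\<phi> k))"
    using wnorm_sum[where v = \<phi> and c = "\<lambda>k. p \<theta> k", OF psd_minv[OF A] fin phi] by (simp add: mean_feat_def)
  also have "\<dots> \<le> (\<Sum>k\<in>I. p \<theta> k * m)"
    by (intro sum_mono) (auto intro!: mult_left_mono m simp: mnl_nonneg)
  finally show ?thesis by (simp add: mnl_sum flip: sum_distrib_right)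
qed

lemma wnorm_centered_le: "k \<in> I \<Longrightarrow> wnorm (minv A) (\<phi> k - mean \<theta>) \<le> 2 * m"
  using wnorm_triangle[OF psd_minv[OF A] phi zero_carrier_vec mean_carrier, of k \<theta>]
    wnorm_minus_commute[OF psd_minv[OF A] zero_carrier_vec mean_carrier, of \<theta>] wnorm_mean_le[of \<theta>] m[of k]
    phi[of k] by simp

text \<open>The polytope radius is centred at the estimate of the episode start and the potential at
  the newest estimate; this inequality moves between them. With L the L1 distance of the two models,
  the changed weights cost \<open>2 * m * L\<close>, the shifted mean costs \<open>m * L\<close>,
  and \<open>L \<le> 2 * m * b\<close> yields the constant 6.\<close>

lemma centered_width_lipschitz:
  assumes \<theta>0: "\<theta>0 \<in> carrier_vec d" and \<theta>1: "\<theta>1 \<in> carrier_vec d" and b: "wnorm A (\<theta>1 - \<theta>0) \<le> b"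
  shows "(\<Sum>k\<in>I. p \<theta>1 k * wnorm (minv A) (\<phi> k - mean \<theta>1))
    \<le> (\<Sum>k\<in>I. p \<theta>0 k * wnorm (minv A) (\<phi> k - mean \<theta>0)) + 6 * m\<^sup>2 * b"
proof -
  let ?L = "\<Sum>k\<in>I. \<bar>p \<theta>1 k - p \<theta>0 k\<bar>" and ?w = "\<lambda>\<theta> k. wnorm (minv A) (\<phi> k - mean \<theta>)"
  have m0: "0 \<le> m" using ne m wnorm_nonneg[OF psd_minv[OF A]] phi by (meson ex_in_conv order.trans)
  have "(\<Sum>k\<in>I. p \<theta>1 k * ?w \<theta>1 k) \<le> (\<Sum>k\<in>I. \<bar>p \<theta>1 k - p \<theta>0 k\<bar> * (2 * m) + p \<theta>0 k * (?w \<theta>0 k + ?L * m))"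
  proof (rule sum_mono)
    fix k assume k: "k \<in> I"
    have w0: "0 \<le> ?w \<theta>1 k" using wnorm_nonneg[OF psd_minv[OF A]] phi[OF k] by simp
    have "?w \<theta>1 k \<le> ?w \<theta>0 k + wnorm (minv A) (mean \<theta>0 - mean \<theta>1)"
      using wnorm_triangle[OF psd_minv[OF A] phi[OF k] mean_carrier mean_carrier] .
    also have "wnorm (minv A) (mean \<theta>0 - mean \<theta>1) \<le> ?L * m"
      using mean_dist_le[of \<theta>1 \<theta>0] wnorm_minus_commute[OF psd_minv[OF A] mean_carrier mean_carrier, of \<theta>0 \<theta>1] by simp
    finally have 1: "p \<theta>0 k * ?w \<theta>1 k \<le> p \<theta>0 k * (?w \<theta>0 k + ?L * m)"
      by (intro mult_left_mono mnl_nonneg) simp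
    have "(p \<theta>1 k - p \<theta>0 k) * ?w \<theta>1 k \<le> \<bar>p \<theta>1 k - p \<theta>0 k\<bar> * ?w \<theta>1 k"
      by (intro mult_right_mono w0) simp
    also have "\<dots> \<le> \<bar>p \<theta>1 k - p \<theta>0 k\<bar> * (2 * m)"
      by (intro mult_left_mono wnorm_centered_le k) simp
    finally show "p \<theta>1 k * ?w \<theta>1 k \<le> \<bar>p \<theta>1 k - p \<theta>0 k\<bar> * (2 * m) + p \<theta>0 k * (?w \<theta>0 k + ?L * m)"
      using 1 by (simp add: algebra_simps)
  qed
  also have "\<dots> = (\<Sum>k\<in>I. p \<theta>0 k * ?w \<theta>0 k) + 3 * m * ?L"
    by (simp add: sum.distrib distrib_left mnl_sum flip: sum_distrib_right)
  also have "3 * m * ?L \<le> 3 * m * (2 * (m * b))"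
    using m0 by (intro mult_left_mono mnl_lipschitz[OF \<theta>0 \<theta>1 b]) simp
  finally show ?thesis by (simp add: power2_eq_square mult_ac)
qed

text \<open>Only the two states \<open>k\<close> and \<open>z\<close> are kept. As the feature at
  \<open>z\<close> is zero, their distances to the mean add up to at least the length of the feature
  at \<open>k\<close>, and their weighted squares amount to at least the product of the two
  probabilities times the squared sum of distances.\<close>

lemma kappa_le_centered_variance:
  assumes kap: "\<And>k l. k \<in> I \<Longrightarrow> l \<in> I \<Longrightarrow> \<kappa> \<le> p \<theta> k * p \<theta> l"
    and z: "z \<in> I" "\<phi> z = 0\<^sub>v d" and k: "k \<in> I"
  shows "\<kappa> * (wnorm (minv A) (\<phi> k))\<^sup>2 \<le> (\<Sum>l\<in>I. p \<theta> l * (wnorm (minv A) (\<phi> l - mean \<theta>))\<^sup>2)"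
proof -
  let ?w = "\<lambda>k. wnorm (minv A) (\<phi> k - mean \<theta>)"
  have nn: "0 \<le> p \<theta> l * (?w l)\<^sup>2" for l using mnl_nonneg by simp
  show ?thesis
  proof (cases "k = z")
    case True
    then show ?thesis using z wnorm_zero[OF psd_minv[OF A]] nn by (simp add: sum_nonneg)
  next
    case False
    define q r x y where "q = p \<theta> k" and "r = p \<theta> z" and "x = ?w k" and "y = ?w z"
    have q: "0 \<le> q" and r: "0 \<le> r" by (simp_all add: q_def r_def mnl_nonneg)
    have "q + r = (\<Sum>l\<in>{k, z}. p \<theta> l)" using False by (simp add: q_def r_def)
    also have "\<dots> \<le> (\<Sum>l\<in>I. p \<theta> l)" using k z fin by (intro sum_mono2) (auto simp: mnl_nonneg)
    finally have qr: "q + r \<le> 1" by (simp add: mnl_sum)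
    have n0: "0 \<le> wnorm (minv A) (\<phi> k)" using wnorm_nonneg[OF psd_minv[OF A] phi[OF k]] .
    have "wnorm (minv A) (\<phi> k) = wnorm (minv A) (\<phi> k - \<phi> z)" using z phi[OF k] by simp
    also have "\<dots> \<le> x + wnorm (minv A) (mean \<theta> - \<phi> z)"
      unfolding x_def by (rule wnorm_triangle[OF psd_minv[OF A] phi[OF k] mean_carrier phi[OF z(1)]])
    also have "wnorm (minv A) (mean \<theta> - \<phi> z) = y"
      unfolding y_def by (rule wnorm_minus_commute[OF psd_minv[OF A] mean_carrier phi[OF z(1)]])
    finally have "(wnorm (minv A) (\<phi> k))\<^sup>2 \<le> (x + y)\<^sup>2" using n0 by (simp add: power_mono)
    then have "\<kappa> * (wnorm (minv A) (\<phi> k))\<^sup>2 \<le> q * r * (x + y)\<^sup>2"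
      using kap[OF k z(1)] q r unfolding q_def[symmetric] r_def[symmetric]
      by (meson mult_mono mult_nonneg_nonneg zero_le_power2)
    also have "\<dots> \<le> q * x\<^sup>2 + r * y\<^sup>2"
    proof -
      \<comment> \<open>The difference of the two sides, written as a square plus a term that is
        nonnegative because \<open>q + r \<le> 1\<close>.\<close>
      have "0 \<le> (q * x - r * y)\<^sup>2 + (1 - (q + r)) * (q * x\<^sup>2 + r * y\<^sup>2)"
        using q r qr by simp
      also have "\<dots> = q * x\<^sup>2 + r * y\<^sup>2 - q * r * (x + y)\<^sup>2"
        by (simp add: power2_eq_square algebra_simps)
      finally show ?thesis by simp
    qed
    also have "\<dots> = (\<Sum>l\<in>{k, z}. p \<theta> l * (?w l)\<^sup>2)" using False by (simp add: q_def r_def x_def y_def)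
    also have "\<dots> \<le> (\<Sum>l\<in>I. p \<theta> l * (?w l)\<^sup>2)" using k z fin nn by (intro sum_mono2) auto
    finally show ?thesis .
  qed
qed

end

text \<open>Jensen's inequality, obtained from nonnegativity of a variance. It bounds the
  first-order width by the square root of the potential.\<close>

lemma width_square_le:
  "(\<Sum>k\<in>I. p \<theta> k * w k)\<^sup>2 \<le> (\<Sum>k\<in>I. p \<theta> k * (w k :: real)\<^sup>2)"
proof -
  let ?m = "\<Sum>k\<in>I. p \<theta> k * w k"
  have "0 \<le> (\<Sum>k\<in>I. p \<theta> k * (w k - ?m)\<^sup>2)" by (intro sum_nonneg) (simp add: mnl_nonneg)
  also have "\<dots> = (\<Sum>k\<in>I. p \<theta> k * (w k)\<^sup>2) - 2 * ?m * ?m + ?m\<^sup>2 * (\<Sum>k\<in>I. p \<theta> k)"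
    unfolding sum_distrib_left[of "2 * ?m"] sum_distrib_left[of "?m\<^sup>2"] sum_subtractf[symmetric] sum.distrib[symmetric]
    by (intro sum.cong) (auto simp: power2_eq_square algebra_simps)
  finally show ?thesis by (simp add: mnl_sum power2_eq_square)
qed

end

section \<open>Existence of the minimiser in the estimator update\<close>

lemma compact_coordinate_box:
  "compact {f :: nat \<Rightarrow> real. \<forall>i. if i < d then \<bar>f i\<bar> \<le> L else f i = 0}"
proof -
  have "compactin (product_topology (\<lambda>i. euclidean) UNIV) (PiE UNIV (\<lambda>i :: nat. if i < d then {-L..L} else {0 :: real}))"
    by (subst compactin_PiE) auto
  then have "compact (PiE UNIV (\<lambda>i :: nat. if i < d then {-L..L} else {0 :: real}))"
    by (simp add: euclidean_product_topology flip: compactin_euclidean_iff)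
  also have "PiE UNIV (\<lambda>i :: nat. if i < d then {-L..L} else {0 :: real}) = {f. \<forall>i. if i < d then \<bar>f i\<bar> \<le> L else f i = 0}"
    by (auto simp: PiE_def Pi_def abs_le_iff minus_le_iff split: if_splits)
  finally show ?thesis .
qed

text \<open>Existence makes the \<open>SOME\<close> in \<open>alg_next\<close> a true minimiser and
  so puts every estimate into \<open>Theta\<close>, where the lower bound \<kappa> applies.
  Compactness is taken in the product topology of coordinate functions that vanish from
  \<open>d\<close> on.\<close>

lemma quadratic_attains_min_on_Theta:
  assumes \<theta>: "\<theta> \<in> carrier_vec d" and A: "A \<in> carrier_mat d d" and g: "g \<in> carrier_vec d" and L: "0 \<le> L"
  shows "\<exists>\<theta>'\<in>Theta d L. \<forall>x\<in>Theta d L.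
    scalar_prod g (\<theta>' - \<theta>) + c * (wnorm A (\<theta>' - \<theta>))\<^sup>2 \<le> scalar_prod g (x - \<theta>) + c * (wnorm A (x - \<theta>))\<^sup>2"
proof -
  define obj where "obj x = scalar_prod g (x - \<theta>) + c * (wnorm A (x - \<theta>))\<^sup>2" for x
  define K where "K = {f. \<forall>i. if i < d then \<bar>f i\<bar> \<le> L else f i = (0::real)} \<inter> {f. (\<Sum>i<d. (f i)\<^sup>2) \<le> L\<^sup>2}"
  have cont: "continuous_on S (\<lambda>f :: nat \<Rightarrow> real. f i)" for S i
    by (rule continuous_on_subset[OF continuous_on_product_coordinates]) simp
  have "closed {f :: nat \<Rightarrow> real. (\<Sum>i<d. (f i)\<^sup>2) \<le> L\<^sup>2}"
    by (intro closed_Collect_le continuous_intros cont)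
  then have K: "compact K" unfolding K_def by (intro compact_Int_closed compact_coordinate_box)
  have K0: "(\<lambda>_. 0) \<in> K" using L by (simp add: K_def)
  have vn: "(vnorm x)\<^sup>2 = (\<Sum>i<d. (vec_index x i)\<^sup>2)" if "x \<in> carrier_vec d" for x
    using that by (simp add: vnorm_def scalar_prod_def atLeast0LessThan sum_nonneg flip: power2_eq_square)
  have vn0: "0 \<le> vnorm x" for x by (simp add: vnorm_def scalar_prod_def sum_nonneg)
  have Kimg: "Matrix.vec d f \<in> Theta d L" if "f \<in> K" for f
  proof -
    have "(vnorm (Matrix.vec d f))\<^sup>2 \<le> L\<^sup>2" using that vn[of "Matrix.vec d f"] by (simp add: K_def)
    then have "vnorm (Matrix.vec d f) \<le> L" using L by (rule power2_le_imp_le)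
    then show ?thesis by (simp add: Theta_def)
  qed
  have Ksurj: "\<exists>f\<in>K. x = Matrix.vec d f" if "x \<in> Theta d L" for x
  proof -
    have x: "x \<in> carrier_vec d" "vnorm x \<le> L" using that by (auto simp: Theta_def)
    define f where "f i = (if i < d then vec_index x i else 0)" for i
    have s: "(\<Sum>i<d. (f i)\<^sup>2) \<le> L\<^sup>2"
      using power_mono[OF x(2) vn0, of 2] vn[OF x(1)] by (simp add: f_def)
    have "\<bar>f i\<bar> \<le> L" if "i < d" for i
    proof -
      have "(f i)\<^sup>2 \<le> (\<Sum>i<d. (f i)\<^sup>2)" using that by (intro member_le_sum) auto
      with s have "\<bar>f i\<bar>\<^sup>2 \<le> L\<^sup>2" by simp
      then show ?thesis using L by (rule power2_le_imp_le)
    qed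
    with s have "f \<in> K" by (auto simp: K_def f_def)
    moreover have "x = Matrix.vec d f" using x by (intro eq_vecI) (auto simp: f_def)
    ultimately show ?thesis by blast
  qed
  have "obj (Matrix.vec d f) = (\<Sum>i<d. vec_index g i * (f i - vec_index \<theta> i)) +
      c * \<bar>\<Sum>i<d. (f i - vec_index \<theta> i) * (\<Sum>j<d. A $$ (i, j) * (f j - vec_index \<theta> j))\<bar>" for f
  proof -
    have "scalar_prod (Matrix.vec d f - \<theta>) (A *\<^sub>v (Matrix.vec d f - \<theta>)) =
      (\<Sum>i<d. (f i - vec_index \<theta> i) * (\<Sum>j<d. A $$ (i, j) * (f j - vec_index \<theta> j)))"
      using \<theta> A by (simp add: scalar_prod_def atLeast0LessThan)
    \<comment> \<open>\<open>sqrt\<close> is extended to negative reals as an odd function, so the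
      square of \<open>wnorm\<close> is an absolute value and the objective is continuous for every
      \<open>A\<close>.\<close>
    moreover have "(sqrt q)\<^sup>2 = \<bar>q\<bar>" for q :: real
      by (simp add: power2_eq_square)
    ultimately show ?thesis
      using \<theta> g by (simp add: obj_def wnorm_def scalar_prod_def[of g] atLeast0LessThan)
  qed
  then have "continuous_on K (\<lambda>f. obj (Matrix.vec d f))"
    by (simp only:) (intro continuous_intros cont)
  from continuous_attains_inf[OF K _ this] K0
  obtain f where f: "f \<in> K" "\<And>h. h \<in> K \<Longrightarrow> obj (Matrix.vec d f) \<le> obj (Matrix.vec d h)" by blast
  have "\<forall>x\<in>Theta d L. obj (Matrix.vec d f) \<le> obj x" using Ksurj f(2) by blast
  then show ?thesis using Kimg[OF f(1)] unfolding obj_def by blast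
qed

section \<open>Iterates of the algorithm\<close>

text \<open>\<open>ln (1 + x)\<close> is at least \<open>x / (1 + x)\<close>, and the denominator is
  at most 2 on the unit interval.\<close>

lemma le_two_ln_one_plus:
  fixes x :: real assumes "0 \<le> x" "x \<le> 1" shows "x \<le> 2 * ln (1 + x)"
proof -
  have "ln (inverse (1 + x)) \<le> inverse (1 + x) - 1" using assms by (intro ln_le_minus_one) simp
  then have "1 - inverse (1 + x) \<le> ln (1 + x)" using assms by (simp add: ln_inverse)
  moreover have "x / 2 \<le> x / (1 + x)" using assms by (intro divide_left_mono) auto
  moreover have "x / (1 + x) = 1 - inverse (1 + x)" using assms by (simp add: field_simps)
  ultimately show ?thesis by linarith
qed

lemma vec_index_le_vnorm:
  assumes "v \<in> carrier_vec n" "j < n" shows "\<bar>vec_index v j\<bar> \<le> vnorm v"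
proof -
  have "(vec_index v j)\<^sup>2 \<le> (\<Sum>i<n. (vec_index v i)\<^sup>2)" using assms by (intro member_le_sum) auto
  then have "sqrt ((vec_index v j)\<^sup>2) \<le> sqrt (\<Sum>i<n. (vec_index v i)\<^sup>2)" by (rule real_sqrt_le_mono)
  then show ?thesis using assms
    by (simp add: vnorm_def scalar_prod_def atLeast0LessThan flip: power2_eq_square)
qed

text \<open>The index \<open>i\<close> counts processed transitions and therefore describes time
  \<open>i + 1\<close>; the radius that belongs to it is \<open>beta M (Suc i)\<close>.\<close>

definition alg_at :: "ucparams \<Rightarrow> (nat \<times> nat \<times> nat) list \<Rightarrow> nat \<Rightarrow> astate" where
  "alg_at M xs i = alg_state M (take i xs)"

definition alg_theta :: "ucparams \<Rightarrow> (nat \<times> nat \<times> nat) list \<Rightarrow> nat \<Rightarrow> real Matrix.vec" where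
  "alg_theta M xs i = fst (alg_at M xs i)"

definition alg_Sigma :: "ucparams \<Rightarrow> (nat \<times> nat \<times> nat) list \<Rightarrow> nat \<Rightarrow> real mat" where
  "alg_Sigma M xs i = fst (snd (alg_at M xs i))"

definition alg_Sigma_ep :: "ucparams \<Rightarrow> (nat \<times> nat \<times> nat) list \<Rightarrow> nat \<Rightarrow> real mat" where
  "alg_Sigma_ep M xs i = fst (snd (snd (alg_at M xs i)))"

definition alg_Q :: "ucparams \<Rightarrow> (nat \<times> nat \<times> nat) list \<Rightarrow> nat \<Rightarrow> nat \<Rightarrow> nat \<Rightarrow> real" where
  "alg_Q M xs i = snd (snd (snd (alg_at M xs i)))"

lemma alg_at_eq: "alg_at M xs i = (alg_theta M xs i, alg_Sigma M xs i, alg_Sigma_ep M xs i, alg_Q M xs i)"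
  by (simp add: alg_theta_def alg_Sigma_def alg_Sigma_ep_def alg_Q_def)

lemma alg_run_from_snoc:
  "alg_run_from M t (xs @ [x]) st = alg_next M (t + length xs) x (alg_run_from M t xs st)"
  by (induction xs arbitrary: t st) auto

lemma alg_at_Suc:
  assumes "i < length xs"
  shows "alg_at M xs (Suc i) = alg_next M (Suc i) (xs ! i) (alg_at M xs i)"
  using assms by (simp add: alg_at_def alg_state_def take_Suc_conv_app_nth alg_run_from_snoc)

lemma alg_at_0:
  "alg_theta M xs 0 = 0\<^sub>v (dim M)" "alg_Sigma M xs 0 = lam M \<cdot>\<^sub>m 1\<^sub>m (dim M)"
  "alg_Sigma_ep M xs 0 = alg_Sigma M xs 0"
  "alg_Q M xs 0 = devi M (Pset M 1 (alg_theta M xs 0) (alg_Sigma M xs 0)) (NN M)"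
  by (simp_all add: alg_theta_def alg_Sigma_def alg_Sigma_ep_def alg_Q_def alg_at_def alg_state_def
      alg_init_def Let_def)

definition alg_objective :: "ucparams \<Rightarrow> nat \<times> nat \<times> nat \<Rightarrow> real Matrix.vec \<Rightarrow> real mat \<Rightarrow> real Matrix.vec \<Rightarrow> real" where
  "alg_objective M tr \<theta> \<Sigma> x = (case tr of (s, a, s2) \<Rightarrow>
     scalar_prod (grad (dim M) (loss M s a s2) \<theta>) (x - \<theta>)
     + 1 / (2 * eta M) * (wnorm (\<Sigma> + eta M \<cdot>\<^sub>m hess (dim M) (loss M s a s2) \<theta>) (x - \<theta>)) ^ 2)"

lemma alg_step:
  assumes "i < length xs" "xs ! i = (s, a, s2)"
  shows "alg_theta M xs (Suc i) = (SOME \<theta>'. \<theta>' \<in> Theta (dim M) (Lth M) \<and>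
      (\<forall>x\<in>Theta (dim M) (Lth M). alg_objective M (xs ! i) (alg_theta M xs i) (alg_Sigma M xs i) \<theta>'
         \<le> alg_objective M (xs ! i) (alg_theta M xs i) (alg_Sigma M xs i) x))" (is ?A)
    and "alg_Sigma M xs (Suc i) = alg_Sigma M xs i + hess (dim M) (loss M s a s2) (alg_theta M xs (Suc i))" (is ?B)
    and "Determinant.det (alg_Sigma M xs (Suc i)) \<le> 2 * Determinant.det (alg_Sigma_ep M xs i) \<Longrightarrow>
      alg_Sigma_ep M xs (Suc i) = alg_Sigma_ep M xs i \<and> alg_Q M xs (Suc i) = alg_Q M xs i"
    and "\<not> Determinant.det (alg_Sigma M xs (Suc i)) \<le> 2 * Determinant.det (alg_Sigma_ep M xs i) \<Longrightarrow>
      alg_Sigma_ep M xs (Suc i) = alg_Sigma M xs (Suc i) \<and>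
      alg_Q M xs (Suc i) = devi M (Pset M (Suc (Suc i)) (alg_theta M xs (Suc i)) (alg_Sigma M xs (Suc i))) (NN M)"
proof -
  note e = alg_at_Suc[OF assms(1), of M, unfolded alg_at_eq[of M xs i] alg_next_def assms(2)]
  show A: ?A
    unfolding alg_theta_def[of M xs "Suc i"] e assms(2) alg_objective_def by (simp add: Let_def)
  have th: "alg_theta M xs (Suc i) = (SOME \<theta>'. \<theta>' \<in> Theta (dim M) (Lth M) \<and>
      (\<forall>x\<in>Theta (dim M) (Lth M).
        scalar_prod (grad (dim M) (loss M s a s2) (alg_theta M xs i)) (\<theta>' - alg_theta M xs i)
     + 1 / (2 * eta M) * (wnorm (alg_Sigma M xs i + eta M \<cdot>\<^sub>m hess (dim M) (loss M s a s2) (alg_theta M xs i)) (\<theta>' - alg_theta M xs i)) ^ 2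
      \<le> scalar_prod (grad (dim M) (loss M s a s2) (alg_theta M xs i)) (x - alg_theta M xs i)
     + 1 / (2 * eta M) * (wnorm (alg_Sigma M xs i + eta M \<cdot>\<^sub>m hess (dim M) (loss M s a s2) (alg_theta M xs i)) (x - alg_theta M xs i)) ^ 2))"
    using A unfolding assms(2) alg_objective_def by simp
  note e' = e[simplified Let_def prod.case, folded th]
  show B: ?B
    unfolding alg_Sigma_def[of M xs "Suc i"] e' by simp
  note e'' = e'[folded B]
  show "Determinant.det (alg_Sigma M xs (Suc i)) \<le> 2 * Determinant.det (alg_Sigma_ep M xs i) \<Longrightarrow>
      alg_Sigma_ep M xs (Suc i) = alg_Sigma_ep M xs i \<and> alg_Q M xs (Suc i) = alg_Q M xs i"
    unfolding alg_Sigma_ep_def[of M xs "Suc i"] alg_Q_def[of M xs "Suc i"] e'' by simp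
  show "\<not> Determinant.det (alg_Sigma M xs (Suc i)) \<le> 2 * Determinant.det (alg_Sigma_ep M xs i) \<Longrightarrow>
      alg_Sigma_ep M xs (Suc i) = alg_Sigma M xs (Suc i) \<and>
      alg_Q M xs (Suc i) = devi M (Pset M (Suc (Suc i)) (alg_theta M xs (Suc i)) (alg_Sigma M xs (Suc i))) (NN M)"
    unfolding alg_Sigma_ep_def[of M xs "Suc i"] alg_Q_def[of M xs "Suc i"] e'' by simp
qed

locale mnl_mdp =
  fixes M :: ucparams and \<theta>s :: "real Matrix.vec" and L\<phi> :: real
  assumes finS: "finite (pS M)" and finA: "finite (pA M)" and A_ne: "pA M \<noteq> {}"
    and rew: "\<And>s a. s \<in> pS M \<Longrightarrow> a \<in> pA M \<Longrightarrow> 0 \<le> rew M s a \<and> rew M s a \<le> 1"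
    and Ssa: "\<And>s a. s \<in> pS M \<Longrightarrow> a \<in> pA M \<Longrightarrow> pSsa M s a \<subseteq> pS M \<and> pSsa M s a \<noteq> {}"
    and phi_carrier: "\<And>s a k. s \<in> pS M \<Longrightarrow> a \<in> pA M \<Longrightarrow> k \<in> pSsa M s a \<Longrightarrow> phi M s a k \<in> carrier_vec (dim M)"
    and phi_le: "\<And>s a k. s \<in> pS M \<Longrightarrow> a \<in> pA M \<Longrightarrow> k \<in> pSsa M s a \<Longrightarrow> vnorm (phi M s a k) \<le> L\<phi>"
    and phi_zero: "\<And>s a. s \<in> pS M \<Longrightarrow> a \<in> pA M \<Longrightarrow> \<exists>k\<in>pSsa M s a. phi M s a k = 0\<^sub>v (dim M)"
    and \<theta>s: "\<theta>s \<in> Theta (dim M) (Lth M)"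
    and disc: "0 \<le> disc M" "disc M < 1"
begin

abbreviation "D \<equiv> dim M"
abbreviation "pstar \<equiv> mnl (phi M) (pSsa M) \<theta>s"

lemma model: "s \<in> pS M \<Longrightarrow> a \<in> pA M \<Longrightarrow> mnl_model M s a"
  using Ssa phi_carrier finite_subset[OF _ finS] by unfold_locales blast+

lemma \<theta>s_carrier: "\<theta>s \<in> carrier_vec D" using \<theta>s by (simp add: Theta_def)

lemma vnorm_nonneg: "0 \<le> vnorm x" by (simp add: vnorm_def scalar_prod_def sum_nonneg)

lemma Lth_nonneg: "0 \<le> Lth M" using \<theta>s vnorm_nonneg[of \<theta>s] by (simp add: Theta_def)

lemma zero_Theta: "0\<^sub>v D \<in> Theta D (Lth M)"
  using Lth_nonneg by (simp add: Theta_def vnorm_def scalar_prod_def)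

definition valid :: "(nat \<times> nat \<times> nat) list \<Rightarrow> bool" where
  "valid xs \<longleftrightarrow> (\<forall>(s, a, s2)\<in>set xs. s \<in> pS M \<and> a \<in> pA M \<and> s2 \<in> pSsa M s a)"

lemma validD:
  assumes "valid xs" "i < length xs" "xs ! i = (s, a, s2)"
  shows "s \<in> pS M" "a \<in> pA M" "s2 \<in> pSsa M s a"
  using assms nth_mem[OF assms(2)] unfolding valid_def by fastforce+

text \<open>Weights and centre come from the estimate after the step, because the algorithm adds the
  Hessian at that estimate to the matrix.\<close>

definition upd :: "(nat \<times> nat \<times> nat) list \<Rightarrow> nat \<Rightarrow> nat \<Rightarrow> nat \<Rightarrow> nat \<Rightarrow> real Matrix.vec" where
  "upd xs i s a k = sqrt (mnl (phi M) (pSsa M) (alg_theta M xs (Suc i)) s a k) \<cdot>\<^sub>v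
     (phi M s a k - mean_feat M (alg_theta M xs (Suc i)) s a)"

lemma theta_Sigma_carrier:
  assumes "valid xs" "i \<le> length xs"
  shows "alg_theta M xs i \<in> Theta D (Lth M) \<and> alg_Sigma M xs i \<in> carrier_mat D D"
  using assms(2)
proof (induction i)
  case 0
  then show ?case using zero_Theta by (simp add: alg_at_0)
next
  case (Suc i)
  then have i: "i < length xs" by simp
  obtain s a s2 where x: "xs ! i = (s, a, s2)" by (cases "xs ! i")
  note v = validD[OF assms(1) i x]
  let ?P = "\<lambda>\<theta>'. \<theta>' \<in> Theta D (Lth M) \<and>
      (\<forall>x\<in>Theta D (Lth M). alg_objective M (xs ! i) (alg_theta M xs i) (alg_Sigma M xs i) \<theta>'
         \<le> alg_objective M (xs ! i) (alg_theta M xs i) (alg_Sigma M xs i) x)"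
  have "alg_theta M xs i \<in> carrier_vec D" and S: "alg_Sigma M xs i \<in> carrier_mat D D"
    using Suc by (auto simp: Theta_def)
  then have "\<exists>\<theta>'. ?P \<theta>'"
    unfolding x alg_objective_def prod.case Bex_def[symmetric]
    by (intro quadratic_attains_min_on_Theta Lth_nonneg) (auto simp: grad_def hess_def)
  then have "?P (alg_theta M xs (Suc i))"
    unfolding alg_step(1)[OF i x] by (rule someI_ex)
  moreover have "alg_Sigma M xs (Suc i) \<in> carrier_mat D D"
    unfolding alg_step(2)[OF i x] using S by (simp add: hess_def)
  ultimately show ?case by blast
qed

context
  fixes xs assumes valid: "valid xs"
begin

abbreviation "th \<equiv> alg_theta M xs"
abbreviation "Sg \<equiv> alg_Sigma M xs"
abbreviation "dt i \<equiv> Determinant.det (Sg i)"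

lemma th_Theta: "i \<le> length xs \<Longrightarrow> th i \<in> Theta D (Lth M)"
  using theta_Sigma_carrier[OF valid] by blast

lemma th_carrier: "i \<le> length xs \<Longrightarrow> th i \<in> carrier_vec D"
  using th_Theta by (auto simp: Theta_def)

lemma Sg_Suc:
  assumes i: "i < length xs" and x: "xs ! i = (s, a, s2)"
  shows "Sg (Suc i) = Sg i + gram D (pSsa M s a) (upd xs i s a)"
proof -
  note v = validD[OF valid i x]
  interpret mnl_model M s a by (rule model[OF v(1,2)])
  have "upd xs i s a = (\<lambda>k. sqrt (p (th (Suc i)) k) \<cdot>\<^sub>v (\<phi> k - mean (th (Suc i))))"
    by (simp add: fun_eq_iff upd_def)
  then show ?thesis unfolding alg_step(2)[OF i x] using hess_loss[OF v(3) th_carrier] i by simp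
qed

text \<open>The witness \<open>j\<close> is the index at which the current episode began. The
  determinant test keeps the ratio at most 2 until a restart, which resets \<open>j\<close> to the
  current index.\<close>

lemma episode_start:
  assumes "\<And>i. i \<le> length xs \<Longrightarrow> 0 \<le> dt i" and "i \<le> length xs"
  shows "\<exists>j\<le>i. alg_Sigma_ep M xs i = Sg j \<and>
    alg_Q M xs i = devi M (Pset M (Suc j) (th j) (Sg j)) (NN M) \<and> dt i \<le> 2 * dt j"
  using assms(2)
proof (induction i)
  case 0
  then show ?case using assms(1)[of 0] by (simp add: alg_at_0)
next
  case (Suc i)
  then have i: "i < length xs" by simp
  obtain s a s2 where x: "xs ! i = (s, a, s2)" by (cases "xs ! i")
  obtain j where j: "j \<le> i" "alg_Sigma_ep M xs i = Sg j"
    "alg_Q M xs i = devi M (Pset M (Suc j) (th j) (Sg j)) (NN M)" using Suc i by auto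
  show ?case
  proof (cases "dt (Suc i) \<le> 2 * Determinant.det (alg_Sigma_ep M xs i)")
    case True
    with j alg_step(3)[OF i x True] show ?thesis by (intro exI[of _ j]) auto
  next
    case False
    with alg_step(4)[OF i x False] assms(1)[OF Suc.prems] show ?thesis by (intro exI[of _ "Suc i"]) auto
  qed
qed

section \<open>Elliptical potential and number of policy switches\<close>

context
  assumes lam: "0 < lam M" and lamL: "4 * L\<phi>\<^sup>2 \<le> lam M"
begin

lemma pd_Sg0: "pd D (Sg 0)"
proof -
  have "psd D (lam M \<cdot>\<^sub>m 1\<^sub>m D)"
    unfolding psd_def using lam
    by (auto simp: smult_mat_vec_one scalar_prod_def mult_ac intro!: sum_nonneg)
  then show ?thesis using lam by (simp add: pd_def alg_at_0)
qed

lemma det_Sg0: "dt 0 = lam M ^ D" by (simp add: alg_at_0)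

lemma minv_Sg0:
  assumes x: "x \<in> carrier_vec D"
  shows "wnorm (minv (Sg 0)) x = vnorm x / sqrt (lam M)"
proof -
  have c: "(1 / lam M) \<cdot>\<^sub>v x \<in> carrier_vec D" using x by simp
  have "Sg 0 *\<^sub>v ((1 / lam M) \<cdot>\<^sub>v x) = x"
    using x lam by (intro eq_vecI) (auto simp: alg_at_0)
  then have "minv (Sg 0) *\<^sub>v x = (1 / lam M) \<cdot>\<^sub>v x" using pd_solve(3)[OF pd_Sg0 c] by simp
  then show ?thesis using x by (simp add: wnorm_def vnorm_def real_sqrt_divide)
qed

lemma upd_carrier:
  assumes "i < length xs" "xs ! i = (s, a, s2)" "k \<in> pSsa M s a"
  shows "upd xs i s a k \<in> carrier_vec D"
  using phi_carrier validD[OF valid assms(1,2)] assms(3) by (simp add: upd_def mean_feat_def)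

lemma pd_Sg: "i \<le> length xs \<Longrightarrow> pd D (Sg i)"
proof (induction i)
  case 0 show ?case by (rule pd_Sg0)
next
  case (Suc i)
  then have i: "i < length xs" by simp
  obtain s a s2 where x: "xs ! i = (s, a, s2)" by (cases "xs ! i")
  note v = validD[OF valid i x]
  interpret mnl_model M s a by (rule model[OF v(1,2)])
  show ?case unfolding Sg_Suc[OF i x]
    using Suc i upd_carrier[OF i x] fin by (intro pd_gram_update) auto
qed

lemma dt_pos: "i \<le> length xs \<Longrightarrow> 0 < dt i" using pd_Sg by (simp add: pd_def)

text \<open>This is the \<open>x\<^sub>t\<close> of the overview: the trace of the covariance added
  at step \<open>i\<close>, centred at the new estimate but measured by the inverse of the old
  matrix, as the determinant lemma requires.\<close>

definition potential :: "nat \<Rightarrow> real" where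
  "potential i = (case xs ! i of (s, a, s2) \<Rightarrow> \<Sum>k\<in>pSsa M s a. mnl (phi M) (pSsa M) (th (Suc i)) s a k *
     (wnorm (minv (Sg i)) (phi M s a k - mean_feat M (th (Suc i)) s a))\<^sup>2)"

lemma step_facts:
  assumes i: "i < length xs"
  shows step_quadratic: "x \<in> carrier_vec D \<Longrightarrow> wnorm (Sg i) x \<le> wnorm (Sg (Suc i)) x"
    and step_minv: "x \<in> carrier_vec D \<Longrightarrow> wnorm (minv (Sg (Suc i))) x \<le> wnorm (minv (Sg i)) x"
    and step_det_minv: "x \<in> carrier_vec D \<Longrightarrow>
      dt i * (wnorm (minv (Sg i)) x)\<^sup>2 \<le> dt (Suc i) * (wnorm (minv (Sg (Suc i))) x)\<^sup>2"
    and step_det: "dt i * (1 + potential i) \<le> dt (Suc i)"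
    and potential_nonneg: "0 \<le> potential i"
proof -
  obtain s a s2 where x: "xs ! i = (s, a, s2)" by (cases "xs ! i")
  note v = validD[OF valid i x]
  interpret mnl_model M s a by (rule model[OF v(1,2)])
  have P: "pd D (Sg i)" and P': "pd D (Sg (Suc i))" using pd_Sg i by auto
  have uc: "upd xs i s a k \<in> carrier_vec D" if "k \<in> I" for k by (rule upd_carrier[OF i x that])
  note g = gram_update[where y = "upd xs i s a", OF P fin uc, folded Sg_Suc[OF i x]]
  show "wnorm (Sg i) x \<le> wnorm (Sg (Suc i)) x" if "x \<in> carrier_vec D" for x
    using g(2)[OF _ that] by (simp add: wnorm_def sum_nonneg)
  show "wnorm (minv (Sg (Suc i))) x \<le> wnorm (minv (Sg i)) x" if "x \<in> carrier_vec D" for x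
    using g(3)[OF _ that] by (simp add: wnorm_def)
  show "dt i * (wnorm (minv (Sg i)) x)\<^sup>2 \<le> dt (Suc i) * (wnorm (minv (Sg (Suc i))) x)\<^sup>2"
    if "x \<in> carrier_vec D" for x
    using g(4)[OF _ that] by (simp add: wnorm_square[OF psd_minv[OF P] that] wnorm_square[OF psd_minv[OF P'] that])
  have "scalar_prod (upd xs i s a k) (minv (Sg i) *\<^sub>v upd xs i s a k) =
    p (th (Suc i)) k * (wnorm (minv (Sg i)) (\<phi> k - mean (th (Suc i))))\<^sup>2" if "k \<in> I" for k
  proof -
    have c: "\<phi> k - mean (th (Suc i)) \<in> carrier_vec D" using phi[OF that] by simp
    have "(wnorm (minv (Sg i)) (upd xs i s a k))\<^sup>2 = p (th (Suc i)) k * (wnorm (minv (Sg i)) (\<phi> k - mean (th (Suc i))))\<^sup>2"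
      unfolding upd_def wnorm_smult[OF psd_minv[OF P] c] by (simp add: power_mult_distrib mnl_nonneg)
    then show ?thesis using wnorm_square[OF psd_minv[OF P] upd_carrier[OF i x that]] by simp
  qed
  then have "potential i = (\<Sum>k\<in>I. scalar_prod (upd xs i s a k) (minv (Sg i) *\<^sub>v upd xs i s a k))"
    by (simp add: potential_def x)
  then show "dt i * (1 + potential i) \<le> dt (Suc i)" using g(5) by simp
  show "0 \<le> potential i" unfolding potential_def x by (auto intro!: sum_nonneg simp: mnl_nonneg)
qed

lemma dt_Suc_ge: "i < length xs \<Longrightarrow> dt i \<le> dt (Suc i)"
  using step_det[of i] potential_nonneg[of i] dt_pos[of i]
  by (smt (verit) less_imp_le_nat mult_le_cancel_left1)

lemma mono_facts:
  assumes "j \<le> i" "i \<le> length xs" and x: "x \<in> carrier_vec D"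
  shows Sg_mono: "wnorm (Sg j) x \<le> wnorm (Sg i) x"
    and minv_antimono: "wnorm (minv (Sg i)) x \<le> wnorm (minv (Sg j)) x"
    and det_minv_mono: "dt j * (wnorm (minv (Sg j)) x)\<^sup>2 \<le> dt i * (wnorm (minv (Sg i)) x)\<^sup>2"
proof -
  have "wnorm (Sg j) x \<le> wnorm (Sg i) x \<and> wnorm (minv (Sg i)) x \<le> wnorm (minv (Sg j)) x \<and>
    dt j * (wnorm (minv (Sg j)) x)\<^sup>2 \<le> dt i * (wnorm (minv (Sg i)) x)\<^sup>2"
    using assms(1,2)
  proof (induction i rule: dec_induct)
    case (step i)
    then show ?case
      using step_quadratic[of i x] step_minv[of i x] step_det_minv[of i x] x by force
  qed simp
  then show "wnorm (Sg j) x \<le> wnorm (Sg i) x" "wnorm (minv (Sg i)) x \<le> wnorm (minv (Sg j)) x"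
    "dt j * (wnorm (minv (Sg j)) x)\<^sup>2 \<le> dt i * (wnorm (minv (Sg i)) x)\<^sup>2" by blast+
qed

text \<open>\<open>Sg i\<close> dominates \<open>Sg 0\<close>, so every centred feature has length
  at most \<open>2 * L\<phi> / sqrt (lam M)\<close>, which the assumption \<open>lamL\<close> makes
  at most 1.\<close>

lemma potential_le_1:
  assumes i: "i < length xs" shows "potential i \<le> 1"
proof -
  obtain s a s2 where x: "xs ! i = (s, a, s2)" by (cases "xs ! i")
  note v = validD[OF valid i x]
  interpret mnl_model M s a by (rule model[OF v(1,2)])
  have P: "pd D (Sg i)" using pd_Sg i by auto
  let ?m = "L\<phi> / sqrt (lam M)"
  have m: "wnorm (minv (Sg i)) (\<phi> k) \<le> ?m" if "k \<in> I" for k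
    using minv_antimono[of 0 i "\<phi> k"] minv_Sg0[OF phi[OF that]] phi[OF that] i lam
      divide_right_mono[OF phi_le[OF v(1,2) that], of "sqrt (lam M)"] by simp
  have "potential i \<le> (\<Sum>k\<in>I. p (th (Suc i)) k * 1)"
    unfolding potential_def x prod.case
  proof (intro sum_mono mult_left_mono mnl_nonneg)
    fix k assume k: "k \<in> I"
    have c: "\<phi> k - mean (th (Suc i)) \<in> carrier_vec D" using phi[OF k] by simp
    have "wnorm (minv (Sg i)) (\<phi> k - mean (th (Suc i))) \<le> 2 * ?m"
      by (rule wnorm_centered_le[OF P m k])
    then have "(wnorm (minv (Sg i)) (\<phi> k - mean (th (Suc i))))\<^sup>2 \<le> (2 * ?m)\<^sup>2"
      by (intro power_mono wnorm_nonneg[OF psd_minv[OF P] c])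
    also have "\<dots> \<le> 1" using lam lamL by (simp add: power_mult_distrib power_divide)
    finally show "(wnorm (minv (Sg i)) (\<phi> k - mean (th (Suc i))))\<^sup>2 \<le> 1" .
  qed
  then show ?thesis by (simp add: mnl_sum)
qed

lemma Sg_entry_le:
  assumes "i \<le> length xs" "u < D" "w < D"
  shows "\<bar>Sg i $$ (u, w)\<bar> \<le> lam M * (1 + real i)"
  using assms(1)
proof (induction i)
  case 0
  then show ?case using assms lam by (simp add: alg_at_0)
next
  case (Suc i)
  then have i: "i < length xs" by simp
  obtain s a s2 where x: "xs ! i = (s, a, s2)" by (cases "xs ! i")
  note v = validD[OF valid i x]
  interpret mnl_model M s a by (rule model[OF v(1,2)])
  let ?\<theta> = "th (Suc i)"
  have ph: "\<bar>vec_index (\<phi> k) j\<bar> \<le> L\<phi>" if "k \<in> I" "j < D" for k j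
    using vec_index_le_vnorm[OF phi[OF that(1)] that(2)] phi_le[OF v(1,2) that(1)] by linarith
  have mn: "\<bar>vec_index (mean ?\<theta>) j\<bar> \<le> L\<phi>" if "j < D" for j
  proof -
    have "\<bar>vec_index (mean ?\<theta>) j\<bar> \<le> (\<Sum>k\<in>I. p ?\<theta> k * L\<phi>)"
      unfolding mean_index[OF that] using ph that
      by (intro order.trans[OF sum_abs] sum_mono) (simp add: abs_mult mnl_nonneg mult_left_mono)
    then show ?thesis by (simp add: mnl_sum flip: sum_distrib_right)
  qed
  have up: "\<bar>vec_index (upd xs i s a k) j\<bar> \<le> sqrt (p ?\<theta> k) * (2 * L\<phi>)" if "k \<in> I" "j < D" for k j
  proof -
    have "vec_index (upd xs i s a k) j = sqrt (p ?\<theta> k) * (vec_index (\<phi> k) j - vec_index (mean ?\<theta>) j)"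
      using that mean_carrier[of ?\<theta>, THEN carrier_vecD] by (simp add: upd_def del: mean_carrier)
    then show ?thesis using ph[OF that] mn[OF that(2)]
      by (simp add: abs_mult mnl_nonneg mult_left_mono)
  qed
  have "\<bar>gram D I (upd xs i s a) $$ (u, w)\<bar> \<le> (\<Sum>k\<in>I. \<bar>vec_index (upd xs i s a k) u * vec_index (upd xs i s a k) w\<bar>)"
    using assms by (simp add: gram_def sum_abs)
  also have "\<dots> \<le> (\<Sum>k\<in>I. p ?\<theta> k * (4 * L\<phi>\<^sup>2))"
  proof (rule sum_mono)
    fix k assume k: "k \<in> I"
    have "\<bar>vec_index (upd xs i s a k) u * vec_index (upd xs i s a k) w\<bar>
        \<le> (sqrt (p ?\<theta> k) * (2 * L\<phi>)) * (sqrt (p ?\<theta> k) * (2 * L\<phi>))"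
      unfolding abs_mult by (rule mult_mono'[OF up[OF k assms(2)] up[OF k assms(3)]]) simp_all
    also have "\<dots> = (sqrt (p ?\<theta> k) * sqrt (p ?\<theta> k)) * (4 * L\<phi>\<^sup>2)"
      by (simp only: power2_eq_square mult_ac numeral_times_numeral mult_numeral_left semiring_norm)
    finally show "\<bar>vec_index (upd xs i s a k) u * vec_index (upd xs i s a k) w\<bar> \<le> p ?\<theta> k * (4 * L\<phi>\<^sup>2)"
      by (simp add: mnl_nonneg)
  qed
  also have "\<dots> \<le> lam M" using lamL by (simp add: mnl_sum flip: sum_distrib_right)
  finally have "\<bar>gram D I (upd xs i s a) $$ (u, w)\<bar> \<le> lam M" .
  moreover have "Sg (Suc i) $$ (u, w) = Sg i $$ (u, w) + gram D I (upd xs i s a) $$ (u, w)"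
    using assms theta_Sigma_carrier[OF valid, of i] i unfolding Sg_Suc[OF i x] by (simp add: gram_def)
  ultimately show ?case using Suc i by (simp add: algebra_simps)
qed

text \<open>The entries of \<open>Sg i\<close> are at most \<open>lam M * (1 + i)\<close>, so the
  powers of \<open>lam M\<close> cancel in the ratio. The factor \<open>D\<close> inside the
  logarithm is the price of the Leibniz formula; it is absorbed later by
  \<open>D \<le> sqrt T\<close>.\<close>

lemma ln_det_ratio_le:
  assumes i: "i \<le> length xs" and D: "0 < D"
  shows "ln (dt i / dt 0) \<le> real D * ln (real D * (1 + real i))"
proof -
  have "dt i \<le> (real D * (lam M * (1 + real i))) ^ D"
    using abs_det_le[OF pd_carrier[OF pd_Sg[OF i]] Sg_entry_le[OF i]] by linarith
  also have "\<dots> = (real D * (1 + real i)) ^ D * dt 0"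
    by (simp add: det_Sg0 power_mult_distrib)
  finally have "dt i / dt 0 \<le> (real D * (1 + real i)) ^ D" using dt_pos[of 0] by (simp add: pos_divide_le_eq)
  then have "ln (dt i / dt 0) \<le> ln ((real D * (1 + real i)) ^ D)"
    using dt_pos[of 0] dt_pos[OF i] by (intro ln_mono) auto
  also have "\<dots> = real D * ln (real D * (1 + real i))" using D by (simp add: ln_realpow)
  finally show ?thesis .
qed

lemma sum_potential_le:
  "i \<le> length xs \<Longrightarrow> (\<Sum>j<i. potential j) \<le> 2 * ln (dt i / dt 0)"
proof (induction i)
  case 0
  then show ?case using dt_pos[of 0] by simp
next
  case (Suc i)
  then have i: "i < length xs" by simp
  note z = potential_nonneg[OF i] potential_le_1[OF i] and p = dt_pos[of i] dt_pos[OF Suc.prems] dt_pos[of 0]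
  have "potential i / 2 \<le> ln (1 + potential i)" using le_two_ln_one_plus[OF z] by simp
  also have "\<dots> \<le> ln (dt (Suc i) / dt i)"
    using step_det[OF i] p i z by (intro ln_mono) (auto simp: field_simps)
  also have "\<dots> = ln (dt (Suc i) / dt 0) - ln (dt i / dt 0)"
    using p i by (simp add: ln_div)
  finally show ?case using Suc i by simp
qed

text \<open>Changes of \<open>Q\<close> are counted instead of restarts, because a restart that
  reproduces the same \<open>Q\<close> causes no regret. Every change comes with a restart, and a
  restart more than doubles the determinant recorded for the episode.\<close>

lemma episodes_le:
  "i \<le> length xs \<Longrightarrow> 2 ^ card {j. j < i \<and> alg_Q M xs (Suc j) \<noteq> alg_Q M xs j} * dt 0
     \<le> Determinant.det (alg_Sigma_ep M xs i) \<and> Determinant.det (alg_Sigma_ep M xs i) \<le> dt i"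
proof (induction i)
  case 0
  then show ?case by (simp add: alg_at_0)
next
  case (Suc i)
  then have i: "i < length xs" by simp
  obtain s a s2 where x: "xs ! i = (s, a, s2)" by (cases "xs ! i")
  let ?C = "\<lambda>i. {j. j < i \<and> alg_Q M xs (Suc j) \<noteq> alg_Q M xs j}"
  have IH: "2 ^ card (?C i) * dt 0 \<le> Determinant.det (alg_Sigma_ep M xs i)" "Determinant.det (alg_Sigma_ep M xs i) \<le> dt i"
    using Suc i by auto
  show ?case
  proof (cases "dt (Suc i) \<le> 2 * Determinant.det (alg_Sigma_ep M xs i)")
    case True
    note e = alg_step(3)[OF i x True]
    then have "?C (Suc i) = ?C i" by (auto simp: less_Suc_eq)
    then show ?thesis using e IH dt_Suc_ge[OF i] by simp
  next
    case False
    note e = alg_step(4)[OF i x False]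
    have "?C (Suc i) \<subseteq> insert i (?C i)" by (auto simp: less_Suc_eq)
    then have "card (?C (Suc i)) \<le> card (insert i (?C i))" by (rule card_mono[rotated]) simp
    also have "\<dots> = Suc (card (?C i))" by simp
    finally have "(2::real) ^ card (?C (Suc i)) * dt 0 \<le> 2 ^ Suc (card (?C i)) * dt 0"
      using dt_pos[of 0] by (intro mult_right_mono power_increasing) auto
    also have "\<dots> \<le> dt (Suc i)" using IH False by simp
    finally show ?thesis using e by simp
  qed
qed

lemma card_switch_le:
  assumes "i \<le> length xs"
  shows "real (card {j. j < i \<and> alg_Q M xs (Suc j) \<noteq> alg_Q M xs j}) \<le> 2 * ln (dt i / dt 0)"
proof -
  let ?K = "card {j. j < i \<and> alg_Q M xs (Suc j) \<noteq> alg_Q M xs j}"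
  have "2 ^ ?K \<le> dt i / dt 0"
    using episodes_le[OF assms] dt_pos[of 0] by (simp add: pos_le_divide_eq)
  then have "ln (2 ^ ?K) \<le> ln (dt i / dt 0)"
    by (intro ln_mono) (auto intro: less_le_trans[OF zero_less_power])
  then have "real ?K * ln 2 \<le> ln (dt i / dt 0)" by (simp add: ln_realpow)
  moreover have "real ?K * (1 / 2) \<le> real ?K * ln 2" by (intro mult_left_mono) (use le_two_ln_one_plus[of 1] in auto)
  ultimately show ?thesis by linarith
qed

section \<open>Confidence polytopes on the good event\<close>

context
  fixes B \<kappa> :: real
  assumes event: "\<And>j. j \<le> length xs \<Longrightarrow> wnorm (Sg j) (th j - \<theta>s) \<le> beta M (Suc j)"
    and B: "\<And>j. j \<le> length xs \<Longrightarrow> beta M (Suc j) \<le> B"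
    and \<kappa>: "0 < \<kappa>"
    and kap: "\<And>i s a s2 \<theta> k l. i < length xs \<Longrightarrow> xs ! i = (s, a, s2) \<Longrightarrow> \<theta> \<in> Theta D (Lth M) \<Longrightarrow>
      k \<in> pSsa M s a \<Longrightarrow> l \<in> pSsa M s a \<Longrightarrow>
      \<kappa> \<le> mnl (phi M) (pSsa M) \<theta> s a k * mnl (phi M) (pSsa M) \<theta> s a l"
begin

lemma beta_nonneg: "j \<le> length xs \<Longrightarrow> 0 \<le> beta M (Suc j)"
  using event[of j] wnorm_nonneg[OF pd_psd[OF pd_Sg], of j "th j - \<theta>s"] th_carrier[of j] \<theta>s_carrier by force

text \<open>The second-order expansion is applied with \<open>m = sqrt m2\<close>, where
  \<open>m2\<close> is the maximum occurring in the radius; its quadratic term has coefficient 1,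
  within the 3 that the polytope grants.\<close>

lemma pstar_in_Pset:
  assumes j: "j \<le> length xs" shows "pstar \<in> Pset M (Suc j) (th j) (Sg j)"
  unfolding Pset_def conf_set_def
proof (intro CollectI ballI conjI)
  fix s a assume sa: "s \<in> pS M" "a \<in> pA M"
  interpret mnl_model M s a by (rule model[OF sa])
  show "0 \<le> p \<theta>s k" for k by (rule mnl_nonneg)
  show "p \<theta>s k \<le> 1" for k
    using member_le_sum[of k I "p \<theta>s"] fin mnl_nonneg by (cases "k \<in> I") (auto simp: mnl_sum mnl_def[of _ _ _ _ _ k])
  show "(\<Sum>k\<in>I. p \<theta>s k) = 1" by (rule mnl_sum)
  note P = pd_Sg[OF j]
  define m2 where "m2 = Max ((\<lambda>k. (wnorm (minv (Sg j)) (\<phi> k))\<^sup>2) ` I)"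
  have m2: "(wnorm (minv (Sg j)) (\<phi> k))\<^sup>2 \<le> m2" if "k \<in> I" for k
    unfolding m2_def using fin that by (intro Max_ge) auto
  then have m20: "0 \<le> m2" using ne by (meson ex_in_conv order.trans zero_le_power2)
  have m: "wnorm (minv (Sg j)) (\<phi> k) \<le> sqrt m2" if "k \<in> I" for k
    using m2[OF that] by (rule real_le_rsqrt)
  have "wnorm (Sg j) (\<theta>s - th j) \<le> beta M (Suc j)"
    using event[OF j] wnorm_minus_commute[OF pd_psd[OF P] \<theta>s_carrier th_carrier[OF j]] by simp
  from mnl_second_order[OF P m th_carrier[OF j] \<theta>s_carrier this]
  have "(\<Sum>k\<in>I. \<bar>p \<theta>s k - p (th j) k\<bar>) \<le> beta M (Suc j) *
     (\<Sum>k\<in>I. p (th j) k * wnorm (minv (Sg j)) (\<phi> k - mean (th j))) + (beta M (Suc j))\<^sup>2 * m2"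
    using m20 by simp
  moreover have "0 \<le> (beta M (Suc j))\<^sup>2 * m2" using m20 by simp
  ultimately show "(\<Sum>k\<in>I. \<bar>p \<theta>s k - p (th j) k\<bar>) \<le> beta M (Suc j) *
     (\<Sum>k\<in>I. p (th j) k * wnorm (minv (Sg j)) (\<phi> k - mean (th j)))
     + 3 * (beta M (Suc j))\<^sup>2 * Max ((\<lambda>k. (wnorm (minv (Sg j)) (\<phi> k))\<^sup>2) ` I)"
    unfolding m2_def[symmetric] by linarith
qed

text \<open>Both \<open>q\<close> and the true kernel lie within the radius around the model of the
  episode start, so twice the radius suffices. Its width term is moved to the newest estimate and
  from \<open>Sg j\<close> to \<open>Sg i\<close>; its maximum term is bounded through
  \<kappa>.\<close>

lemma Pset_l1_diameter:
  assumes i: "i < length xs" and x: "xs ! i = (s, a, s2)" and j: "j \<le> i" and dd: "dt i \<le> 2 * dt j"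
    and q: "q \<in> Pset M (Suc j) (th j) (Sg j)"
  shows "(\<Sum>k\<in>pSsa M s a. \<bar>q s a k - pstar s a k\<bar>) \<le> 4 * B * sqrt (potential i) + 60 * B\<^sup>2 * potential i / \<kappa>"
proof -
  note v = validD[OF valid i x]
  interpret mnl_model M s a by (rule model[OF v(1,2)])
  have jn: "j \<le> length xs" and il: "i \<le> length xs" and Sil: "Suc i \<le> length xs" using i j by auto
  note P = pd_Sg[OF jn] and Pi = pd_Sg[OF il]
  let ?b = "beta M (Suc j)" and ?t = "th (Suc i)"
  have b: "0 \<le> ?b" "?b \<le> B" using beta_nonneg[OF jn] B[OF jn] by auto
  note x0 = potential_nonneg[OF i]
  define m2 where "m2 = Max ((\<lambda>k. (wnorm (minv (Sg j)) (\<phi> k))\<^sup>2) ` I)"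
  have m2: "(wnorm (minv (Sg j)) (\<phi> k))\<^sup>2 \<le> m2" if "k \<in> I" for k
    unfolding m2_def using fin that by (intro Max_ge) auto
  have m: "wnorm (minv (Sg j)) (\<phi> k) \<le> sqrt m2" if "k \<in> I" for k
    using m2[OF that] by (rule real_le_rsqrt)
  \<comment> \<open>Monotonicity of the adjugate form and the determinant test replace
    \<open>Sg j\<close> by \<open>Sg i\<close> at the price of a factor 2.\<close>
  have lazy: "(wnorm (minv (Sg j)) w)\<^sup>2 \<le> 2 * (wnorm (minv (Sg i)) w)\<^sup>2" if "w \<in> carrier_vec D" for w
  proof -
    have "dt j * (wnorm (minv (Sg j)) w)\<^sup>2 \<le> dt i * (wnorm (minv (Sg i)) w)\<^sup>2"
      by (rule det_minv_mono[OF j il that])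
    also have "\<dots> \<le> 2 * dt j * (wnorm (minv (Sg i)) w)\<^sup>2" using dd by (intro mult_right_mono) auto
    finally show ?thesis using dt_pos[OF jn] by (simp add: mult.left_commute mult.assoc)
  qed
  obtain z where z: "z \<in> I" "\<phi> z = 0\<^sub>v D" using phi_zero[OF v(1,2)] by blast
  have "m2 \<le> 2 * potential i / \<kappa>"
    unfolding m2_def
  proof (subst Max_le_iff)
    show "\<forall>y\<in>(\<lambda>k. (wnorm (minv (Sg j)) (\<phi> k))\<^sup>2) ` I. y \<le> 2 * potential i / \<kappa>"
    proof
      fix y assume "y \<in> (\<lambda>k. (wnorm (minv (Sg j)) (\<phi> k))\<^sup>2) ` I"
      then obtain k where k: "k \<in> I" and y: "y = (wnorm (minv (Sg j)) (\<phi> k))\<^sup>2" by blast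
      have "\<kappa> * (wnorm (minv (Sg i)) (\<phi> k))\<^sup>2 \<le> potential i"
        unfolding potential_def x prod.case
        by (rule kappa_le_centered_variance[OF Pi _ kap[OF i x th_Theta[OF Sil]] z k, where m = "Max (wnorm (minv (Sg i)) ` \<phi> ` I)"])
           (use fin in auto)
      then have "(wnorm (minv (Sg i)) (\<phi> k))\<^sup>2 \<le> potential i / \<kappa>"
        using \<kappa> by (simp add: pos_le_divide_eq mult.commute)
      then show "y \<le> 2 * potential i / \<kappa>" using lazy[OF phi[OF k]] unfolding y by linarith
    qed
  qed (use fin ne in auto)
  moreover have "0 \<le> m2" using ne m2 by (meson ex_in_conv order.trans zero_le_power2)
  ultimately have m2x: "m2 \<le> 2 * potential i / \<kappa>" "0 \<le> m2" by auto
  \<comment> \<open>Each estimate is close to the true parameter in the norm of its own matrix; the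
    later matrix dominates \<open>Sg j\<close>, so both distances can be measured in the
    latter.\<close>
  have dist: "wnorm (Sg j) (th j - ?t) \<le> 2 * B"
  proof -
    have "wnorm (Sg j) (th j - ?t) \<le> wnorm (Sg j) (th j - \<theta>s) + wnorm (Sg j) (\<theta>s - ?t)"
      by (rule wnorm_triangle[OF pd_psd[OF P] th_carrier[OF jn] \<theta>s_carrier th_carrier[OF Sil]])
    also have "wnorm (Sg j) (\<theta>s - ?t) = wnorm (Sg j) (?t - \<theta>s)"
      by (rule wnorm_minus_commute[OF pd_psd[OF P] \<theta>s_carrier th_carrier[OF Sil]])
    also have "\<dots> \<le> wnorm (Sg (Suc i)) (?t - \<theta>s)"
      using j th_carrier[OF Sil] \<theta>s_carrier by (intro Sg_mono Sil) auto
    finally show ?thesis using event[OF jn] event[OF Sil] B[OF jn] B[OF Sil] by linarith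
  qed
  let ?F = "\<lambda>\<theta>. \<Sum>k\<in>I. p \<theta> k * wnorm (minv (Sg j)) (\<phi> k - mean \<theta>)"
  have "?F (th j) \<le> ?F ?t + 6 * (sqrt m2)\<^sup>2 * (2 * B)"
    by (rule centered_width_lipschitz[OF P m th_carrier[OF Sil] th_carrier[OF jn] dist])
  also have "?F ?t \<le> sqrt (2 * potential i)"
  proof (rule real_le_rsqrt)
    have "(?F ?t)\<^sup>2 \<le> (\<Sum>k\<in>I. p ?t k * (wnorm (minv (Sg j)) (\<phi> k - mean ?t))\<^sup>2)" by (rule width_square_le)
    also have "\<dots> \<le> (\<Sum>k\<in>I. p ?t k * (2 * (wnorm (minv (Sg i)) (\<phi> k - mean ?t))\<^sup>2))"
      using phi by (intro sum_mono mult_left_mono lazy mnl_nonneg) auto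
    also have "\<dots> = 2 * potential i" by (simp add: potential_def x sum_distrib_left mult.left_commute)
    finally show "(?F ?t)\<^sup>2 \<le> 2 * potential i" .
  qed
  finally have F: "?F (th j) \<le> sqrt 2 * sqrt (potential i) + 12 * B * m2"
    using m2x by (simp add: real_sqrt_mult mult_ac)
  have s2: "sqrt 2 \<le> (2::real)" by (rule real_le_lsqrt) auto
  define rad where "rad = ?b * ?F (th j) + 3 * ?b\<^sup>2 * m2"
  have F0: "0 \<le> ?F (th j)"
    using phi by (intro sum_nonneg mult_nonneg_nonneg mnl_nonneg wnorm_nonneg[OF psd_minv[OF P]]) auto
  have "rad \<le> B * (2 * sqrt (potential i) + 12 * B * m2) + 3 * B\<^sup>2 * m2"
    unfolding rad_def
  proof (intro add_mono mult_mono power_mono)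
    have "sqrt 2 * sqrt (potential i) \<le> 2 * sqrt (potential i)" using s2 x0 by (intro mult_right_mono) auto
    then show "?F (th j) \<le> 2 * sqrt (potential i) + 12 * B * m2" using F by linarith
  qed (use b m2x F0 in auto)
  \<comment> \<open>The 15 is 12 from the change of centre plus 3 from the polytope. The bound on
    \<open>m2\<close> doubles it to 30, and the triangle inequality at the end to 60.\<close>
  also have "\<dots> = 2 * B * sqrt (potential i) + 15 * B\<^sup>2 * m2" by (simp add: power2_eq_square algebra_simps)
  also have "\<dots> \<le> 2 * B * sqrt (potential i) + 15 * B\<^sup>2 * (2 * potential i / \<kappa>)"
    using m2x by (intro add_left_mono mult_left_mono) auto
  finally have rad: "rad \<le> 2 * B * sqrt (potential i) + 30 * B\<^sup>2 * potential i / \<kappa>" by (simp add: mult_ac)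
  have in_rad: "(\<Sum>k\<in>I. \<bar>q s a k - p (th j) k\<bar>) \<le> rad" if "q \<in> Pset M (Suc j) (th j) (Sg j)" for q
    using that v(1,2) unfolding Pset_def conf_set_def rad_def m2_def by blast
  have "(\<Sum>k\<in>I. \<bar>q s a k - pstar s a k\<bar>) \<le> (\<Sum>k\<in>I. \<bar>q s a k - p (th j) k\<bar> + \<bar>p \<theta>s k - p (th j) k\<bar>)"
    by (intro sum_mono) linarith
  also have "\<dots> \<le> rad + rad"
    unfolding sum.distrib by (rule add_mono[OF in_rad[OF q] in_rad[OF pstar_in_Pset[OF jn]]])
  finally show ?thesis using rad by simp
qed

end
end
end
end

section \<open>Values and optimism\<close>

lemma expectation_bounds:
  fixes f :: "'a \<Rightarrow> real"
  assumes "finite (set_pmf p)" "\<And>x. x \<in> set_pmf p \<Longrightarrow> l \<le> f x \<and> f x \<le> u"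
  shows "l \<le> measure_pmf.expectation p f" "measure_pmf.expectation p f \<le> u"
  using assms
  by (auto intro!: measure_pmf.integral_ge_const measure_pmf.integral_le_const
      integrable_measure_pmf_finite simp: AE_measure_pmf_iff)

text \<open>Associativity of \<open>bind_pmf\<close> moves the first step to the front, as the
  Bellman equation requires; the definition of \<open>run_pmf\<close> splits off the last
  one.\<close>

lemma run_pmf_Suc_left:
  "run_pmf P \<pi> h (Suc n) = bind_pmf (step_pmf P \<pi> h) (\<lambda>h'. run_pmf P \<pi> h' n)"
proof (induction n)
  case 0
  show ?case by (simp add: bind_return_pmf bind_return_pmf')
next
  case (Suc n)
  have "run_pmf P \<pi> h (Suc (Suc n)) = bind_pmf (run_pmf P \<pi> h (Suc n)) (step_pmf P \<pi>)" by simp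
  also have "\<dots> = bind_pmf (step_pmf P \<pi> h) (\<lambda>h'. run_pmf P \<pi> h' (Suc n))"
    unfolding Suc.IH by (simp add: bind_assoc_pmf)
  finally show ?case .
qed

context mnl_mdp
begin

abbreviation "P \<equiv> trans_pmf (phi M) (pSsa M) \<theta>s"
abbreviation "\<gamma> \<equiv> disc M"
definition "c = 1 / (1 - disc M)"

lemma c_pos: "0 < c" and c_eq: "1 + disc M * c = c"
  using disc by (simp_all add: c_def field_simps)

lemma c_ge1: "1 \<le> c" using disc by (simp add: c_def field_simps)

context
  fixes s a assumes sa: "s \<in> pS M" "a \<in> pA M"
begin

interpretation mnl_model M s a by (rule model[OF sa])

lemma pmf_P: "pmf (P s a) k = pstar s a k"
proof -
  have "(\<integral>\<^sup>+ k. ennreal (p \<theta>s k) \<partial>count_space UNIV) = (\<Sum>k\<in>I. ennreal (p \<theta>s k))"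
    using fin by (intro nn_integral_count_space') (auto simp: mnl_def)
  also have "\<dots> = 1" by (simp add: sum_ennreal mnl_nonneg mnl_sum)
  finally show ?thesis unfolding trans_pmf_def by (intro pmf_embed_pmf mnl_nonneg)
qed

lemma set_P: "set_pmf (P s a) = pSsa M s a"
proof (rule Set.set_eqI)
  show "k \<in> set_pmf (P s a) \<longleftrightarrow> k \<in> I" for k
    using mnl_pos[of k \<theta>s] by (cases "k \<in> I") (simp_all add: set_pmf_iff pmf_P, simp add: mnl_def)
qed

lemma expectation_P: "measure_pmf.expectation (P s a) f = (\<Sum>k\<in>pSsa M s a. pstar s a k * (f k :: real))"
  using fin by (subst integral_measure_pmf_real[of I]) (auto simp: set_P pmf_P mult.commute)

end

context
  fixes \<pi> assumes \<pi>: "\<pi> \<in> policies (pA M)"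
begin

lemma set_policy: "set_pmf (\<pi> h) \<subseteq> pA M" using \<pi> unfolding policies_def by blast

lemma finite_policy: "finite (set_pmf (\<pi> h))" using set_policy finA finite_subset by blast

lemma set_step:
  assumes "snd h \<in> pS M"
  shows "set_pmf (step_pmf P \<pi> h) = {(fst h @ [(snd h, a)], k) | a k. a \<in> set_pmf (\<pi> h) \<and> k \<in> pSsa M (snd h) a}"
proof -
  have "set_pmf (step_pmf P \<pi> h) = (\<Union>a\<in>set_pmf (\<pi> h). (\<lambda>k. (fst h @ [(snd h, a)], k)) ` set_pmf (P (snd h) a))"
    by (simp add: step_pmf_def)
  also have "\<dots> = (\<Union>a\<in>set_pmf (\<pi> h). (\<lambda>k. (fst h @ [(snd h, a)], k)) ` pSsa M (snd h) a)"
    using set_policy[of h] by (intro SUP_cong refl) (metis assms set_P subsetD)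
  finally show ?thesis by blast
qed

lemma finite_step:
  assumes "snd h \<in> pS M" shows "finite (set_pmf (step_pmf P \<pi> h))"
proof -
  have "set_pmf (step_pmf P \<pi> h) \<subseteq> (\<lambda>(a, k). (fst h @ [(snd h, a)], k)) ` (pA M \<times> pS M)"
    using set_policy[of h] Ssa[OF assms] by (fastforce simp: set_step[OF assms])
  then show ?thesis by (rule finite_subset) (simp add: finA finS)
qed

lemma step_state: "snd h \<in> pS M \<Longrightarrow> h' \<in> set_pmf (step_pmf P \<pi> h) \<Longrightarrow> snd h' \<in> pS M"
  using set_policy[of h] Ssa[of "snd h"] by (fastforce simp: set_step)

lemma run_state:
  assumes "snd h \<in> pS M"
  shows "finite (set_pmf (run_pmf P \<pi> h n)) \<and> (\<forall>h'\<in>set_pmf (run_pmf P \<pi> h n). snd h' \<in> pS M)"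
proof (induction n)
  case (Suc n)
  then show ?case using finite_step step_state by auto
qed (use assms in simp)

lemma expectation_step:
  assumes h: "snd h \<in> pS M"
  shows "measure_pmf.expectation (step_pmf P \<pi> h) f =
    (\<Sum>a\<in>pA M. pmf (\<pi> h) a * (\<Sum>k\<in>pSsa M (snd h) a. pstar (snd h) a k * (f (fst h @ [(snd h, a)], k) :: real)))"
  unfolding step_pmf_def
  using set_policy finA Ssa[OF h] finite_subset[OF _ finS]
  by (subst pmf_expectation_bind[OF finA]) (auto simp: expectation_P[OF h] set_P[OF h] intro!: sum.cong)

definition R :: "hist \<Rightarrow> real" where "R h = measure_pmf.expectation (\<pi> h) (\<lambda>a. rew M (snd h) a)"

lemma R_bounds: "snd h \<in> pS M \<Longrightarrow> 0 \<le> R h \<and> R h \<le> 1"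
  unfolding R_def using expectation_bounds[OF finite_policy, of h 0 "rew M (snd h)" 1] rew set_policy by blast

definition er :: "hist \<Rightarrow> nat \<Rightarrow> real" where "er h i = measure_pmf.expectation (run_pmf P \<pi> h i) R"

lemma er_bounds: "snd h \<in> pS M \<Longrightarrow> 0 \<le> er h i \<and> er h i \<le> 1"
  unfolding er_def using expectation_bounds[of "run_pmf P \<pi> h i" 0 R 1] run_state[of h i] R_bounds by blast

lemma Vpi_eq: "Vpi \<gamma> (rew M) P \<pi> h = (\<Sum>i. \<gamma> ^ i * er h i)"
  unfolding Vpi_def er_def R_def ..

lemma summable_er: "snd h \<in> pS M \<Longrightarrow> summable (\<lambda>i. \<gamma> ^ i * er h i)"
  by (rule summable_comparison_test[OF _ summable_geometric[of \<gamma>]])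
     (use er_bounds[of h] disc in \<open>auto intro!: exI[of _ 0] mult_left_le simp: abs_mult\<close>)

lemma Vpi_bounds:
  assumes h: "snd h \<in> pS M"
  shows "0 \<le> Vpi \<gamma> (rew M) P \<pi> h" "Vpi \<gamma> (rew M) P \<pi> h \<le> c"
proof -
  show "0 \<le> Vpi \<gamma> (rew M) P \<pi> h"
    unfolding Vpi_eq using er_bounds[OF h] disc by (intro suminf_nonneg summable_er[OF h]) auto
  have "Vpi \<gamma> (rew M) P \<pi> h \<le> (\<Sum>i. \<gamma> ^ i)"
    unfolding Vpi_eq using er_bounds[OF h] disc
    by (intro suminf_le summable_er[OF h] summable_geometric) (auto intro!: mult_left_le)
  then show "Vpi \<gamma> (rew M) P \<pi> h \<le> c" using disc by (simp add: suminf_geometric c_def)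
qed

text \<open>Rewards from the second step on are averages over the successors of the first; as these
  are finitely many, the average commutes with the discounted series. Values live on histories
  because the policy depends on them.\<close>

lemma Vpi_bellman:
  assumes h: "snd h \<in> pS M"
  shows "Vpi \<gamma> (rew M) P \<pi> h = R h + \<gamma> * measure_pmf.expectation (step_pmf P \<pi> h) (Vpi \<gamma> (rew M) P \<pi>)"
proof -
  let ?S = "set_pmf (step_pmf P \<pi> h)"
  have fin: "finite ?S" by (rule finite_step[OF h])
  have E: "measure_pmf.expectation (step_pmf P \<pi> h) f = (\<Sum>h'\<in>?S. pmf (step_pmf P \<pi> h) h' * f h')" for f :: "hist \<Rightarrow> real"
    using fin by (subst integral_measure_pmf_real[of ?S]) (auto simp: mult.commute)
  have er_Suc: "er h (Suc i) = (\<Sum>h'\<in>?S. pmf (step_pmf P \<pi> h) h' * er h' i)" for i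
    unfolding er_def run_pmf_Suc_left
    using run_state step_state[OF h] by (subst pmf_expectation_bind[OF fin]) auto
  have sm: "summable (\<lambda>i. \<gamma> ^ i * er h' i)" if "h' \<in> ?S" for h'
    using summable_er step_state[OF h that] by blast
  have "Vpi \<gamma> (rew M) P \<pi> h = er h 0 + (\<Sum>i. \<gamma> ^ Suc i * er h (Suc i))"
    unfolding Vpi_eq using suminf_split_head[OF summable_er[OF h]] by simp
  also have "er h 0 = R h" by (simp add: er_def)
  also have "(\<lambda>i. \<gamma> ^ Suc i * er h (Suc i)) = (\<lambda>i. \<Sum>h'\<in>?S. \<gamma> * pmf (step_pmf P \<pi> h) h' * (\<gamma> ^ i * er h' i))"
    unfolding er_Suc by (simp add: sum_distrib_left mult_ac)
  also have "(\<Sum>i. \<Sum>h'\<in>?S. \<gamma> * pmf (step_pmf P \<pi> h) h' * (\<gamma> ^ i * er h' i)) =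
      (\<Sum>h'\<in>?S. \<Sum>i. \<gamma> * pmf (step_pmf P \<pi> h) h' * (\<gamma> ^ i * er h' i))"
    by (rule suminf_sum) (intro summable_mult sm)
  also have "\<dots> = (\<Sum>h'\<in>?S. \<gamma> * pmf (step_pmf P \<pi> h) h' * Vpi \<gamma> (rew M) P \<pi> h')"
    unfolding Vpi_eq by (intro sum.cong refl suminf_mult sm)
  finally show ?thesis by (simp add: E sum_distrib_left mult_ac)
qed

end

section \<open>Extended value iteration over a set of plausible kernels\<close>

lemma mixture_le:
  assumes "s \<in> pS M" "a \<in> pA M" "\<And>k. k \<in> pSsa M s a \<Longrightarrow> 0 \<le> q k" "(\<Sum>k\<in>pSsa M s a. q k) = 1"
    and "\<And>k. k \<in> pS M \<Longrightarrow> V k \<le> (u :: real)"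
  shows "(\<Sum>k\<in>pSsa M s a. q k * V k) \<le> u"
proof -
  have "(\<Sum>k\<in>pSsa M s a. q k * V k) \<le> (\<Sum>k\<in>pSsa M s a. q k * u)"
    using assms Ssa[OF assms(1,2)] by (intro sum_mono mult_left_mono) auto
  also have "\<dots> = u" using assms(4) by (simp flip: sum_distrib_right)
  finally show ?thesis .
qed

text \<open>What value iteration relies on: the true kernel is a candidate, which gives optimism,
  and all candidates are distributions on the reachable sets, which keeps the suprema
  bounded.\<close>

definition plausible :: "(nat \<Rightarrow> nat \<Rightarrow> nat \<Rightarrow> real) set \<Rightarrow> bool" where
  "plausible Q \<longleftrightarrow> pstar \<in> Q \<and> (\<forall>q\<in>Q. \<forall>s\<in>pS M. \<forall>a\<in>pA M.
     (\<forall>k\<in>pSsa M s a. 0 \<le> q s a k) \<and> (\<Sum>k\<in>pSsa M s a. q s a k) = 1)"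

definition dV :: "(nat \<Rightarrow> nat \<Rightarrow> nat \<Rightarrow> real) set \<Rightarrow> nat \<Rightarrow> nat \<Rightarrow> real" where
  "dV Q n s = Max ((\<lambda>a. devi M Q n s a) ` pA M)"

lemma dV_ge: "a \<in> pA M \<Longrightarrow> devi M Q n s a \<le> dV Q n s"
  unfolding dV_def using finA by (intro Max_ge) auto

lemma dV_le: "(\<And>a. a \<in> pA M \<Longrightarrow> devi M Q n s a \<le> u) \<Longrightarrow> dV Q n s \<le> u"
  unfolding dV_def using finA A_ne by (subst Max_le_iff) auto

lemma devi_Suc: "devi M Q (Suc n) s a = rew M s a + \<gamma> * (SUP q\<in>Q. \<Sum>k\<in>pSsa M s a. q s a k * dV Q n k)"
  by (simp add: dV_def)

context
  fixes Q assumes Q: "plausible Q"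
begin

lemma Q_ne: "Q \<noteq> {}" using Q by (auto simp: plausible_def)

lemma sup_le:
  assumes "s \<in> pS M" "a \<in> pA M" "\<And>k. k \<in> pS M \<Longrightarrow> V k \<le> u"
  shows "(SUP q\<in>Q. \<Sum>k\<in>pSsa M s a. q s a k * V k) \<le> (u :: real)"
  using Q assms by (intro cSUP_least[OF Q_ne] mixture_le) (auto simp: plausible_def)

lemma le_sup:
  assumes "s \<in> pS M" "a \<in> pA M" "\<And>k. k \<in> pS M \<Longrightarrow> V k \<le> (u :: real)" "q \<in> Q"
  shows "(\<Sum>k\<in>pSsa M s a. q s a k * V k) \<le> (SUP q\<in>Q. \<Sum>k\<in>pSsa M s a. q s a k * V k)"
proof (rule cSUP_upper[OF assms(4)], rule bdd_aboveI2[where M = u])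
  fix q assume "q \<in> Q"
  then show "(\<Sum>k\<in>pSsa M s a. q s a k * V k) \<le> u"
    using Q assms by (intro mixture_le) (auto simp: plausible_def)
qed

lemma dV_upper: "s \<in> pS M \<Longrightarrow> dV Q n s \<le> c"
proof (induction n arbitrary: s)
  case 0
  then show ?case by (intro dV_le) (simp add: c_def)
next
  case (Suc n)
  show ?case
  proof (rule dV_le)
    fix a assume a: "a \<in> pA M"
    have "(SUP q\<in>Q. \<Sum>k\<in>pSsa M s a. q s a k * dV Q n k) \<le> c" by (rule sup_le[OF Suc.prems a Suc.IH])
    then have "\<gamma> * (SUP q\<in>Q. \<Sum>k\<in>pSsa M s a. q s a k * dV Q n k) \<le> \<gamma> * c"
      using disc by (intro mult_left_mono) auto
    then show "devi M Q (Suc n) s a \<le> c"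
      unfolding devi_Suc using rew[OF Suc.prems a] c_eq by linarith
  qed
qed

text \<open>Induction on the iterations with an arbitrary history. A Bellman step of any
  history-dependent policy averages over actions, and each action's value is at most its optimistic
  backup since the true kernel competes in the supremum. The start value is the largest possible
  return.\<close>

lemma optimism:
  assumes \<pi>: "\<pi> \<in> policies (pA M)"
  shows "snd h \<in> pS M \<Longrightarrow> Vpi \<gamma> (rew M) P \<pi> h \<le> dV Q n (snd h)"
proof (induction n arbitrary: h)
  case 0
  obtain a where "a \<in> pA M" using A_ne by blast
  then show ?case using Vpi_bounds(2)[OF \<pi> 0] dV_ge[of a Q 0 "snd h"] by (simp add: c_def)
next
  case (Suc n)
  let ?s = "snd h"
  note set\<pi> = set_policy[OF \<pi>, of h]
  have R: "R \<pi> h = (\<Sum>a\<in>pA M. pmf (\<pi> h) a * rew M ?s a)"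
    unfolding R_def[OF \<pi>] using set\<pi> finA by (subst integral_measure_pmf_real[of "pA M"]) (auto simp: mult.commute)
  have "Vpi \<gamma> (rew M) P \<pi> h = (\<Sum>a\<in>pA M. pmf (\<pi> h) a *
      (rew M ?s a + \<gamma> * (\<Sum>k\<in>pSsa M ?s a. pstar ?s a k * Vpi \<gamma> (rew M) P \<pi> (fst h @ [(?s, a)], k))))"
    unfolding Vpi_bellman[OF \<pi> Suc.prems] R expectation_step[OF \<pi> Suc.prems]
    by (simp add: sum_distrib_left distrib_left sum.distrib mult_ac)
  also have "\<dots> \<le> (\<Sum>a\<in>pA M. pmf (\<pi> h) a * dV Q (Suc n) ?s)"
  proof (intro sum_mono mult_left_mono pmf_nonneg)
    fix a assume a: "a \<in> pA M"
    interpret mnl_model M ?s a by (rule model[OF Suc.prems a])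
    have "(\<Sum>k\<in>I. pstar ?s a k * Vpi \<gamma> (rew M) P \<pi> (fst h @ [(?s, a)], k)) \<le> (\<Sum>k\<in>I. pstar ?s a k * dV Q n k)"
      using Suc.IH[of "(fst h @ [(?s, a)], k)" for k] Ssa[OF Suc.prems a]
      by (intro sum_mono mult_left_mono mnl_nonneg) auto
    also have "\<dots> \<le> (SUP q\<in>Q. \<Sum>k\<in>I. q ?s a k * dV Q n k)"
      using Q by (intro le_sup[OF Suc.prems a dV_upper]) (auto simp: plausible_def)
    finally have "rew M ?s a + \<gamma> * (\<Sum>k\<in>I. pstar ?s a k * Vpi \<gamma> (rew M) P \<pi> (fst h @ [(?s, a)], k)) \<le> devi M Q (Suc n) ?s a"
      unfolding devi_Suc using disc by (intro add_left_mono mult_left_mono) auto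
    also have "\<dots> \<le> dV Q (Suc n) ?s" by (rule dV_ge[OF a])
    finally show "rew M ?s a + \<gamma> * (\<Sum>k\<in>I. pstar ?s a k * Vpi \<gamma> (rew M) P \<pi> (fst h @ [(?s, a)], k)) \<le> dV Q (Suc n) ?s" .
  qed
  also have "\<dots> = dV Q (Suc n) ?s"
    using sum_pmf_eq_1[OF finA set\<pi>] by (simp flip: sum_distrib_right)
  finally show ?case .
qed

lemma dV_nonneg: "s \<in> pS M \<Longrightarrow> 0 \<le> dV Q n s"
proof -
  assume s: "s \<in> pS M"
  obtain a where "a \<in> pA M" using A_ne by blast
  then have \<pi>: "(\<lambda>_. return_pmf a) \<in> policies (pA M)" by (simp add: policies_def)
  show ?thesis using optimism[OF \<pi>, of "([], s)" n] Vpi_bounds(1)[OF \<pi>, of "([], s)"] s by simp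
qed

lemma Vstar_le: "s \<in> pS M \<Longrightarrow> Vstar \<gamma> (rew M) P (pA M) s \<le> dV Q n s"
proof -
  assume s: "s \<in> pS M"
  obtain a where "a \<in> pA M" using A_ne by blast
  then have "(\<lambda>_. return_pmf a) \<in> policies (pA M)" by (simp add: policies_def)
  then show ?thesis unfolding Vstar_def using optimism[of _ "([], s)" n] s by (intro cSUP_least) auto
qed

text \<open>Since \<open>c = 1 + \<gamma> * c\<close> and rewards are nonnegative, the first backup
  lowers the start value by at most 1; monotonicity of the backup and the factor \<gamma> on
  constant shifts propagate this gap.\<close>

lemma dV_almost_fixed:
  assumes "s \<in> pS M" "a \<in> pA M"
  shows "devi M Q n s a \<le> devi M Q (Suc n) s a + \<gamma> ^ n"
  using assms
proof (induction n arbitrary: s a)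
  case 0
  interpret mnl_model M s a by (rule model[OF 0])
  obtain b where b: "b \<in> pA M" using A_ne by blast
  have c: "dV Q 0 k = c" for k
    by (rule antisym) (use dV_le[of Q 0 k c] dV_ge[OF b, of Q 0 k] in \<open>simp_all add: c_def\<close>)
  have "(\<Sum>k\<in>I. pstar s a k * dV Q 0 k) \<le> (SUP q\<in>Q. \<Sum>k\<in>I. q s a k * dV Q 0 k)"
    using Q by (intro le_sup[OF 0, where u = c]) (auto simp: plausible_def c)
  then have "c \<le> (SUP q\<in>Q. \<Sum>k\<in>I. q s a k * dV Q 0 k)"
    by (simp add: c mnl_sum flip: sum_distrib_right)
  then have "\<gamma> * c \<le> \<gamma> * (SUP q\<in>Q. \<Sum>k\<in>I. q s a k * dV Q 0 k)" using disc by (intro mult_left_mono) auto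
  then have "c \<le> rew M s a + \<gamma> * (SUP q\<in>Q. \<Sum>k\<in>I. q s a k * dV Q 0 k) + 1"
    using rew[OF 0] c_eq by linarith
  then show ?case unfolding devi_Suc by (simp add: c_def)
next
  case (Suc n)
  have dle: "dV Q n k \<le> dV Q (Suc n) k + \<gamma> ^ n" if "k \<in> pS M" for k
  proof (rule dV_le)
    fix b assume b: "b \<in> pA M"
    show "devi M Q n k b \<le> dV Q (Suc n) k + \<gamma> ^ n" using Suc.IH[OF that b] dV_ge[OF b, of Q "Suc n" k] by linarith
  qed
  have "(SUP q\<in>Q. \<Sum>k\<in>pSsa M s a. q s a k * dV Q n k) \<le> (SUP q\<in>Q. \<Sum>k\<in>pSsa M s a. q s a k * dV Q (Suc n) k) + \<gamma> ^ n"
  proof (rule cSUP_least[OF Q_ne])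
    fix q assume q: "q \<in> Q"
    then have q0: "\<And>k. k \<in> pSsa M s a \<Longrightarrow> 0 \<le> q s a k" and q1: "(\<Sum>k\<in>pSsa M s a. q s a k) = 1"
      using Q Suc.prems by (auto simp: plausible_def)
    have "(\<Sum>k\<in>pSsa M s a. q s a k * dV Q n k) \<le> (\<Sum>k\<in>pSsa M s a. q s a k * (dV Q (Suc n) k + \<gamma> ^ n))"
      using q0 dle Ssa[OF Suc.prems] by (intro sum_mono mult_left_mono) auto
    also have "\<dots> = (\<Sum>k\<in>pSsa M s a. q s a k * dV Q (Suc n) k) + \<gamma> ^ n"
      using q1 by (simp add: distrib_left sum.distrib flip: sum_distrib_right)
    also have "(\<Sum>k\<in>pSsa M s a. q s a k * dV Q (Suc n) k) \<le> (SUP q\<in>Q. \<Sum>k\<in>pSsa M s a. q s a k * dV Q (Suc n) k)"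
      by (rule le_sup[OF Suc.prems dV_upper q])
    finally show "(\<Sum>k\<in>pSsa M s a. q s a k * dV Q n k) \<le> (SUP q\<in>Q. \<Sum>k\<in>pSsa M s a. q s a k * dV Q (Suc n) k) + \<gamma> ^ n"
      by simp
  qed
  then have "\<gamma> * (SUP q\<in>Q. \<Sum>k\<in>pSsa M s a. q s a k * dV Q n k) \<le> \<gamma> * ((SUP q\<in>Q. \<Sum>k\<in>pSsa M s a. q s a k * dV Q (Suc n) k) + \<gamma> ^ n)"
    using disc by (intro mult_left_mono) auto
  then show ?case unfolding devi_Suc[of Q n] devi_Suc[of Q "Suc n"] by (simp add: distrib_left)
qed

text \<open>Replacing a plausible kernel by the true one costs at most \<open>c * \<rho>\<close>,
  because the values lie in \<open>[0, c]\<close>. The term \<open>\<gamma> ^ n\<close> pays for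
  stopping the iteration before its fixed point.\<close>

lemma devi_step_error:
  assumes s: "s \<in> pS M" and a: "a \<in> pA M"
    and \<rho>: "\<And>q. q \<in> Q \<Longrightarrow> (\<Sum>k\<in>pSsa M s a. \<bar>q s a k - pstar s a k\<bar>) \<le> \<rho>"
  shows "devi M Q n s a \<le> rew M s a + \<gamma> * (\<Sum>k\<in>pSsa M s a. pstar s a k * dV Q n k) + \<gamma> * (c * \<rho>) + \<gamma> ^ n"
proof -
  have "(SUP q\<in>Q. \<Sum>k\<in>pSsa M s a. q s a k * dV Q n k) \<le> (\<Sum>k\<in>pSsa M s a. pstar s a k * dV Q n k) + c * \<rho>"
  proof (rule cSUP_least[OF Q_ne])
    fix q assume q: "q \<in> Q"
    have "(\<Sum>k\<in>pSsa M s a. q s a k * dV Q n k) - (\<Sum>k\<in>pSsa M s a. pstar s a k * dV Q n k)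
      = (\<Sum>k\<in>pSsa M s a. (q s a k - pstar s a k) * dV Q n k)"
      by (simp add: left_diff_distrib sum_subtractf)
    also have "\<dots> \<le> (\<Sum>k\<in>pSsa M s a. \<bar>q s a k - pstar s a k\<bar> * c)"
    proof (rule sum_mono)
      fix k assume "k \<in> pSsa M s a"
      then have k: "k \<in> pS M" using Ssa[OF s a] by blast
      have "(q s a k - pstar s a k) * dV Q n k \<le> \<bar>q s a k - pstar s a k\<bar> * dV Q n k"
        using dV_nonneg[OF k] by (intro mult_right_mono) auto
      also have "\<dots> \<le> \<bar>q s a k - pstar s a k\<bar> * c" using dV_upper[OF k] by (intro mult_left_mono) auto
      finally show "(q s a k - pstar s a k) * dV Q n k \<le> \<bar>q s a k - pstar s a k\<bar> * c" .
    qed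
    also have "\<dots> \<le> \<rho> * c" using \<rho>[OF q] c_pos by (simp flip: sum_distrib_right)
    finally show "(\<Sum>k\<in>pSsa M s a. q s a k * dV Q n k) \<le> (\<Sum>k\<in>pSsa M s a. pstar s a k * dV Q n k) + c * \<rho>"
      by (simp add: mult.commute)
  qed
  then have "\<gamma> * (SUP q\<in>Q. \<Sum>k\<in>pSsa M s a. q s a k * dV Q n k)
    \<le> \<gamma> * ((\<Sum>k\<in>pSsa M s a. pstar s a k * dV Q n k) + c * \<rho>)"
    using disc by (intro mult_left_mono) auto
  then show ?thesis using dV_almost_fixed[OF s a, of n] unfolding devi_Suc by (simp add: distrib_left)
qed

end
end

section \<open>Concentration along trajectories\<close>

lemma run_pmf_length:
  assumes "h \<in> set_pmf (run_pmf P \<pi> ([], s1) n)" shows "length (fst h) = n"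
  using assms by (induction n arbitrary: h) (auto simp: step_pmf_def)

lemma hprefix_self: "length (fst h) = n \<Longrightarrow> hprefix h n = h"
  by (simp add: hprefix_def)

lemma hprefix_step:
  assumes "h' \<in> set_pmf (step_pmf P \<pi> h)" "i \<le> length (fst h)"
  shows "hprefix h' i = hprefix h i"
  using assms by (auto simp: step_pmf_def hprefix_def nth_append)

definition path_sum :: "(hist \<Rightarrow> hist \<Rightarrow> real) \<Rightarrow> nat \<Rightarrow> hist \<Rightarrow> real" where
  "path_sum D n h = (\<Sum>i<n. D (hprefix h i) (hprefix h (Suc i)))"

text \<open>Differences are functions of two consecutive histories, so conditioning on the past is
  integration against \<open>step_pmf\<close>.\<close>

locale bounded_martingale_differences =
  fixes P :: "nat \<Rightarrow> nat \<Rightarrow> nat pmf" and \<pi> :: "hist \<Rightarrow> nat pmf" and s1 :: nat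
    and D :: "hist \<Rightarrow> hist \<Rightarrow> real" and b :: real
  assumes b: "0 < b"
    and mean_zero: "\<And>n h. h \<in> set_pmf (run_pmf P \<pi> ([], s1) n) \<Longrightarrow>
      measure_pmf.expectation (step_pmf P \<pi> h) (D h) = 0"
    and bounded: "\<And>n h h'. h \<in> set_pmf (run_pmf P \<pi> ([], s1) n) \<Longrightarrow>
      h' \<in> set_pmf (step_pmf P \<pi> h) \<Longrightarrow> \<bar>D h h'\<bar> \<le> b"
begin

lemma path_sum_step:
  assumes "h \<in> set_pmf (run_pmf P \<pi> ([], s1) n)" "h' \<in> set_pmf (step_pmf P \<pi> h)"
  shows "path_sum D (Suc n) h' = path_sum D n h + D h h'"
proof -
  have l: "length (fst h) = n" by (rule run_pmf_length[OF assms(1)])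
  have "length (fst h') = Suc n" using assms(2) l by (auto simp: step_pmf_def)
  then show ?thesis
    using hprefix_step[OF assms(2)] l by (simp add: path_sum_def hprefix_self)
qed

text \<open>Given the past, Hoeffding's lemma on \<open>[-b, b]\<close> bounds the newest factor by
  the exponential of \<open>l^2 * (2 * b)^2 / 8\<close>; the recursion of \<open>run_pmf\<close>
  supplies the tower property.\<close>

lemma exp_moment:
  assumes l: "0 < l"
  shows "(\<integral>\<^sup>+ h. ennreal (exp (l * path_sum D n h)) \<partial>measure_pmf (run_pmf P \<pi> ([], s1) n))
    \<le> ennreal (exp (real n * (l\<^sup>2 * b\<^sup>2 / 2)))"
proof (induction n)
  case 0
  show ?case by (simp add: path_sum_def)
next
  case (Suc n)
  let ?r = "run_pmf P \<pi> ([], s1) n" and ?q = "exp (l\<^sup>2 * b\<^sup>2 / 2)"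
  have "(\<integral>\<^sup>+ h'. ennreal (exp (l * path_sum D (Suc n) h')) \<partial>measure_pmf (run_pmf P \<pi> ([], s1) (Suc n)))
    = (\<integral>\<^sup>+ h. \<integral>\<^sup>+ h'. ennreal (exp (l * path_sum D (Suc n) h')) \<partial>measure_pmf (step_pmf P \<pi> h) \<partial>measure_pmf ?r)"
    by simp
  also have "\<dots> \<le> (\<integral>\<^sup>+ h. ennreal (exp (l * path_sum D n h)) * ennreal ?q \<partial>measure_pmf ?r)"
  proof (rule nn_integral_mono_AE, unfold AE_measure_pmf_iff, rule ballI)
    fix h assume h: "h \<in> set_pmf ?r"
    interpret interval_bounded_random_variable "measure_pmf (step_pmf P \<pi> h)" "D h" "-b" b
      by unfold_locales (use bounded[OF h] in \<open>auto simp: AE_measure_pmf_iff abs_le_iff minus_le_iff\<close>)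
    have "(\<integral>\<^sup>+ h'. ennreal (exp (l * path_sum D (Suc n) h')) \<partial>measure_pmf (step_pmf P \<pi> h))
      = (\<integral>\<^sup>+ h'. ennreal (exp (l * path_sum D n h)) * ennreal (exp (l * D h h')) \<partial>measure_pmf (step_pmf P \<pi> h))"
      using path_sum_step[OF h]
      by (intro nn_integral_cong_AE) (auto simp: AE_measure_pmf_iff distrib_left exp_add ennreal_mult)
    also have "\<dots> = ennreal (exp (l * path_sum D n h)) * (\<integral>\<^sup>+ h'. ennreal (exp (l * D h h')) \<partial>measure_pmf (step_pmf P \<pi> h))"
      by (rule nn_integral_cmult) simp
    also have "\<dots> \<le> ennreal (exp (l * path_sum D n h)) * ennreal ?q"
      using Hoeffdings_lemma_nn_integral_0[OF l mean_zero[OF h]]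
      by (intro mult_left_mono) (simp_all add: power2_eq_square field_simps)
    finally show "(\<integral>\<^sup>+ h'. ennreal (exp (l * path_sum D (Suc n) h')) \<partial>measure_pmf (step_pmf P \<pi> h))
      \<le> ennreal (exp (l * path_sum D n h)) * ennreal ?q" .
  qed
  also have "\<dots> = (\<integral>\<^sup>+ h. ennreal (exp (l * path_sum D n h)) \<partial>measure_pmf ?r) * ennreal ?q"
    by (rule nn_integral_multc) simp
  also have "\<dots> \<le> ennreal (exp (real n * (l\<^sup>2 * b\<^sup>2 / 2))) * ennreal ?q"
    by (rule mult_right_mono[OF Suc.IH]) simp
  also have "\<dots> = ennreal (exp (real (Suc n) * (l\<^sup>2 * b\<^sup>2 / 2)))"
    by (simp add: ennreal_mult[symmetric] exp_add[symmetric] algebra_simps)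
  finally show ?case .
qed

theorem azuma:
  assumes \<delta>: "0 < \<delta>" "\<delta> < 1"
  shows "measure_pmf.prob (run_pmf P \<pi> ([], s1) n) {h. b * sqrt (2 * real n * ln (1 / \<delta>)) < path_sum D n h} \<le> \<delta>"
proof (cases "n = 0")
  case True
  then show ?thesis using \<delta> by (simp add: path_sum_def)
next
  case False
  define L where "L = ln (1 / \<delta>)"
  have L: "0 < L" using \<delta> by (simp add: L_def)
  define \<epsilon> where "\<epsilon> = b * sqrt (2 * real n * L)"
  \<comment> \<open>The optimal Chernoff parameter: \<open>l * \<epsilon>\<close> is
    \<open>2 * L\<close> while the moment bound contributes \<open>L\<close>, which leaves
    \<open>exp (- L) = \<delta>\<close>.\<close>
  define l where "l = sqrt (2 * L / real n) / b"
  have l: "0 < l" using L False b by (simp add: l_def)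
  have l2: "real n * (l\<^sup>2 * b\<^sup>2 / 2) = L" using False b L by (simp add: l_def power_divide)
  have "l * \<epsilon> = sqrt (2 * L / real n) * sqrt (2 * real n * L)" using b by (simp add: l_def \<epsilon>_def)
  also have "\<dots> = sqrt ((2 * L)\<^sup>2)" unfolding real_sqrt_mult[symmetric] using False by (simp add: power2_eq_square)
  also have "\<dots> = 2 * L" using L by (subst real_sqrt_abs) simp
  finally have l\<epsilon>: "l * \<epsilon> = 2 * L" .
  let ?r = "run_pmf P \<pi> ([], s1) n"
  have "emeasure ?r {h. \<epsilon> < path_sum D n h} \<le> emeasure ?r {h \<in> space ?r. 1 \<le> ennreal (exp (- (2 * L))) * ennreal (exp (l * path_sum D n h))}"
  proof (rule emeasure_mono)
    show "{h. \<epsilon> < path_sum D n h} \<subseteq> {h \<in> space ?r. 1 \<le> ennreal (exp (- (2 * L))) * ennreal (exp (l * path_sum D n h))}"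
    proof safe
      fix h assume "\<epsilon> < path_sum D n h"
      then have "2 * L \<le> l * path_sum D n h" using l l\<epsilon> by (metis less_imp_le mult_le_cancel_left_pos)
      then show "1 \<le> ennreal (exp (- (2 * L))) * ennreal (exp (l * path_sum D n h))"
        by (simp add: ennreal_mult[symmetric] exp_add[symmetric] flip: ennreal_1)
    qed simp
  qed simp
  also have "\<dots> \<le> ennreal (exp (- (2 * L))) * (\<integral>\<^sup>+ h. ennreal (exp (l * path_sum D n h)) * indicator (space ?r) h \<partial>?r)"
    by (rule nn_integral_Markov_inequality) simp_all
  also have "\<dots> \<le> ennreal (exp (- (2 * L))) * ennreal (exp L)"
    using exp_moment[OF l, of n] unfolding l2 by (intro mult_left_mono) simp_all
  also have "\<dots> = ennreal (exp (- L))" by (simp add: ennreal_mult[symmetric] exp_add[symmetric])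
  also have "exp (- L) = \<delta>" using \<delta> by (simp add: L_def ln_div)
  finally have "emeasure ?r {h. \<epsilon> < path_sum D n h} \<le> ennreal \<delta>" .
  then show ?thesis using \<delta> unfolding \<epsilon>_def L_def measure_pmf.emeasure_eq_measure by simp
qed

end

section \<open>Regret\<close>

lemma transitions_length [simp]: "length (transitions h) = length (fst h)"
  by (simp add: transitions_def)

lemma transitions_nth:
  "i < length (fst h) \<Longrightarrow> transitions h ! i = (fst (fst h ! i), snd (fst h ! i), snd (hprefix h (Suc i)))"
  by (simp add: transitions_def hprefix_def)

text \<open>The policy reruns the algorithm on the history seen so far. By this identity all its
  intermediate states belong to a single run on the final list of transitions.\<close>

lemma transitions_hprefix:
  assumes "i \<le> length (fst h)" shows "transitions (hprefix h i) = take i (transitions h)"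
proof (rule nth_equalityI)
  show l: "length (transitions (hprefix h i)) = length (take i (transitions h))"
    using assms by (simp add: hprefix_def)
  fix j assume "j < length (transitions (hprefix h i))"
  then have j: "j < i" "j < length (fst h)" using assms by (auto simp: hprefix_def)
  have "hprefix (hprefix h i) (Suc j) = hprefix h (Suc j)"
    using j assms by (cases "Suc j = i") (auto simp: hprefix_def)
  then show "transitions (hprefix h i) ! j = take i (transitions h) ! j"
    using j assms by (simp add: transitions_nth hprefix_def[of h i])
qed

lemma run_pmf_prefix:
  assumes "h \<in> set_pmf (run_pmf P \<pi> ([], s1) n)" "i < n"
  shows "hprefix h i \<in> set_pmf (run_pmf P \<pi> ([], s1) i) \<and>
    hprefix h (Suc i) \<in> set_pmf (step_pmf P \<pi> (hprefix h i))"
  using assms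
proof (induction n arbitrary: h)
  case (Suc n)
  then obtain g where g: "g \<in> set_pmf (run_pmf P \<pi> ([], s1) n)" "h \<in> set_pmf (step_pmf P \<pi> g)" by auto
  have lg: "length (fst g) = n" and lh: "length (fst h) = Suc n"
    using run_pmf_length[OF g(1)] run_pmf_length[OF Suc.prems(1)] by auto
  show ?case
  proof (cases "i = n")
    case True
    then show ?thesis using g hprefix_step[OF g(2), of n] lg lh by (simp add: hprefix_self)
  next
    case False
    then have "i < n" using Suc.prems by simp
    then show ?thesis using Suc.IH[OF g(1)] hprefix_step[OF g(2), of i] hprefix_step[OF g(2), of "Suc i"] lg by simp
  qed
qed simp

locale ucmnlk_run = mnl_mdp +
  fixes sel :: "(nat \<Rightarrow> nat \<Rightarrow> real) \<Rightarrow> nat \<Rightarrow> nat" and s1 :: nat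
  assumes sel: "\<And>Q s. sel Q s \<in> pA M \<and> (\<forall>a\<in>pA M. Q s a \<le> Q s (sel Q s))"
    and s1: "s1 \<in> pS M"
begin

abbreviation "\<pi> \<equiv> ucmnlk_pol M sel"
abbreviation "act \<equiv> ucmnlk M sel"
abbreviation "traj n \<equiv> run_pmf P \<pi> ([], s1) n"
abbreviation "V \<equiv> Vpi \<gamma> (rew M) P \<pi>"

definition Qh :: "hist \<Rightarrow> nat \<Rightarrow> nat \<Rightarrow> real" where
  "Qh g = snd (snd (snd (alg_state M (transitions g))))"

lemma act_eq: "act g = sel (Qh g) (snd g)"
  by (simp add: ucmnlk_def Qh_def split: prod.split)

lemma act_in: "act g \<in> pA M" using sel by (simp add: act_eq)

lemma pol: "\<pi> \<in> policies (pA M)" using act_in by (simp add: policies_def ucmnlk_pol_def)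

lemma expectation_step_act:
  assumes g: "snd g \<in> pS M"
  shows "measure_pmf.expectation (step_pmf P \<pi> g) f =
    (\<Sum>k\<in>pSsa M (snd g) (act g). pstar (snd g) (act g) k * (f (fst g @ [(snd g, act g)], k) :: real))"
  unfolding step_pmf_def ucmnlk_pol_def by (simp add: bind_return_pmf expectation_P[OF g act_in])

lemma R_act: "R \<pi> g = rew M (snd g) (act g)"
  unfolding R_def[OF pol] ucmnlk_pol_def by simp

lemma step_act:
  assumes "snd g \<in> pS M" "g' \<in> set_pmf (step_pmf P \<pi> g)"
  shows "\<exists>k\<in>pSsa M (snd g) (act g). g' = (fst g @ [(snd g, act g)], k)"
  using assms set_P[OF assms(1) act_in] by (auto simp: step_pmf_def ucmnlk_pol_def bind_return_pmf)

lemma traj_state: "g \<in> set_pmf (traj n) \<Longrightarrow> snd g \<in> pS M"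
  using run_state[OF pol, of "([], s1)" n] s1 by auto

text \<open>Clipping keeps the martingale differences bounded on trajectories where a confidence polytope
  is empty, so that the supremum in the value iteration is a junk value.\<close>
definition clip :: "real \<Rightarrow> real" where "clip x = max 0 (min c x)"

text \<open>The optimistic excess at the next history, still under the \<open>Q\<close> of the
  current step; a switch of \<open>Q\<close> is charged separately. Subtracting the policy's own
  value lets one martingale cover the noise in both values.\<close>

definition W :: "hist \<Rightarrow> hist \<Rightarrow> real" where
  "W g g' = clip (Qh g (snd g') (sel (Qh g) (snd g'))) - V g'"

definition Dm :: "hist \<Rightarrow> hist \<Rightarrow> real" where
  "Dm g g' = measure_pmf.expectation (step_pmf P \<pi> g) (W g) - W g g'"

lemma W_bound: "snd g' \<in> pS M \<Longrightarrow> - c \<le> W g g' \<and> W g g' \<le> c"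
  using Vpi_bounds[OF pol, of g'] c_pos by (auto simp: W_def clip_def)

sublocale mart: bounded_martingale_differences P \<pi> s1 Dm "2 * c"
proof
  show "0 < 2 * c" using c_pos by simp
  fix n g assume g: "g \<in> set_pmf (traj n)"
  note gS = traj_state[OF g]
  have fin: "finite (set_pmf (step_pmf P \<pi> g))" by (rule finite_step[OF pol gS])
  show "measure_pmf.expectation (step_pmf P \<pi> g) (Dm g) = 0"
    unfolding Dm_def by (subst Bochner_Integration.integral_diff) (auto intro: integrable_measure_pmf_finite fin)
  have st: "snd g' \<in> pS M" if "g' \<in> set_pmf (step_pmf P \<pi> g)" for g'
    by (rule step_state[OF pol gS that])
  fix g' assume g': "g' \<in> set_pmf (step_pmf P \<pi> g)"
  have "- c \<le> measure_pmf.expectation (step_pmf P \<pi> g) (W g)" "measure_pmf.expectation (step_pmf P \<pi> g) (W g) \<le> c"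
    using expectation_bounds[OF fin, of "- c" "W g" c] W_bound st by blast+
  then show "\<bar>Dm g g'\<bar> \<le> 2 * c" using W_bound[OF st[OF g'], of g] by (auto simp: Dm_def abs_le_iff)
qed

lemma regret_le_trivial:
  assumes h: "h \<in> set_pmf (traj n)"
  shows "regret \<gamma> (rew M) P (pA M) \<pi> (Suc n) h \<le> real (Suc n) * c"
proof -
  have S: "snd (hprefix h i) \<in> pS M" if "i < Suc n" for i
  proof (cases "i = n")
    case True
    then show ?thesis using traj_state[OF h] hprefix_self[OF run_pmf_length[OF h]] by simp
  next
    case False
    then show ?thesis using that run_pmf_prefix[OF h, of i] traj_state[of "hprefix h i" i] by simp
  qed
  have Vs: "Vstar \<gamma> (rew M) P (pA M) s \<le> c" if "s \<in> pS M" for s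
    unfolding Vstar_def using that pol by (intro cSUP_least) (auto intro: Vpi_bounds(2))
  have "regret \<gamma> (rew M) P (pA M) \<pi> (Suc n) h \<le> (\<Sum>i<Suc n. c) - (\<Sum>i<Suc n. 0)"
    unfolding regret_def using S Vs Vpi_bounds(1)[OF pol] by (intro diff_mono sum_mono) auto
  then show ?thesis by simp
qed

section \<open>Regret along one fixed trajectory\<close>

context
  fixes h n assumes h: "h \<in> set_pmf (traj n)"
begin

abbreviation "hi i \<equiv> hprefix h i"
abbreviation "st i \<equiv> snd (hprefix h i)"
abbreviation "xs \<equiv> transitions h"

lemma len: "length (fst h) = n" by (rule run_pmf_length[OF h])

lemma hi_n: "hi n = h" using hprefix_self[OF len] .

lemma hi_run: "i \<le> n \<Longrightarrow> hi i \<in> set_pmf (traj i)"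
  using run_pmf_prefix[OF h, of i] h hi_n by (cases "i = n") auto

lemma hi_step: "i < n \<Longrightarrow> hi (Suc i) \<in> set_pmf (step_pmf P \<pi> (hi i))"
  using run_pmf_prefix[OF h, of i] by blast

lemma st_in: "i \<le> n \<Longrightarrow> st i \<in> pS M" using hi_run traj_state by blast

lemma xs_nth:
  assumes i: "i < n" shows "xs ! i = (st i, act (hi i), st (Suc i))" "st (Suc i) \<in> pSsa M (st i) (act (hi i))"
proof -
  obtain k where k: "k \<in> pSsa M (st i) (act (hi i))" "hi (Suc i) = (fst (hi i) @ [(st i, act (hi i))], k)"
    using step_act[OF st_in hi_step[OF i]] i by auto
  have "take (Suc i) (fst h) = take i (fst h) @ [(st i, act (hi i))]"
    using arg_cong[OF k(2), of fst] by (simp add: hprefix_def)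
  then have "fst h ! i = (st i, act (hi i))"
    using i len by (simp add: take_Suc_conv_app_nth)
  then show "xs ! i = (st i, act (hi i), st (Suc i))" using i len by (simp add: transitions_nth)
  show "st (Suc i) \<in> pSsa M (st i) (act (hi i))" using k by simp
qed

lemma valid_xs: "valid xs"
  unfolding valid_def
proof
  fix t assume "t \<in> set xs"
  then obtain i where "i < n" "t = xs ! i" using len by (auto simp: in_set_conv_nth)
  then show "case t of (s, a, s2) \<Rightarrow> s \<in> pS M \<and> a \<in> pA M \<and> s2 \<in> pSsa M s a"
    using xs_nth[of i] st_in[of i] act_in by simp
qed

lemma Qh_hi: "i \<le> n \<Longrightarrow> Qh (hi i) = alg_Q M xs i"
  using transitions_hprefix[of i h] len by (simp add: Qh_def alg_Q_def alg_at_def)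

text \<open>For the excess \<open>x i\<close> of the optimistic value over the policy's value, one
  step gives \<open>x i \<le> \<gamma> * x (Suc i)\<close> plus errors. Summing over time reproduces
  the same sum with factor \<gamma> on the right, and multiplication by
  \<open>c = 1 / (1 - \<gamma>)\<close> resolves the inequality.\<close>

lemma regret_decomposition:
  assumes pl: "\<And>i. i \<le> n \<Longrightarrow> plausible (Qs i)"
    and Qs: "\<And>i. i \<le> n \<Longrightarrow> alg_Q M xs i = devi M (Qs i) (NN M)"
    and \<rho>: "\<And>i q. i < n \<Longrightarrow> q \<in> Qs i \<Longrightarrow>
      (\<Sum>k\<in>pSsa M (st i) (act (hi i)). \<bar>q (st i) (act (hi i)) k - pstar (st i) (act (hi i)) k\<bar>) \<le> \<rho> i"
    and K: "real (card {i. i < n \<and> alg_Q M xs (Suc i) \<noteq> alg_Q M xs i}) \<le> K"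
    and \<epsilon>: "path_sum Dm n h \<le> \<epsilon>" "0 \<le> \<epsilon>"
  shows "regret \<gamma> (rew M) P (pA M) \<pi> (Suc n) h
    \<le> c * (c + \<epsilon> + c * (\<Sum>i<n. \<rho> i) + real n * \<gamma> ^ NN M + c * K)"
proof -
  let ?N = "NN M"
  define v where "v i s = dV (Qs i) ?N s" for i s
  define x where "x i = v i (st i) - V (hi i)" for i
  define sw where "sw i = (if alg_Q M xs (Suc i) \<noteq> alg_Q M xs i then 1 else 0 :: real)" for i
  have greedy: "Qh (hi i) s (sel (Qh (hi i)) s) = v i s" if "i \<le> n" for i s
  proof -
    have "Qh (hi i) = devi M (Qs i) ?N" using Qh_hi[OF that] Qs[OF that] by simp
    then show ?thesis unfolding v_def dV_def
      using sel[of "devi M (Qs i) ?N" s] finA by (intro antisym) (auto intro!: Max_ge Max.boundedI simp: A_ne)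
  qed
  have vb: "0 \<le> v i s \<and> v i s \<le> c" if "i \<le> n" "s \<in> pS M" for i s
    using dV_nonneg[OF pl[OF that(1)] that(2)] dV_upper[OF pl[OF that(1)] that(2)] by (simp add: v_def)
  have x0: "0 \<le> x i" if "i \<le> n" for i
    using optimism[OF pl[OF that] pol st_in[OF that]] by (simp add: x_def v_def)
  have xc: "x i \<le> c" if "i \<le> n" for i
    using vb[OF that st_in[OF that]] Vpi_bounds(1)[OF pol st_in[OF that]] by (simp add: x_def)
  have \<rho>0: "0 \<le> \<rho> i" if "i < n" for i
  proof -
    have "pstar \<in> Qs i" using pl[of i] that by (simp add: plausible_def)
    from \<rho>[OF that this] show ?thesis by simp
  qed
  have step: "x i \<le> \<gamma> * x (Suc i) + \<gamma> * Dm (hi i) (hi (Suc i)) + c * \<rho> i + \<gamma> ^ ?N + c * sw i" if i: "i < n" for i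
  proof -
    have il: "i \<le> n" and Sil: "Suc i \<le> n" using i by auto
    let ?s = "st i" and ?a = "act (hi i)"
    note sS = st_in[OF il] and s'S = st_in[OF Sil]
    have WE: "W (hi i) g' = v i (snd g') - V g'" if "snd g' \<in> pS M" for g'
      unfolding W_def greedy[OF il] using vb[OF il that] by (simp add: clip_def)
    have Ssub: "pSsa M ?s ?a \<subseteq> pS M" using Ssa[OF sS act_in] by blast
    have EW: "measure_pmf.expectation (step_pmf P \<pi> (hi i)) (W (hi i)) =
        (\<Sum>k\<in>pSsa M ?s ?a. pstar ?s ?a k * v i k) - measure_pmf.expectation (step_pmf P \<pi> (hi i)) V"
      unfolding expectation_step_act[OF sS] using Ssub
      by (simp add: sum_subtractf[symmetric] right_diff_distrib[symmetric] subset_iff WE cong: sum.cong)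
    have "v i ?s = devi M (Qs i) ?N ?s ?a"
      using greedy[OF il, of ?s] Qh_hi[OF il] Qs[OF il] by (simp add: act_eq)
    also have "\<dots> \<le> rew M ?s ?a + \<gamma> * (\<Sum>k\<in>pSsa M ?s ?a. pstar ?s ?a k * v i k) + \<gamma> * (c * \<rho> i) + \<gamma> ^ ?N"
      unfolding v_def by (rule devi_step_error[OF pl[OF il] sS act_in]) (rule \<rho>[OF i])
    finally have "x i \<le> \<gamma> * (\<Sum>k\<in>pSsa M ?s ?a. pstar ?s ?a k * v i k)
        - \<gamma> * measure_pmf.expectation (step_pmf P \<pi> (hi i)) V + \<gamma> * (c * \<rho> i) + \<gamma> ^ ?N"
      unfolding x_def Vpi_bellman[OF pol sS] R_act by simp
    also have "\<dots> = \<gamma> * (Dm (hi i) (hi (Suc i)) + W (hi i) (hi (Suc i))) + \<gamma> * (c * \<rho> i) + \<gamma> ^ ?N"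
      by (simp add: Dm_def EW right_diff_distrib)
    finally have 1: "x i \<le> \<gamma> * (Dm (hi i) (hi (Suc i)) + W (hi i) (hi (Suc i))) + \<gamma> * (c * \<rho> i) + \<gamma> ^ ?N" .
    \<comment> \<open>The next state is valued under the old and the new \<open>Q\<close>; both
      values lie in \<open>[0, c]\<close>, so a change costs at most \<open>c\<close>.\<close>
    have "v i (st (Suc i)) \<le> v (Suc i) (st (Suc i)) + c * sw i"
    proof (cases "alg_Q M xs (Suc i) = alg_Q M xs i")
      case True
      then have "Qh (hi (Suc i)) = Qh (hi i)" using Qh_hi[OF il] Qh_hi[OF Sil] by simp
      then show ?thesis using greedy[OF il, of "st (Suc i)"] greedy[OF Sil, of "st (Suc i)"] True by (simp add: sw_def)
    next
      case False
      then show ?thesis using vb[OF il s'S] vb[OF Sil s'S] by (simp add: sw_def)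
    qed
    then have "W (hi i) (hi (Suc i)) \<le> x (Suc i) + c * sw i" unfolding WE[OF s'S] x_def by simp
    then have "\<gamma> * W (hi i) (hi (Suc i)) \<le> \<gamma> * (x (Suc i) + c * sw i)" using disc by (intro mult_left_mono) auto
    moreover have "\<gamma> * (c * sw i) \<le> c * sw i"
      using disc c_pos by (intro mult_left_le_one_le) (auto simp: sw_def)
    moreover have "\<gamma> * (c * \<rho> i) \<le> c * \<rho> i"
      using disc c_pos \<rho>0[OF i] by (intro mult_left_le_one_le) auto
    ultimately show ?thesis using 1 by (simp add: distrib_left)
  qed
  define X where "X = (\<Sum>i<Suc n. x i)"
  have X': "(\<Sum>i<n. x (Suc i)) \<le> X"
    unfolding X_def by (subst sum.lessThan_Suc_shift) (use x0 in simp)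
  have swK: "(\<Sum>i<n. sw i) \<le> K"
  proof -
    have "(\<Sum>i<n. sw i) = real (card {i. i < n \<and> alg_Q M xs (Suc i) \<noteq> alg_Q M xs i})"
      unfolding sw_def by (simp add: sum.If_cases Int_def lessThan_def)
    then show ?thesis using K by simp
  qed
  \<comment> \<open>The last of the \<open>Suc n\<close> summands has no successor on the trajectory
    and is bounded by \<open>c\<close>.\<close>
  have "X \<le> (\<Sum>i<n. \<gamma> * x (Suc i) + \<gamma> * Dm (hi i) (hi (Suc i)) + c * \<rho> i + \<gamma> ^ ?N + c * sw i) + c"
    unfolding X_def sum.lessThan_Suc by (intro add_mono sum_mono step xc) auto
  also have "\<dots> = \<gamma> * (\<Sum>i<n. x (Suc i)) + \<gamma> * path_sum Dm n h + c * (\<Sum>i<n. \<rho> i) + real n * \<gamma> ^ ?N + c * (\<Sum>i<n. sw i) + c"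
    by (simp add: sum.distrib sum_distrib_left path_sum_def)
  also have "\<dots> \<le> \<gamma> * X + \<epsilon> + c * (\<Sum>i<n. \<rho> i) + real n * \<gamma> ^ ?N + c * K + c"
  proof -
    have "\<gamma> * path_sum Dm n h \<le> \<gamma> * \<epsilon>" using \<epsilon>(1) disc by (intro mult_left_mono) auto
    moreover have "\<gamma> * \<epsilon> \<le> \<epsilon>" using \<epsilon>(2) disc by (intro mult_left_le_one_le) auto
    moreover have "\<gamma> * (\<Sum>i<n. x (Suc i)) \<le> \<gamma> * X" using X' disc by (intro mult_left_mono) auto
    moreover have "c * (\<Sum>i<n. sw i) \<le> c * K" using swK c_pos by (intro mult_left_mono) auto
    ultimately show ?thesis by linarith
  qed
  finally have "(1 - \<gamma>) * X \<le> c + \<epsilon> + c * (\<Sum>i<n. \<rho> i) + real n * \<gamma> ^ ?N + c * K" by (simp add: algebra_simps)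
  then have "c * ((1 - \<gamma>) * X) \<le> c * (c + \<epsilon> + c * (\<Sum>i<n. \<rho> i) + real n * \<gamma> ^ ?N + c * K)"
    using c_pos by (intro mult_left_mono) auto
  moreover have "c * ((1 - \<gamma>) * X) = X" using disc by (simp add: c_def)
  moreover have "regret \<gamma> (rew M) P (pA M) \<pi> (Suc n) h \<le> X"
    unfolding regret_def X_def sum_subtractf[symmetric] x_def v_def
    using Vstar_le[OF pl st_in] by (intro sum_mono) (auto intro!: diff_right_mono)
  ultimately show ?thesis by simp
qed

lemma Pset_plausible: "pstar \<in> Pset M t \<theta> \<Sigma> \<Longrightarrow> plausible (Pset M t \<theta> \<Sigma>)"
  unfolding plausible_def
proof (intro conjI ballI)
  fix q s a assume q: "q \<in> Pset M t \<theta> \<Sigma>" and sa: "s \<in> pS M" "a \<in> pA M"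
  show "(\<Sum>k\<in>pSsa M s a. q s a k) = 1" using q sa unfolding Pset_def conf_set_def by blast
  fix k assume "k \<in> pSsa M s a"
  then have "k \<in> pS M" using Ssa[OF sa] by blast
  then show "0 \<le> q s a k" using q sa unfolding Pset_def conf_set_def by blast
qed

text \<open>The decomposition is used with the polytopes of the episode starts. \<open>G\<close>
  bounds twice the growth of the log-determinant, hence both the summed potentials and the number of
  switches; Cauchy-Schwarz turns the summed square roots into \<open>sqrt (n * G)\<close>.\<close>

lemma regret_bound:
  assumes lam: "0 < lam M" and lamL: "4 * L\<phi>\<^sup>2 \<le> lam M" and D0: "0 < D"
    and event: "\<And>j. j \<le> n \<Longrightarrow> wnorm (alg_Sigma M xs j) (alg_theta M xs j - \<theta>s) \<le> beta M (Suc j)"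
    and B: "\<And>j. j \<le> n \<Longrightarrow> beta M (Suc j) \<le> B"
    and \<kappa>: "0 < \<kappa>"
    and kap: "\<And>i \<theta> k l. i < n \<Longrightarrow> \<theta> \<in> Theta D (Lth M) \<Longrightarrow>
      k \<in> pSsa M (st i) (act (hi i)) \<Longrightarrow> l \<in> pSsa M (st i) (act (hi i)) \<Longrightarrow>
      \<kappa> \<le> mnl (phi M) (pSsa M) \<theta> (st i) (act (hi i)) k * mnl (phi M) (pSsa M) \<theta> (st i) (act (hi i)) l"
    and \<epsilon>: "path_sum Dm n h \<le> \<epsilon>" "0 \<le> \<epsilon>"
    and G: "G = 2 * real D * ln (real D * (1 + real n))"
  shows "regret \<gamma> (rew M) P (pA M) \<pi> (Suc n) h
    \<le> c * (c + \<epsilon> + c * (4 * B * sqrt (real n * G) + 60 * B\<^sup>2 * G / \<kappa>) + real n * \<gamma> ^ NN M + c * G)"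
proof -
  note ctx = valid_xs lam lamL
  have lx: "length xs = n" using len by simp
  have ev: "wnorm (alg_Sigma M xs j) (alg_theta M xs j - \<theta>s) \<le> beta M (Suc j)" if "j \<le> length xs" for j
    using event that lx by simp
  have BB: "beta M (Suc j) \<le> B" if "j \<le> length xs" for j using B that lx by simp
  have kk: "\<kappa> \<le> mnl (phi M) (pSsa M) \<theta> s a k * mnl (phi M) (pSsa M) \<theta> s a l"
    if "i < length xs" "xs ! i = (s, a, s2)" "\<theta> \<in> Theta D (Lth M)" "k \<in> pSsa M s a" "l \<in> pSsa M s a"
    for i s a s2 \<theta> k l
    using kap[of i \<theta> k l] xs_nth(1)[of i] that lx by simp
  define start where "start i j \<longleftrightarrow> j \<le> i \<and>
      alg_Q M xs i = devi M (Pset M (Suc j) (alg_theta M xs j) (alg_Sigma M xs j)) (NN M) \<and>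
      Determinant.det (alg_Sigma M xs i) \<le> 2 * Determinant.det (alg_Sigma M xs j)" for i j
  define j where "j i = (SOME j. start i j)" for i
  have start: "start i (j i)" if "i \<le> n" for i
  proof -
    have "\<exists>j. start i j"
      using episode_start[OF valid_xs less_imp_le[OF dt_pos[OF ctx]], of i] that lx unfolding start_def by blast
    then show ?thesis unfolding j_def by (rule someI_ex)
  qed
  have j: "j i \<le> i"
    and jQ: "alg_Q M xs i = devi M (Pset M (Suc (j i)) (alg_theta M xs (j i)) (alg_Sigma M xs (j i))) (NN M)"
    and jd: "Determinant.det (alg_Sigma M xs i) \<le> 2 * Determinant.det (alg_Sigma M xs (j i))" if "i \<le> n" for i
    using start[OF that] by (simp_all add: start_def)
  define Qs where "Qs i = Pset M (Suc (j i)) (alg_theta M xs (j i)) (alg_Sigma M xs (j i))" for i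
  let ?x = "potential xs"
  define \<rho> where "\<rho> i = 4 * B * sqrt (?x i) + 60 * B\<^sup>2 * ?x i / \<kappa>" for i
  have x0: "0 \<le> ?x i" if "i < n" for i using potential_nonneg[OF ctx] that lx by simp
  have ln: "ln (Determinant.det (alg_Sigma M xs n) / Determinant.det (alg_Sigma M xs 0)) \<le> G / 2"
    using ln_det_ratio_le[OF ctx _ D0, of n] lx G by simp
  have sx: "(\<Sum>i<n. ?x i) \<le> G" using sum_potential_le[OF ctx, of n] lx ln by simp
  have "0 \<le> beta M (Suc 0)"
    by (rule beta_nonneg[OF ctx _ _ \<kappa>]) (fact ev BB kk | simp)+
  then have B0: "0 \<le> B" using B[of 0] by simp
  have "regret \<gamma> (rew M) P (pA M) \<pi> (Suc n) h
    \<le> c * (c + \<epsilon> + c * (\<Sum>i<n. \<rho> i) + real n * \<gamma> ^ NN M + c * G)"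
  proof (rule regret_decomposition[of Qs])
    show "plausible (Qs i)" if "i \<le> n" for i
    proof -
      have ji: "j i \<le> length xs" using j[OF that] that lx by simp
      show ?thesis unfolding Qs_def
        by (intro Pset_plausible pstar_in_Pset[OF ctx _ _ \<kappa> _ ji]) (fact ev BB kk)+
    qed
    show "alg_Q M xs i = devi M (Qs i) (NN M)" if "i \<le> n" for i using jQ[OF that] by (simp add: Qs_def)
    show "(\<Sum>k\<in>pSsa M (st i) (act (hi i)). \<bar>q (st i) (act (hi i)) k - pstar (st i) (act (hi i)) k\<bar>) \<le> \<rho> i"
      if "i < n" "q \<in> Qs i" for i q
    proof -
      have il: "i < length xs" "i \<le> n" and q: "q \<in> Pset M (Suc (j i)) (alg_theta M xs (j i)) (alg_Sigma M xs (j i))"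
        using that lx by (auto simp: Qs_def)
      show ?thesis unfolding \<rho>_def
        by (rule Pset_l1_diameter[OF ctx _ _ \<kappa> _ il(1) xs_nth(1)[OF that(1)] j[OF il(2)] jd[OF il(2)] q])
           (fact ev BB kk)+
    qed
    show "real (card {i. i < n \<and> alg_Q M xs (Suc i) \<noteq> alg_Q M xs i}) \<le> G"
      using card_switch_le[OF ctx, of n] lx ln by simp
  qed (fact \<epsilon>)+
  also have "\<dots> \<le> c * (c + \<epsilon> + c * (4 * B * sqrt (real n * G) + 60 * B\<^sup>2 * G / \<kappa>) + real n * \<gamma> ^ NN M + c * G)"
  proof -
    have "(\<Sum>i<n. sqrt (?x i))\<^sup>2 \<le> (\<Sum>i<n. (sqrt (?x i))\<^sup>2) * real (card {..<n})"
      by (rule sum_squared_le_sum_of_squares)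
    also have "\<dots> = (\<Sum>i<n. ?x i) * real n" using x0 by simp
    also have "\<dots> \<le> real n * G" using mult_right_mono[OF sx, of "real n"] by (simp add: mult.commute)
    finally have "(\<Sum>i<n. sqrt (?x i)) \<le> sqrt (real n * G)" by (rule real_le_rsqrt)
    then have "4 * B * (\<Sum>i<n. sqrt (?x i)) \<le> 4 * B * sqrt (real n * G)" using B0 by (intro mult_left_mono) auto
    moreover have "60 * B\<^sup>2 / \<kappa> * (\<Sum>i<n. ?x i) \<le> 60 * B\<^sup>2 / \<kappa> * G"
      using sx \<kappa> by (intro mult_left_mono) auto
    moreover have "(\<Sum>i<n. \<rho> i) = 4 * B * (\<Sum>i<n. sqrt (?x i)) + 60 * B\<^sup>2 / \<kappa> * (\<Sum>i<n. ?x i)"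
      by (simp add: \<rho>_def sum.distrib sum_distrib_left)
    ultimately have "(\<Sum>i<n. \<rho> i) \<le> 4 * B * sqrt (real n * G) + 60 * B\<^sup>2 * G / \<kappa>" by simp
    then show ?thesis using c_pos by (intro mult_left_mono add_mono) auto
  qed
  finally show ?thesis .
qed

text \<open>This covers \<lambda> = 0, where the matrices are zero and \<open>minv\<close> is
  unspecified. All features vanish, so every parameter yields the true kernel, every radius is 0
  whatever \<open>minv\<close> returns, and \<open>Q\<close> never changes.\<close>

lemma regret_bound_degenerate:
  assumes L0: "L\<phi> = 0" and lam: "0 \<le> lam M"
    and \<epsilon>: "path_sum Dm n h \<le> \<epsilon>" "0 \<le> \<epsilon>"
  shows "regret \<gamma> (rew M) P (pA M) \<pi> (Suc n) h \<le> c * (c + \<epsilon> + real n * \<gamma> ^ NN M)"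
proof -
  have lx: "length xs = n" using len by simp
  have phi0: "phi M s a k = 0\<^sub>v D" if "s \<in> pS M" "a \<in> pA M" "k \<in> pSsa M s a" for s a k
  proof -
    have v: "phi M s a k \<in> carrier_vec D" using phi_carrier that by blast
    have "\<bar>vec_index (phi M s a k) j\<bar> \<le> 0" if "j < D" for j
      using vec_index_le_vnorm[OF v that] phi_le[OF \<open>s \<in> pS M\<close> \<open>a \<in> pA M\<close> \<open>k \<in> pSsa M s a\<close>] L0 by linarith
    then show ?thesis using v by (intro eq_vecI) auto
  qed
  have mnl0: "mnl (phi M) (pSsa M) \<theta> s a k = pstar s a k"
    if "s \<in> pS M" "a \<in> pA M" "\<theta> \<in> carrier_vec D" for \<theta> s a k
    using phi0[OF that(1,2)] that(3) \<theta>s_carrier by (simp add: mnl_def cong: sum.cong)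
  have w0: "wnorm A (0\<^sub>v D) = 0" for A by (simp add: wnorm_def scalar_prod_def)
  have mean0: "mean_feat M \<theta> s a = 0\<^sub>v D" if "s \<in> pS M" "a \<in> pA M" for \<theta> s a
    using phi0[OF that] by (intro eq_vecI) (auto simp: mean_feat_def)
  have rad0: "(\<Sum>k\<in>pSsa M s a. mnl (phi M) (pSsa M) \<theta> s a k * wnorm A (phi M s a k - mean_feat M \<theta> s a)) = 0"
    "Max ((\<lambda>k. (wnorm A (phi M s a k))\<^sup>2) ` pSsa M s a) = 0" if "s \<in> pS M" "a \<in> pA M" for s a \<theta> A
  proof -
    show "(\<Sum>k\<in>pSsa M s a. mnl (phi M) (pSsa M) \<theta> s a k * wnorm A (phi M s a k - mean_feat M \<theta> s a)) = 0"
      using phi0[OF that] by (simp add: mean0[OF that] w0)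
    have "(\<lambda>k. (wnorm A (phi M s a k))\<^sup>2) ` pSsa M s a = {0}"
      using phi0[OF that] Ssa[OF that] w0 by auto
    then show "Max ((\<lambda>k. (wnorm A (phi M s a k))\<^sup>2) ` pSsa M s a) = 0" by simp
  qed
  have pin: "pstar \<in> Pset M t \<theta> A" if \<theta>: "\<theta> \<in> carrier_vec D" for t \<theta> A
    unfolding Pset_def conf_set_def
  proof (intro CollectI ballI conjI)
    fix s a assume sa: "s \<in> pS M" "a \<in> pA M"
    interpret mnl_model M s a by (rule model[OF sa])
    show "0 \<le> p \<theta>s k" for k by (rule mnl_nonneg)
    show "p \<theta>s k \<le> 1" for k
      using member_le_sum[of k I "p \<theta>s"] fin mnl_nonneg by (cases "k \<in> I") (auto simp: mnl_sum mnl_def[of _ _ _ _ _ k])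
    show "(\<Sum>k\<in>I. p \<theta>s k) = 1" by (rule mnl_sum)
    show "(\<Sum>k\<in>I. \<bar>p \<theta>s k - p \<theta> k\<bar>) \<le> beta M t * (\<Sum>k\<in>I. p \<theta> k * wnorm (minv A) (\<phi> k - mean \<theta>))
        + 3 * (beta M t)\<^sup>2 * Max ((\<lambda>k. (wnorm (minv A) (\<phi> k))\<^sup>2) ` I)"
      unfolding rad0[OF sa] by (simp add: mnl0[OF sa \<theta>])
  qed
  have p0: "(\<Sum>k\<in>pSsa M s a. \<bar>q s a k - pstar s a k\<bar>) \<le> 0"
    if "q \<in> Pset M t \<theta> A" "s \<in> pS M" "a \<in> pA M" "\<theta> \<in> carrier_vec D" for q t \<theta> A s a
  proof -
    have "(\<Sum>k\<in>pSsa M s a. \<bar>q s a k - mnl (phi M) (pSsa M) \<theta> s a k\<bar>)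
      \<le> beta M t * (\<Sum>k\<in>pSsa M s a. mnl (phi M) (pSsa M) \<theta> s a k * wnorm (minv A) (phi M s a k - mean_feat M \<theta> s a))
        + 3 * (beta M t)\<^sup>2 * Max ((\<lambda>k. (wnorm (minv A) (phi M s a k))\<^sup>2) ` pSsa M s a)"
      using that(1-3) unfolding Pset_def conf_set_def by blast
    then show ?thesis unfolding rad0[OF that(2,3)] by (simp add: mnl0[OF that(2-4)])
  qed
  have const: "alg_Sigma M xs i = alg_Sigma M xs 0 \<and> alg_Sigma_ep M xs i = alg_Sigma M xs 0 \<and> alg_Q M xs i = alg_Q M xs 0"
    if "i \<le> n" for i
    using that
  proof (induction i)
    case 0
    show ?case by (simp add: alg_at_0)
  next
    case (Suc i)
    then have i: "i < n" by simp
    note x = xs_nth(1)[OF i]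
    have "gram D (pSsa M (st i) (act (hi i))) (upd xs i (st i) (act (hi i))) = 0\<^sub>m D D"
      using phi0[OF st_in act_in] mean0[OF st_in act_in] i
      by (intro eq_matI) (auto simp: gram_def upd_def)
    then have S: "alg_Sigma M xs (Suc i) = alg_Sigma M xs 0"
      using Sg_Suc[OF valid_xs _ x] Suc lx by (simp add: alg_at_0)
    have "0 \<le> Determinant.det (alg_Sigma M xs 0)" using lam by (simp add: alg_at_0)
    then have "Determinant.det (alg_Sigma M xs (Suc i)) \<le> 2 * Determinant.det (alg_Sigma_ep M xs i)"
      using S Suc by simp
    from alg_step(3)[OF _ x this] show ?case using S Suc lx by simp
  qed
  define Q0 where "Q0 = Pset M 1 (alg_theta M xs 0) (alg_Sigma M xs 0)"
  have th0: "alg_theta M xs 0 \<in> carrier_vec D" by (simp add: alg_at_0)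
  have "regret \<gamma> (rew M) P (pA M) \<pi> (Suc n) h \<le> c * (c + \<epsilon> + c * (\<Sum>i<n. 0) + real n * \<gamma> ^ NN M + c * 0)"
  proof (rule regret_decomposition[of "\<lambda>_. Q0"])
    show "plausible Q0" unfolding Q0_def by (rule Pset_plausible[OF pin[OF th0]])
    show "alg_Q M xs i = devi M Q0 (NN M)" if "i \<le> n" for i
      using const[OF that] alg_at_0(4)[of M xs] by (simp add: Q0_def)
    show "(\<Sum>k\<in>pSsa M (st i) (act (hi i)). \<bar>q (st i) (act (hi i)) k - pstar (st i) (act (hi i)) k\<bar>) \<le> 0"
      if "i < n" "q \<in> Q0" for i q
      using that p0[of q 1, OF _ st_in act_in th0] by (simp add: Q0_def)
    have "{i. i < n \<and> alg_Q M xs (Suc i) \<noteq> alg_Q M xs i} = {}"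
    proof -
      have "alg_Q M xs (Suc i) = alg_Q M xs i" if "i < n" for i using const[of i] const[of "Suc i"] that by simp
      then show ?thesis by blast
    qed
    then show "real (card {i. i < n \<and> alg_Q M xs (Suc i) \<noteq> alg_Q M xs i}) \<le> 0" by simp
  qed (fact \<epsilon>)+
  then show ?thesis by simp
qed

end
end

text \<open>\<open>l\<close> stands for \<open>1 + ln (T * U / \<delta>)\<close> and dominates every
  logarithm. The term \<open>60 * B^2 * G\<close> sets the scale: \<open>B^2\<close> brings
  \<open>l^4\<close> and \<open>G\<close> brings \<open>3 * d * l\<close>, whence the constant 180
  and the exponent 5.\<close>

lemma regret_arithmetic:
  fixes c d T F l \<kappa> \<epsilon> G B g n :: real
  assumes c: "1 \<le> c" and d: "1 \<le> d" and T: "1 \<le> T" and l: "1 \<le> l" and \<kappa>: "0 < \<kappa>" and F: "0 \<le> F"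
    and B: "0 \<le> B" "B \<le> F * sqrt d * l\<^sup>2" and G: "0 \<le> G" "G \<le> 3 * d * l"
    and \<epsilon>: "\<epsilon> \<le> 4 * c * sqrt T * l" and n: "0 \<le> n" "n \<le> T" and g: "n * g \<le> d * sqrt T"
  shows "c * (c + \<epsilon> + c * (4 * B * sqrt (n * G) + 60 * B\<^sup>2 * G / \<kappa>) + n * g + c * G)
    \<le> 180 * (1 + F\<^sup>2) * l ^ 5 * (d * sqrt T * c\<^sup>2 + d\<^sup>2 * c\<^sup>2 / \<kappa>)"
proof -
  define S where "S = d * sqrt T"
  have sT: "1 \<le> sqrt T" using T by simp
  have S1: "1 \<le> S" unfolding S_def using mult_mono[OF d sT] d by simp
  then have S0: "0 \<le> S" by linarith
  have dS: "d \<le> S" unfolding S_def using sT d by (simp add: mult_le_cancel_left1)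
  have TS: "sqrt T \<le> S" unfolding S_def using sT d by (simp add: mult_le_cancel_right1)
  have l5: "1 \<le> l ^ 5" using l by (rule one_le_power)
  have ll: "l \<le> l ^ 5" using power_increasing[of 1 5 l] l by simp
  have l35: "l ^ 3 \<le> l ^ 5" using power_increasing[of 3 5 l] l by simp
  have t1: "c \<le> c * (S * l ^ 5)" using mult_mono[OF S1 l5] c S1 by (simp add: mult_le_cancel_left1)
  have t2: "\<epsilon> \<le> c * (4 * (S * l ^ 5))"
  proof -
    have "sqrt T * l \<le> S * l ^ 5" by (rule mult_mono[OF TS ll S0]) (use l in simp)
    then have "4 * c * (sqrt T * l) \<le> 4 * c * (S * l ^ 5)" using c by (intro mult_left_mono) auto
    then show ?thesis using \<epsilon> by (simp add: mult_ac)
  qed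
  have t3: "4 * B * sqrt (n * G) \<le> 8 * F * (S * l ^ 5)"
  proof -
    have "n * G \<le> T * (3 * d * l)" using n G T by (intro mult_mono) auto
    \<comment> \<open>Enlarging \<open>3 * l\<close> to \<open>4 * l^2\<close> lets the constant and
      the logarithm leave the square root.\<close>
    also have "\<dots> \<le> T * (4 * d * l\<^sup>2)"
      using T d l by (intro mult_left_mono mult_mono) (auto simp: power2_eq_square mult_le_cancel_left1)
    finally have "sqrt (n * G) \<le> sqrt (T * (4 * d * l\<^sup>2))" by (rule real_sqrt_le_mono)
    also have "\<dots> = 2 * sqrt T * sqrt d * l" using l by (simp add: real_sqrt_mult)
    finally have "4 * B * sqrt (n * G) \<le> 4 * (F * sqrt d * l\<^sup>2) * (2 * sqrt T * sqrt d * l)"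
      using B G n by (intro mult_mono) auto
    also have "\<dots> = 8 * F * ((sqrt d * sqrt d) * sqrt T * l ^ 3)" by (simp add: power2_eq_square power3_eq_cube)
    also have "\<dots> = 8 * F * (S * l ^ 3)" using d by (simp add: S_def)
    also have "\<dots> \<le> 8 * F * (S * l ^ 5)" using F S1 l35 by (intro mult_left_mono) auto
    finally show ?thesis .
  qed
  have t4: "60 * B\<^sup>2 * G / \<kappa> \<le> 180 * F\<^sup>2 * l ^ 5 * (d\<^sup>2 / \<kappa>)"
  proof -
    have "B\<^sup>2 \<le> (F * sqrt d * l\<^sup>2)\<^sup>2" using B by (intro power_mono) auto
    also have "\<dots> = F\<^sup>2 * d * l ^ 4" using d by (simp add: power_mult_distrib)
    finally have "60 * B\<^sup>2 * G \<le> 60 * (F\<^sup>2 * d * l ^ 4) * (3 * d * l)"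
      using G d l by (intro mult_mono) auto
    also have "\<dots> = 180 * F\<^sup>2 * l ^ 5 * d\<^sup>2" by (simp add: power2_eq_square power_numeral_reduce)
    finally show ?thesis using \<kappa> by (simp add: divide_right_mono)
  qed
  have t5: "n * g \<le> c * (S * l ^ 5)"
  proof -
    have "S \<le> S * l ^ 5" using S1 l5 by (simp add: mult_le_cancel_left1)
    also have "\<dots> \<le> c * (S * l ^ 5)" using mult_right_mono[OF c, of "S * l ^ 5"] S0 l by simp
    finally show ?thesis using g by (simp add: S_def)
  qed
  have t6: "G \<le> 3 * (S * l ^ 5)"
  proof -
    have "d * l \<le> S * l ^ 5" by (rule mult_mono[OF dS ll S0]) (use l in simp)
    then show ?thesis using G by simp
  qed
  have F1: "2 * F \<le> 1 + F\<^sup>2"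
    using zero_le_power2[of "F - 1"] by (simp add: power2_diff)
  have "c + \<epsilon> + c * (4 * B * sqrt (n * G) + 60 * B\<^sup>2 * G / \<kappa>) + n * g + c * G
    \<le> c * (S * l ^ 5) + c * (4 * (S * l ^ 5)) + c * (8 * F * (S * l ^ 5) + 180 * F\<^sup>2 * l ^ 5 * (d\<^sup>2 / \<kappa>))
      + c * (S * l ^ 5) + c * (3 * (S * l ^ 5))"
    using c t1 t2 t3 t4 t5 t6 by (intro add_mono mult_left_mono) auto
  also have "\<dots> = c * ((9 + 8 * F) * (S * l ^ 5) + 180 * F\<^sup>2 * (l ^ 5 * (d\<^sup>2 / \<kappa>)))" by (simp add: algebra_simps)
  also have "\<dots> \<le> c * (180 * (1 + F\<^sup>2) * (S * l ^ 5) + 180 * (1 + F\<^sup>2) * (l ^ 5 * (d\<^sup>2 / \<kappa>)))"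
  proof -
    have "9 + 8 * F \<le> 180 * (1 + F\<^sup>2)" using mult_left_mono[OF F1, of 4] zero_le_power2[of F]
      unfolding distrib_left by linarith
    moreover have "0 \<le> S * l ^ 5" "0 \<le> l ^ 5 * (d\<^sup>2 / \<kappa>)" using S0 l \<kappa> by simp_all
    ultimately show ?thesis using c by (intro mult_left_mono add_mono mult_right_mono) auto
  qed
  finally have "c * (c + \<epsilon> + c * (4 * B * sqrt (n * G) + 60 * B\<^sup>2 * G / \<kappa>) + n * g + c * G)
    \<le> c * (c * (180 * (1 + F\<^sup>2) * (S * l ^ 5) + 180 * (1 + F\<^sup>2) * (l ^ 5 * (d\<^sup>2 / \<kappa>))))"
    using c by (intro mult_left_mono) auto
  also have "\<dots> = 180 * (1 + F\<^sup>2) * l ^ 5 * (d * sqrt T * c\<^sup>2 + d\<^sup>2 * c\<^sup>2 / \<kappa>)"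
    by (simp add: S_def power2_eq_square algebra_simps)
  finally show ?thesis .
qed

text \<open>Follows from \<open>\<gamma> \<le> exp (\<gamma> - 1)\<close>; it turns the lower bound
  on the number of iterations into \<open>\<gamma> ^ N \<le> d / sqrt T\<close>.\<close>

lemma power_le_exp_neg:
  fixes \<gamma> :: real assumes "0 \<le> \<gamma>" shows "\<gamma> ^ N \<le> exp (- (real N * (1 - \<gamma>)))"
proof -
  have "\<gamma> \<le> exp (\<gamma> - 1)" using exp_ge_add_one_self[of "\<gamma> - 1"] by simp
  then have "\<gamma> ^ N \<le> exp (\<gamma> - 1) ^ N" using assms by (rule power_mono)
  then show ?thesis by (simp add: exp_of_nat_mult[symmetric] algebra_simps)
qed

section \<open>The high-probability regret bound\<close>

context ucmnlk_run
begin

text \<open>\<open>traj (T - 1)\<close> produces the history at time \<open>T\<close>, with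
  \<open>T - 1\<close> transitions and the \<open>T\<close> states over which the regret is summed.
  The confidence event and Azuma's inequality each account for one \<delta>.\<close>

theorem regret_whp:
  fixes F U \<kappa> \<delta> :: real and T :: nat
  defines "bound \<equiv> 180 * (1 + F\<^sup>2) * (1 + ln (real T * U / \<delta>)) ^ 5 *
      (real D * sqrt (real T) / (1 - \<gamma>)\<^sup>2 + (real D)\<^sup>2 / (\<kappa> * (1 - \<gamma>)\<^sup>2))"
  assumes T: "1 \<le> T" and D0: "0 < D" and \<kappa>: "0 < \<kappa>" and \<delta>: "0 < \<delta>" "\<delta> < 1" and U: "1 \<le> U"
    and beta: "\<And>t. beta M t = F * sqrt (real D) * (ln (U * real t / \<delta>))\<^sup>2"
    and lamL: "4 * L\<phi>\<^sup>2 \<le> lam M"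
    and N: "ln (sqrt (real T) / real D) / (1 - \<gamma>) \<le> real (NN M)"
    and kap: "\<And>h i \<theta> k l. h \<in> set_pmf (traj (T - 1)) \<Longrightarrow> i < T \<Longrightarrow> \<theta> \<in> Theta D (Lth M) \<Longrightarrow>
      k \<in> pSsa M (snd (hprefix h i)) (act (hprefix h i)) \<Longrightarrow> l \<in> pSsa M (snd (hprefix h i)) (act (hprefix h i)) \<Longrightarrow>
      \<kappa> \<le> mnl (phi M) (pSsa M) \<theta> (snd (hprefix h i)) (act (hprefix h i)) k *
          mnl (phi M) (pSsa M) \<theta> (snd (hprefix h i)) (act (hprefix h i)) l"
    and event: "1 - \<delta> \<le> measure_pmf.prob (traj (T - 1))
        {h. \<forall>t\<in>{1..T}. wnorm (alg_Sigma M (transitions h) (t - 1)) (alg_theta M (transitions h) (t - 1) - \<theta>s) \<le> beta M t}"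
  shows "1 - 2 * \<delta> \<le> measure_pmf.prob (traj (T - 1))
    {h. regret \<gamma> (rew M) P (pA M) \<pi> T h \<le> bound}"
proof -
  define n where "n = T - 1"
  have Tn: "T = Suc n" using T by (simp add: n_def)
  define l where "l = 1 + ln (real T * U / \<delta>)"
  have RT: "1 \<le> real T" using T by simp
  have TU: "1 \<le> real T * U" using mult_mono[OF RT U] by simp
  have ge1: "1 \<le> U * real t / \<delta>" if "1 \<le> t" for t :: nat
  proof -
    have "1 * 1 \<le> U * real t" using U that by (intro mult_mono) auto
    then show ?thesis using \<delta> by (simp add: pos_le_divide_eq)
  qed
  have lnl: "ln x \<le> l - 1" if "0 < x" "x \<le> real T * U / \<delta>" for x using that by (simp add: l_def)
  have l1: "1 \<le> l" using ge1[OF T] by (simp add: l_def mult.commute)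
  have c2: "1 / (1 - \<gamma>)\<^sup>2 = c\<^sup>2" by (simp add: c_def power_divide)
  have bound_eq: "bound = 180 * (1 + F\<^sup>2) * l ^ 5 * (real D * sqrt (real T) * c\<^sup>2 + (real D)\<^sup>2 * c\<^sup>2 / \<kappa>)"
    unfolding bound_def l_def c2[symmetric] by (simp add: mult.commute)
  show ?thesis
  proof (cases "sqrt (real T) < real D")
    case True
    have "real T * c \<le> bound"
    proof -
      have "real T * c = sqrt (real T) * sqrt (real T) * c" by simp
      also have "\<dots> \<le> real D * sqrt (real T) * c\<^sup>2"
        using True c_ge1 by (intro mult_mono) (auto simp: power2_eq_square)
      also have "\<dots> \<le> real D * sqrt (real T) * c\<^sup>2 + (real D)\<^sup>2 * c\<^sup>2 / \<kappa>" using \<kappa> by simp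
      also have "\<dots> \<le> (180 * (1 + F\<^sup>2) * l ^ 5) * \<dots>"
      proof -
        have "1 * 1 \<le> (180 * (1 + F\<^sup>2)) * l ^ 5"
          using l1 by (intro mult_mono one_le_power) auto
        moreover have "0 \<le> real D * sqrt (real T) * c\<^sup>2 + (real D)\<^sup>2 * c\<^sup>2 / \<kappa>" using \<kappa> by simp
        ultimately show ?thesis by (simp add: mult_le_cancel_right1)
      qed
      finally show ?thesis by (simp add: bound_eq)
    qed
    then have "regret \<gamma> (rew M) P (pA M) \<pi> T h \<le> bound" if "h \<in> set_pmf (traj (T - 1))" for h
      using regret_le_trivial[of h n] that by (simp add: Tn)
    then have "measure_pmf.prob (traj (T - 1)) {h. regret \<gamma> (rew M) P (pA M) \<pi> T h \<le> bound} = 1"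
      by (subst measure_pmf.prob_eq_1) (auto simp: AE_measure_pmf_iff)
    then show ?thesis using \<delta> by simp
  next
    case False
    define \<epsilon> where "\<epsilon> = 2 * c * sqrt (2 * real n * ln (1 / \<delta>))"
    define E where "E = {h. \<forall>t\<in>{1..T}. wnorm (alg_Sigma M (transitions h) (t - 1)) (alg_theta M (transitions h) (t - 1) - \<theta>s) \<le> beta M t}"
    define G where "G = 2 * real D * ln (real D * (1 + real n))"
    define B where "B = beta M T"
    have dT: "real D \<le> sqrt (real T)" using False by simp
    have D1: "1 \<le> real D" using D0 by simp
    have l\<delta>: "ln (1 / \<delta>) \<le> l" "0 \<le> ln (1 / \<delta>)"
      using lnl[of "1 / \<delta>"] TU \<delta> by (simp_all add: divide_right_mono ln_div)
    have \<epsilon>0: "0 \<le> \<epsilon>" using c_pos l\<delta> by (simp add: \<epsilon>_def)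
    have \<epsilon>le: "\<epsilon> \<le> 4 * c * sqrt (real T) * l"
    proof -
      have "l \<le> l * l" using l1 by (simp add: mult_le_cancel_left1)
      with l\<delta> have "ln (1 / \<delta>) \<le> l * l" by linarith
      then have "2 * real n * ln (1 / \<delta>) \<le> 4 * real T * (l * l)"
        using l\<delta> Tn by (intro mult_mono) auto
      then have "sqrt (2 * real n * ln (1 / \<delta>)) \<le> sqrt (4 * real T * (l * l))" by (rule real_sqrt_le_mono)
      also have "\<dots> = 2 * sqrt (real T) * l" using l1 by (simp add: real_sqrt_mult)
      finally have "2 * c * sqrt (2 * real n * ln (1 / \<delta>)) \<le> 2 * c * (2 * sqrt (real T) * l)"
        using c_pos by (intro mult_left_mono) auto
      then show ?thesis by (simp add: \<epsilon>_def mult_ac)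
    qed
    have Gb: "0 \<le> G" "G \<le> 3 * real D * l"
    proof -
      have "1 * 1 \<le> real D * real T" using D1 RT by (intro mult_mono) auto
      then have DT: "1 \<le> real D * real T" by simp
      have Gn: "G = 2 * real D * ln (real D * real T)" by (simp add: G_def Tn add.commute)
      show "0 \<le> G" unfolding Gn using DT by simp
      \<comment> \<open>Here \<open>D \<le> sqrt T\<close> absorbs the dimension inside the
        logarithm, so that no separate \<open>ln D\<close> remains.\<close>
      have "ln (real D * real T) \<le> ln (sqrt (real T) * real T)"
        using DT dT RT by (intro ln_mono mult_right_mono) auto
      also have "\<dots> = 3 / 2 * ln (real T)" using RT by (simp add: ln_mult ln_sqrt)
      also have "ln (real T) \<le> l"
      proof -
        have "real T * \<delta> \<le> real T * U" using \<delta> U by (intro mult_left_mono) auto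
        then have "real T \<le> real T * U / \<delta>" using \<delta> by (simp add: pos_le_divide_eq)
        from lnl[OF _ this] T show ?thesis by simp
      qed
      finally have "ln (real D * real T) \<le> 3 / 2 * l" by simp
      then have "2 * real D * ln (real D * real T) \<le> 2 * real D * (3 / 2 * l)" by (intro mult_left_mono) auto
      then show "G \<le> 3 * real D * l" unfolding Gn by (simp add: mult_ac)
    qed
    have g: "real n * \<gamma> ^ NN M \<le> real D * sqrt (real T)"
    proof -
      have "ln (sqrt (real T) / real D) \<le> real (NN M) * (1 - \<gamma>)" using N disc by (simp add: pos_divide_le_eq)
      then have "exp (- (real (NN M) * (1 - \<gamma>))) \<le> exp (- ln (sqrt (real T) / real D))" by simp
      also have "\<dots> = real D / sqrt (real T)" using D1 RT by (simp add: exp_minus)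
      finally have "\<gamma> ^ NN M \<le> real D / sqrt (real T)" using power_le_exp_neg[OF disc(1), of "NN M"] by linarith
      then have "real n * \<gamma> ^ NN M \<le> real T * (real D / sqrt (real T))"
        using Tn disc by (intro mult_mono) auto
      also have "\<dots> = real D * (real T / sqrt (real T))" by simp
      also have "\<dots> = real D * sqrt (real T)" by (simp only: real_div_sqrt[OF of_nat_0_le_iff])
      finally show ?thesis .
    qed
    have good: "regret \<gamma> (rew M) P (pA M) \<pi> T h \<le> bound"
      if h: "h \<in> set_pmf (traj n)" and hE: "h \<in> E" and az: "path_sum Dm n h \<le> \<epsilon>" for h
    proof -
      have ev: "wnorm (alg_Sigma M (transitions h) j) (alg_theta M (transitions h) j - \<theta>s) \<le> beta M (Suc j)" if "j \<le> n" for j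
        using hE that Tn by (auto simp: E_def dest!: bspec[of _ _ "Suc j"])
      have lam0: "0 \<le> lam M" using lamL zero_le_power2[of L\<phi>] by linarith
      \<comment> \<open>\<open>F\<close> is the value of a polynomial and could be negative. On the
        confidence event \<open>beta M 1\<close> bounds a nonnegative norm, and
        \<open>ln (U / \<delta>)\<close> is positive, which forces \<open>F \<ge> 0\<close>. The
        norm is expanded by hand to include \<lambda> = 0.\<close>
      have "0 \<le> wnorm (alg_Sigma M (transitions h) 0) (alg_theta M (transitions h) 0 - \<theta>s)"
      proof -
        define v where "v = 0\<^sub>v D - \<theta>s"
        have "v \<in> carrier_vec D" using \<theta>s_carrier by (simp add: v_def)
        then have "scalar_prod v ((lam M \<cdot>\<^sub>m 1\<^sub>m D) *\<^sub>v v) = lam M * scalar_prod v v"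
          by (subst smult_mat_vec_one) auto
        moreover have "0 \<le> scalar_prod v v" by (simp add: scalar_prod_def sum_nonneg)
        ultimately show ?thesis using lam0 by (simp add: wnorm_def alg_at_0 flip: v_def)
      qed
      then have "0 \<le> beta M 1" using ev[of 0] by simp
      moreover have "0 < ln (U * real 1 / \<delta>)" using U \<delta> by (intro ln_gt_zero) (simp add: pos_less_divide_eq)
      ultimately have F0: "0 \<le> F" using D0 by (simp add: beta zero_le_mult_iff)
      have bmono: "beta M (Suc j) \<le> B" if "j \<le> n" for j
      proof -
        have "U * real (Suc j) / \<delta> \<le> U * real T / \<delta>"
          using U \<delta> that Tn by (intro divide_right_mono mult_left_mono) auto
        then have "ln (U * real (Suc j) / \<delta>) \<le> ln (U * real T / \<delta>)"
          using ge1[of "Suc j"] by (intro ln_mono) auto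
        then have "(ln (U * real (Suc j) / \<delta>))\<^sup>2 \<le> (ln (U * real T / \<delta>))\<^sup>2"
          using ge1[of "Suc j"] by (intro power_mono) auto
        then show ?thesis unfolding B_def beta using F0 by (intro mult_left_mono) auto
      qed
      have B0: "0 \<le> B" unfolding B_def beta using F0 by simp
      have "(ln (U * real T / \<delta>))\<^sup>2 \<le> l\<^sup>2"
        using ge1[OF T] by (intro power_mono) (auto simp: l_def mult.commute)
      then have Bl: "B \<le> F * sqrt (real D) * l\<^sup>2" unfolding B_def beta using F0 by (intro mult_left_mono) auto
      have "regret \<gamma> (rew M) P (pA M) \<pi> (Suc n) h
        \<le> c * (c + \<epsilon> + c * (4 * B * sqrt (real n * G) + 60 * B\<^sup>2 * G / \<kappa>) + real n * \<gamma> ^ NN M + c * G)"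
      proof (cases "0 < lam M")
        case True
        show ?thesis
          by (rule regret_bound[OF h True lamL D0 ev bmono \<kappa> kap az \<epsilon>0 G_def])
             (use h Tn in \<open>auto simp: n_def[symmetric]\<close>)
      next
        case False
        then have "L\<phi>\<^sup>2 \<le> 0" using lamL by linarith
        then have L0: "L\<phi> = 0" by simp
        have "regret \<gamma> (rew M) P (pA M) \<pi> (Suc n) h \<le> c * (c + \<epsilon> + real n * \<gamma> ^ NN M)"
          by (rule regret_bound_degenerate[OF h L0 lam0 az \<epsilon>0])
        also have "\<dots> \<le> c * (c + \<epsilon> + c * (4 * B * sqrt (real n * G) + 60 * B\<^sup>2 * G / \<kappa>) + real n * \<gamma> ^ NN M + c * G)"
        proof -
          have "0 \<le> c * (4 * B * sqrt (real n * G) + 60 * B\<^sup>2 * G / \<kappa>)" "0 \<le> c * G"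
            using c_pos B0 Gb \<kappa> by (auto intro!: mult_nonneg_nonneg add_nonneg_nonneg)
          then show ?thesis using c_pos by (intro mult_left_mono) auto
        qed
        finally show ?thesis .
      qed
      also have "\<dots> \<le> bound"
        unfolding bound_eq using Tn
        by (intro regret_arithmetic c_ge1 D1 RT l1 \<kappa> F0 B0 Bl Gb \<epsilon>le g) auto
      finally show ?thesis by (simp add: Tn)
    qed
    let ?t = "{h. regret \<gamma> (rew M) P (pA M) \<pi> T h \<le> bound}" and ?a = "{h. \<epsilon> < path_sum Dm n h}"
    have "1 - \<delta> \<le> measure_pmf.prob (traj n) E" using event by (simp add: E_def n_def)
    \<comment> \<open>\<open>good\<close> speaks of histories in the support, so the event is
      intersected with it before the comparison.\<close>
    also have "\<dots> = measure_pmf.prob (traj n) (E \<inter> set_pmf (traj n))" by (simp add: measure_Int_set_pmf)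
    also have "\<dots> \<le> measure_pmf.prob (traj n) (?t \<union> ?a)"
      using good by (intro measure_pmf.finite_measure_mono) force+
    also have "\<dots> \<le> measure_pmf.prob (traj n) ?t + measure_pmf.prob (traj n) ?a"
      by (rule measure_Un_le) auto
    also have "measure_pmf.prob (traj n) ?a \<le> \<delta>" using mart.azuma[OF \<delta>, of n] by (simp add: \<epsilon>_def)
    finally show ?thesis by (simp add: n_def)
  qed
qed

end

text \<open>\<open>f\<close> and \<open>k\<close> are chosen before all instance data, so they
  depend on \<open>f0\<close> alone. The probability hypothesis expresses, for the instance at hand,
  the property of \<open>f0\<close> that the radii are built on.\<close>

theorem theorem4:
  fixes f0 :: "real \<Rightarrow> real \<Rightarrow> real"
  assumes "poly2 f0"
  shows "\<exists>f :: real \<Rightarrow> real \<Rightarrow> real. \<exists>k :: nat. poly2 f \<and>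
   (\<forall>(S::nat set) (A::nat set) (r::nat \<Rightarrow> nat \<Rightarrow> real) (Ssa::nat \<Rightarrow> nat \<Rightarrow> nat set)
      (\<phi>::nat \<Rightarrow> nat \<Rightarrow> nat \<Rightarrow> real Matrix.vec) (d::nat) (\<theta>s::real Matrix.vec) (L\<theta>::real) (L\<phi>::real)
      (\<gamma>::real) (\<kappa>::real) (\<delta>::real) (\<eta>::real) (lam0::real) (N::nat) (T::nat) (s1::nat)
      (sel::(nat \<Rightarrow> nat \<Rightarrow> real) \<Rightarrow> nat \<Rightarrow> nat).
    let U = UU S A Ssa;
        P = trans_pmf \<phi> Ssa \<theta>s;
        M = \<lparr>pS = S, pA = A, rew = r, pSsa = Ssa, phi = \<phi>, dim = d, Lth = L\<theta>, disc = \<gamma>,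
             eta = \<eta>, lam = lam0, del = \<delta>, NN = N, beta = beta0 f0 L\<theta> L\<phi> d U \<delta>\<rparr>;
        \<pi> = ucmnlk_pol M sel;
        traj = run_pmf P \<pi> ([], s1) (T - 1)
    in
     (finite S \<and> finite A \<and> A \<noteq> {} \<and> s1 \<in> S \<and>
      (\<forall>s\<in>S. \<forall>a\<in>A. 0 \<le> r s a \<and> r s a \<le> 1) \<and>
      (\<forall>s\<in>S. \<forall>a\<in>A. Ssa s a \<subseteq> S \<and> Ssa s a \<noteq> {}) \<and>
      0 < d \<and> (\<forall>s\<in>S. \<forall>a\<in>A. \<forall>s'\<in>Ssa s a. \<phi> s a s' \<in> carrier_vec d) \<and> \<theta>s \<in> carrier_vec d \<and>
      (\<forall>s\<in>S. \<forall>a\<in>A. \<forall>s'\<in>Ssa s a. vnorm (\<phi> s a s') \<le> L\<phi>) \<and> vnorm \<theta>s \<le> L\<theta> \<and>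
      0 < \<kappa> \<and> \<kappa> < 1 \<and>
      (\<forall>h\<in>set_pmf traj. \<forall>i<T. \<forall>\<theta>\<in>Theta d L\<theta>.
          \<forall>s'\<in>Ssa (snd (hprefix h i)) (ucmnlk M sel (hprefix h i)).
          \<forall>s''\<in>Ssa (snd (hprefix h i)) (ucmnlk M sel (hprefix h i)).
            mnl \<phi> Ssa \<theta> (snd (hprefix h i)) (ucmnlk M sel (hprefix h i)) s' *
            mnl \<phi> Ssa \<theta> (snd (hprefix h i)) (ucmnlk M sel (hprefix h i)) s'' \<ge> \<kappa>) \<and>
      (\<forall>s\<in>S. \<forall>a\<in>A. \<exists>s'\<in>Ssa s a. \<phi> s a s' = 0\<^sub>v d) \<and>
      0 \<le> \<gamma> \<and> \<gamma> < 1 \<and> 0 < \<delta> \<and> \<delta> < 1 \<and> 1 \<le> T \<and>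
      \<eta> = 1/2 * ln (real U) + (L\<theta> * L\<phi> + 1) \<and>
      lam0 \<ge> 84 * sqrt 2 * (L\<theta> * L\<phi> ^ 3 + real d * L\<phi> ^ 2) * \<eta> \<and>
      real N \<ge> ln (sqrt (real T) / real d) / (1 - \<gamma>) \<and>
      (\<forall>Q s. sel Q s \<in> A \<and> (\<forall>a\<in>A. Q s a \<le> Q s (sel Q s))) \<and>
      measure_pmf.prob traj
        {h. \<forall>t\<in>{1..T}. case alg_state M (take (t - 1) (transitions h)) of (\<theta>h, \<Sigma>, _, _) \<Rightarrow>
              wnorm \<Sigma> (\<theta>h - \<theta>s) \<le> beta0 f0 L\<theta> L\<phi> d U \<delta> t} \<ge> 1 - \<delta>
    \<longrightarrow>
      measure_pmf.prob traj
        {h. regret \<gamma> r P A \<pi> T h \<le>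
              f L\<theta> L\<phi> * (1 + ln (real T * real U / \<delta>)) ^ k *
              (real d * sqrt (real T) / (1 - \<gamma>) ^ 2 + real d ^ 2 / (\<kappa> * (1 - \<gamma>) ^ 2))}
        \<ge> 1 - 2 * \<delta>))"
proof -
  \<comment> \<open>\<open>M\<close> is kept as a variable with a defining equation while the locale
    is instantiated; reflexivity replaces it by the record at the end.\<close>
  have body: "1 - 2 * \<delta> \<le> measure_pmf.prob (run_pmf (trans_pmf \<phi> Ssa \<theta>s) (ucmnlk_pol M sel) ([], s1) (T - 1))
        {h. regret \<gamma> r (trans_pmf \<phi> Ssa \<theta>s) A (ucmnlk_pol M sel) T h \<le>
              180 * (1 + (f0 L\<theta> L\<phi>)\<^sup>2) * (1 + ln (real T * real (UU S A Ssa) / \<delta>)) ^ 5 *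
              (real d * sqrt (real T) / (1 - \<gamma>) ^ 2 + real d ^ 2 / (\<kappa> * (1 - \<gamma>) ^ 2))}"
    if M: "M = \<lparr>pS = S, pA = A, rew = r, pSsa = Ssa, phi = \<phi>, dim = d, Lth = L\<theta>, disc = \<gamma>,
             eta = \<eta>, lam = lam0, del = \<delta>, NN = N, beta = beta0 f0 L\<theta> L\<phi> d (UU S A Ssa) \<delta>\<rparr>"
      and S: "finite S" and A: "finite A" "A \<noteq> {}" and s1: "s1 \<in> S"
      and r: "\<forall>s\<in>S. \<forall>a\<in>A. 0 \<le> r s a \<and> r s a \<le> 1"
      and Ssa: "\<forall>s\<in>S. \<forall>a\<in>A. Ssa s a \<subseteq> S \<and> Ssa s a \<noteq> {}"
      and d: "0 < d"
      and \<phi>: "\<forall>s\<in>S. \<forall>a\<in>A. \<forall>s'\<in>Ssa s a. \<phi> s a s' \<in> carrier_vec d" and \<theta>s: "\<theta>s \<in> carrier_vec d"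
      and \<phi>L: "\<forall>s\<in>S. \<forall>a\<in>A. \<forall>s'\<in>Ssa s a. vnorm (\<phi> s a s') \<le> L\<phi>" and \<theta>L: "vnorm \<theta>s \<le> L\<theta>"
      and \<kappa>: "0 < \<kappa>"
      and kap: "\<forall>h\<in>set_pmf (run_pmf (trans_pmf \<phi> Ssa \<theta>s) (ucmnlk_pol M sel) ([], s1) (T - 1)). \<forall>i<T. \<forall>\<theta>\<in>Theta d L\<theta>.
          \<forall>s'\<in>Ssa (snd (hprefix h i)) (ucmnlk M sel (hprefix h i)).
          \<forall>s''\<in>Ssa (snd (hprefix h i)) (ucmnlk M sel (hprefix h i)).
            mnl \<phi> Ssa \<theta> (snd (hprefix h i)) (ucmnlk M sel (hprefix h i)) s' *
            mnl \<phi> Ssa \<theta> (snd (hprefix h i)) (ucmnlk M sel (hprefix h i)) s'' \<ge> \<kappa>"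
      and z: "\<forall>s\<in>S. \<forall>a\<in>A. \<exists>s'\<in>Ssa s a. \<phi> s a s' = 0\<^sub>v d"
      and \<gamma>: "0 \<le> \<gamma>" "\<gamma> < 1" and \<delta>: "0 < \<delta>" "\<delta> < 1" and T: "1 \<le> T"
      and \<eta>: "\<eta> = 1/2 * ln (real (UU S A Ssa)) + (L\<theta> * L\<phi> + 1)"
      and lam: "lam0 \<ge> 84 * sqrt 2 * (L\<theta> * L\<phi> ^ 3 + real d * L\<phi> ^ 2) * \<eta>"
      and N: "real N \<ge> ln (sqrt (real T) / real d) / (1 - \<gamma>)"
      and sel: "\<forall>Q s. sel Q s \<in> A \<and> (\<forall>a\<in>A. Q s a \<le> Q s (sel Q s))"
      and event: "measure_pmf.prob (run_pmf (trans_pmf \<phi> Ssa \<theta>s) (ucmnlk_pol M sel) ([], s1) (T - 1))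
        {h. \<forall>t\<in>{1..T}. case alg_state M (take (t - 1) (transitions h)) of (\<theta>h, \<Sigma>, _, _) \<Rightarrow>
              wnorm \<Sigma> (\<theta>h - \<theta>s) \<le> beta0 f0 L\<theta> L\<phi> d (UU S A Ssa) \<delta> t} \<ge> 1 - \<delta>"
    for S A :: "nat set" and r Ssa \<phi> d \<theta>s L\<theta> L\<phi> \<gamma> \<kappa> \<delta> \<eta> lam0 N T s1 sel M
  proof -
    have [simp]: "pS M = S" "pA M = A" "rew M = r" "pSsa M = Ssa" "phi M = \<phi>" "dim M = d" "Lth M = L\<theta>"
      "disc M = \<gamma>" "lam M = lam0" "NN M = N" "beta M = beta0 f0 L\<theta> L\<phi> d (UU S A Ssa) \<delta>"
      by (simp_all add: M)
    interpret R: ucmnlk_run M \<theta>s L\<phi> sel s1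
      by unfold_locales (use S A r Ssa \<phi> \<phi>L z \<theta>s \<theta>L \<gamma> sel s1 in \<open>auto simp: Theta_def\<close>)
    obtain a where a: "a \<in> A" using A by blast
    obtain s' where s': "s' \<in> Ssa s1 a" using Ssa s1 a by blast
    have L\<phi>0: "0 \<le> L\<phi>" using \<phi>L s1 a s' R.vnorm_nonneg[of "\<phi> s1 a s'"] by (meson order.trans)
    have L\<theta>0: "0 \<le> L\<theta>" using R.Lth_nonneg by simp
    have "1 \<le> card (Ssa s1 a)"
      using s' Ssa s1 a finite_subset[OF _ S] by (metis One_nat_def Suc_leI card_gt_0_iff)
    also have "card (Ssa s1 a) \<le> UU S A Ssa"
    proof -
      have "{card (Ssa s a) | s a. s \<in> S \<and> a \<in> A} = (\<lambda>(s, a). card (Ssa s a)) ` (S \<times> A)" by auto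
      then have "finite {card (Ssa s a) | s a. s \<in> S \<and> a \<in> A}" using S A by simp
      then show ?thesis unfolding UU_def using s1 a by (intro Max_ge) auto
    qed
    finally have U: "1 \<le> real (UU S A Ssa)" by simp
    \<comment> \<open>The hypothesis on \<lambda> is reduced to this form by
      \<open>\<eta> \<ge> 1\<close>, \<open>84 * sqrt 2 \<ge> 4\<close> and
      \<open>d \<ge> 1\<close>.\<close>
    have lamL: "4 * L\<phi>\<^sup>2 \<le> lam0"
    proof -
      have "0 \<le> ln (real (UU S A Ssa))" using U by simp
      then have \<eta>1: "1 \<le> \<eta>" unfolding \<eta> using L\<phi>0 L\<theta>0 by simp
      have "1 \<le> sqrt (2 :: real)" by simp
      then have s2: "4 \<le> 84 * sqrt (2 :: real)" by linarith
      have "L\<phi>\<^sup>2 \<le> real d * L\<phi>\<^sup>2" using d by (simp add: mult_le_cancel_right1)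
      also have "\<dots> \<le> L\<theta> * L\<phi> ^ 3 + real d * L\<phi>\<^sup>2" using L\<phi>0 L\<theta>0 by simp
      finally have q: "L\<phi>\<^sup>2 \<le> L\<theta> * L\<phi> ^ 3 + real d * L\<phi>\<^sup>2" .
      have "4 * L\<phi>\<^sup>2 * 1 \<le> (84 * sqrt 2) * (L\<theta> * L\<phi> ^ 3 + real d * L\<phi>\<^sup>2) * \<eta>"
        by (intro mult_mono s2 q \<eta>1) (use L\<phi>0 L\<theta>0 in auto)
      then show ?thesis using lam by linarith
    qed
    have "1 - 2 * \<delta> \<le> measure_pmf.prob (run_pmf (trans_pmf (phi M) (pSsa M) \<theta>s) (ucmnlk_pol M sel) ([], s1) (T - 1))
       {h. regret (disc M) (rew M) (trans_pmf (phi M) (pSsa M) \<theta>s) (pA M) (ucmnlk_pol M sel) T h \<le> 180 * (1 + (f0 L\<theta> L\<phi>)\<^sup>2) * (1 + ln (real T * real (UU S A Ssa) / \<delta>)) ^ 5 *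
         (real (dim M) * sqrt (real T) / (1 - disc M)\<^sup>2 + (real (dim M))\<^sup>2 / (\<kappa> * (1 - disc M)\<^sup>2))}"
    proof (rule R.regret_whp[OF T _ \<kappa> \<delta> U])
      show "1 - \<delta> \<le> measure_pmf.prob (run_pmf (trans_pmf (phi M) (pSsa M) \<theta>s) (ucmnlk_pol M sel) ([], s1) (T - 1)) {h. \<forall>t\<in>{1..T}.
          wnorm (alg_Sigma M (transitions h) (t - 1)) (alg_theta M (transitions h) (t - 1) - \<theta>s) \<le> beta M t}"
        using event by (simp add: alg_Sigma_def alg_theta_def alg_at_def case_prod_beta)
    qed (use d lamL N kap in \<open>auto simp: beta0_def\<close>)
    then show ?thesis by simp
  qed
  show ?thesis
    unfolding Let_def
    by (intro exI[of _ "\<lambda>x y. 180 * (1 + (f0 x y)\<^sup>2)"] exI[of _ 5] conjI allI impI poly2_affine_square assms,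
        elim conjE, rule body[OF refl]) assumption+
qed

end
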